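(* Let $\mathcal R$ be the recursion operator of the sine-Gordon equation $\phi_{xy}=\sin\phi$ given by $\mathcal R\Phi=\Phi_{xx}+\phi_xQ$, $Q_x=\Phi_x\phi_x$, $Q_y=\Phi\sin\phi$. Let $\mathcal P,\mathcal Q\in\mathbb R[\mathcal R]$ be polynomials in $\mathcal R$ with real coefficients, with $\mathcal Q\not\equiv0$. Then the operator $\mathcal P\circ\mathcal Q^{-1}$, corresponding to the formal fraction $\mathcal P/\mathcal Q$, is a Bäcklund auto-transformation of the Moutard equation $\Phi_{xy}=\Phi\cos\phi$.
   Context: All functions are smooth, on connected, simply connected open sets in the $(x,y)$-plane on which $\sin\phi\neq0$, where $\phi$ denotes a solution of the sine-Gordon equation $\phi_{xy}=\sin\phi$. $\mathcal R$ is a multivalued linear operator on solutions of the Moutard equation $\Phi_{xy}=\Phi\cos\phi$: $\mathcal R\Phi$ is the set of all $\Phi_{xx}+\phi_xQ$ with $Q$ satisfying the displayed equations ($Q$ is unique up to an additive constant). Operators are composed, added and multiplied by real numbers as multivalued operators: $(\mathcal U\circ\mathcal V)\Phi=\mathcal U\mathcal V\Phi$, $(\mathcal U+\mathcal V)\Phi=\mathcal U\Phi+\mathcal V\Phi$, $(r\,\mathcal U)\Phi=r\,\mathcal U\Phi$ (for all possible values). A polynomial in $\mathcal R$ is $\nu_n\mathcal R^n+\cdots+\nu_1\mathcal R+\nu_0\mathrm{Id}$, $\nu_i\in\mathbb R$. Such an operator is $\equiv0$ if it is trivial, i.e. of the form $\Phi\mapsto W^{(1)}\Sigma^{(1)}+\cdots+W^{(k)}\Sigma^{(k)}$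 with $\Sigma^{(i)}$ fixed symmetries of the sine-Gordon equation (functions of $x,y,\phi$ and finitely many derivatives of $\phi$ satisfying $\Sigma_{xy}=\Sigma\cos\phi$ for all solutions $\phi$), independent of $\Phi$, and $W^{(i)}$ arbitrary constants; for polynomials in $\mathcal R$, $\mathcal Q\not\equiv0$ amounts to $\mathcal Q$ being a nonzero polynomial. Inverses are taken in the sense of relations: $\Phi\in\mathcal Q^{-1}\Psi$ if and only if $\Phi$ solves the Moutard equation and $\Psi\in\mathcal Q\Phi$. A Bäcklund auto-transformation of the Moutard equation (equivalently, a recursion operator in Guthrie's form) is a correspondence $\Psi\mapsto\Theta$ between solutions of the Moutard equation with the same $\phi$ which is given by a linear system $w_x=Aw+a$, $w_y=Bw+b$ for finitely many auxiliary functions $w=(w^1,\dots,w^m)$, together with a formula for $\Theta$. Here $A,B$ are matrices depending on $x,y,\phi$ and derivatives of $\phi$; $a,b$ are linear in $\Psi$ and its derivatives, with coefficients depending on $x,y,\phi$ and derivatives of $\phi$; the system is compatible (the condition $(w_x)_y=(w_y)_x$ holds identically) whenever $\phi$ solves the sine-Gordon equation and $\Psi$ solves the Moutard equation; and $\Theta$ is given as a linear expression in $w$, $\Psi$ and derivatives of $\Psi$ (with coefficients of the same kind) and again satisfies $\Theta_{xy}=\Theta\cos\phi$. *)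

theory Defs
  imports "HOL-Analysis.Analysis" "HOL-Computational_Algebra.Polynomial"
begin

section \<open>Smooth functions in the plane\<close>

type_synonym plane = "real \<times> real"
type_synonym pfun = "plane \<Rightarrow> real"

definition dx :: "pfun \<Rightarrow> pfun" where
  "dx f p = deriv (\<lambda>t. f (t, snd p)) (fst p)"

definition dy :: "pfun \<Rightarrow> pfun" where
  "dy f p = deriv (\<lambda>t. f (fst p, t)) (snd p)"

definition pd :: "nat \<Rightarrow> nat \<Rightarrow> pfun \<Rightarrow> pfun" where
  "pd i j f = (dx ^^ i) ((dy ^^ j) f)"

text \<open>On an open set \<open>U\<close> this is \<open>k\<close>-fold continuous differentiability.\<close>

primrec Ck :: "nat \<Rightarrow> plane set \<Rightarrow> pfun \<Rightarrow> bool" where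
  "Ck 0 U f \<longleftrightarrow> continuous_on U f"
| "Ck (Suc k) U f \<longleftrightarrow>
     (\<exists>f'. (\<forall>p\<in>U. (f has_derivative f' p) (at p)) \<and> (\<forall>v. Ck k U (\<lambda>p. f' p v)))"

definition smooth :: "plane set \<Rightarrow> pfun \<Rightarrow> bool" where
  "smooth U f \<longleftrightarrow> (\<forall>k. Ck k U f)"

section \<open>The sine-Gordon and Moutard equations\<close>

text \<open>
  Functions defined on \<open>U\<close> are represented by total functions whose values outside the open
  set \<open>U\<close> are irrelevant; equality of functions on \<open>U\<close> is always stated pointwise on \<open>U\<close>.
\<close>

definition sine_gordon :: "plane set \<Rightarrow> pfun \<Rightarrow> bool" where
  "sine_gordon U \<phi> \<longleftrightarrow> smooth U \<phi> \<and> (\<forall>p\<in>U. dy (dx \<phi>) p = sin (\<phi> p))"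

definition background :: "plane set \<Rightarrow> pfun \<Rightarrow> bool" where
  "background U \<phi> \<longleftrightarrow>
     open U \<and> connected U \<and> simply_connected U \<and>
     sine_gordon U \<phi> \<and> (\<forall>p\<in>U. sin (\<phi> p) \<noteq> 0)"

definition moutard :: "plane set \<Rightarrow> pfun \<Rightarrow> pfun \<Rightarrow> bool" where
  "moutard U \<phi> \<Phi> \<longleftrightarrow> smooth U \<Phi> \<and> (\<forall>p\<in>U. dy (dx \<Phi>) p = \<Phi> p * cos (\<phi> p))"

section \<open>Multivalued operators\<close>

type_synonym mop = "pfun \<Rightarrow> pfun set"

definition mop_id :: "plane set \<Rightarrow> mop" where
  "mop_id U \<Phi> = {\<Psi>. \<forall>p\<in>U. \<Psi> p = \<Phi> p}"

definition mop_comp :: "mop \<Rightarrow> mop \<Rightarrow> mop" where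
  "mop_comp S T \<Phi> = (\<Union>\<Psi>\<in>T \<Phi>. S \<Psi>)"

definition mop_add :: "plane set \<Rightarrow> mop \<Rightarrow> mop \<Rightarrow> mop" where
  "mop_add U S T \<Phi> = {\<Psi>. \<exists>f\<in>S \<Phi>. \<exists>g\<in>T \<Phi>. \<forall>p\<in>U. \<Psi> p = f p + g p}"

definition mop_scale :: "plane set \<Rightarrow> real \<Rightarrow> mop \<Rightarrow> mop" where
  "mop_scale U r S \<Phi> = {\<Psi>. \<exists>f\<in>S \<Phi>. \<forall>p\<in>U. \<Psi> p = r * f p}"

primrec mop_pow :: "plane set \<Rightarrow> mop \<Rightarrow> nat \<Rightarrow> mop" where
  "mop_pow U S 0 = mop_id U"
| "mop_pow U S (Suc n) = mop_comp S (mop_pow U S n)"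

text \<open>
  \<open>mop_poly_upto U S \<nu> n\<close> is \<open>\<nu>\<^sub>n S\<^sup>n + \<dots> + \<nu>\<^sub>1 S + \<nu>\<^sub>0 Id\<close>; the values of the different
  powers of \<open>S\<close> are chosen independently of each other.
\<close>

primrec mop_poly_upto :: "plane set \<Rightarrow> mop \<Rightarrow> (nat \<Rightarrow> real) \<Rightarrow> nat \<Rightarrow> mop" where
  "mop_poly_upto U S \<nu> 0 = mop_scale U (\<nu> 0) (mop_id U)"
| "mop_poly_upto U S \<nu> (Suc n) =
     mop_add U (mop_scale U (\<nu> (Suc n)) (mop_pow U S (Suc n))) (mop_poly_upto U S \<nu> n)"

definition mop_poly :: "plane set \<Rightarrow> mop \<Rightarrow> real poly \<Rightarrow> mop" where
  "mop_poly U S P = mop_poly_upto U S (coeff P) (degree P)"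

definition mop_inv :: "plane set \<Rightarrow> pfun \<Rightarrow> mop \<Rightarrow> mop" where
  "mop_inv U \<phi> S \<Psi> = {\<Phi>. moutard U \<phi> \<Phi> \<and> \<Psi> \<in> S \<Phi>}"

definition sg_recursion :: "plane set \<Rightarrow> pfun \<Rightarrow> mop" where
  "sg_recursion U \<phi> \<Phi> = {\<Psi>. \<exists>q. smooth U q \<and>
     (\<forall>p\<in>U. dx q p = dx \<Phi> p * dx \<phi> p \<and>
            dy q p = \<Phi> p * sin (\<phi> p) \<and>
            \<Psi> p = dx (dx \<Phi>) p + dx \<phi> p * q p)}"

section \<open>Functions of \<open>x\<close>, \<open>y\<close>, \<open>\<phi>\<close> and derivatives of \<open>\<phi>\<close>\<close>

text \<open>\<open>D i j\<close> is the jet coordinate of \<open>\<partial>\<^sub>x\<^sup>i \<partial>\<^sub>y\<^sup>j \<phi>\<close>; in particular \<open>D 0 0\<close> is that of \<open>\<phi>\<close>.\<close>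

datatype coord = X | Y | D nat nat

type_synonym jetfun = "(coord \<Rightarrow> real) \<Rightarrow> real"

primrec jet :: "pfun \<Rightarrow> plane \<Rightarrow> coord \<Rightarrow> real" where
  "jet \<phi> p X = fst p"
| "jet \<phi> p Y = snd p"
| "jet \<phi> p (D i j) = pd i j \<phi> p"

definition jet_domain :: "(coord \<Rightarrow> real) set" where
  "jet_domain = {u. sin (u (D 0 0)) \<noteq> 0}"

text \<open>
  Continuity refers to the product topology. For functions of finitely many of the
  coordinates, \<open>jet_Ck k\<close> is therefore the usual class of \<open>k\<close> times continuously
  differentiable functions: all partial derivatives up to order \<open>k\<close> exist and are continuous.
\<close>

primrec jet_Ck :: "nat \<Rightarrow> jetfun \<Rightarrow> bool" where
  "jet_Ck 0 F \<longleftrightarrow> continuous_on jet_domain F"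
| "jet_Ck (Suc k) F \<longleftrightarrow> continuous_on jet_domain F \<and>
     (\<exists>G. \<forall>c. (\<forall>u\<in>jet_domain. ((\<lambda>t. F (u(c := t))) has_real_derivative G c u) (at (u c)))
            \<and> jet_Ck k (G c))"

definition finite_order :: "jetfun \<Rightarrow> bool" where
  "finite_order F \<longleftrightarrow> (\<exists>N. \<forall>u\<in>jet_domain. \<forall>v\<in>jet_domain.
     u X = v X \<and> u Y = v Y \<and> (\<forall>i j. i + j \<le> N \<longrightarrow> u (D i j) = v (D i j)) \<longrightarrow> F u = F v)"

definition jet_smooth :: "jetfun \<Rightarrow> bool" where
  "jet_smooth F \<longleftrightarrow> finite_order F \<and> (\<forall>k. jet_Ck k F)"

section \<open>Baecklund auto-transformations of the Moutard equation\<close>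

text \<open>
  The data of a linear system \<open>w\<^sub>x = A w + a\<close>, \<open>w\<^sub>y = B w + b\<close> for \<open>w\<^sup>0, \<dots>, w\<^sup>m\<^sup>-\<^sup>1\<close> and of a
  formula \<open>\<Theta> = C w + c\<close>, where \<open>m = nvars\<close>. Indices of matrices and vectors range over
  \<open>{..<nvars}\<close>. The terms \<open>a\<close>, \<open>b\<close>, \<open>c\<close> are linear in the derivatives
  \<open>\<partial>\<^sub>x\<^sup>i \<partial>\<^sub>y\<^sup>j \<Psi>\<close>, \<open>i, j \<le> psi_order\<close>, and are given by their coefficients, with \<open>i\<close> and \<open>j\<close> as
  the last two indices.
\<close>

record guthrie =
  nvars :: nat
  psi_order :: nat
  matA :: "nat \<Rightarrow> nat \<Rightarrow> jetfun"
  matB :: "nat \<Rightarrow> nat \<Rightarrow> jetfun"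
  inhA :: "nat \<Rightarrow> nat \<Rightarrow> nat \<Rightarrow> jetfun"
  inhB :: "nat \<Rightarrow> nat \<Rightarrow> nat \<Rightarrow> jetfun"
  outW :: "nat \<Rightarrow> jetfun"
  outPsi :: "nat \<Rightarrow> nat \<Rightarrow> jetfun"

definition lin_diff :: "nat \<Rightarrow> (nat \<Rightarrow> nat \<Rightarrow> jetfun) \<Rightarrow> pfun \<Rightarrow> pfun \<Rightarrow> pfun" where
  "lin_diff N \<alpha> \<phi> \<Psi> p = (\<Sum>i\<le>N. \<Sum>j\<le>N. \<alpha> i j (jet \<phi> p) * pd i j \<Psi> p)"

definition smooth_coeffs :: "guthrie \<Rightarrow> bool" where
  "smooth_coeffs S \<longleftrightarrow>
     (\<forall>i<nvars S. \<forall>j<nvars S. jet_smooth (matA S i j) \<and> jet_smooth (matB S i j)) \<and>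
     (\<forall>i<nvars S. jet_smooth (outW S i)) \<and>
     (\<forall>k\<le>psi_order S. \<forall>l\<le>psi_order S. jet_smooth (outPsi S k l) \<and>
        (\<forall>i<nvars S. jet_smooth (inhA S i k l) \<and> jet_smooth (inhB S i k l)))"

definition rhs_x :: "guthrie \<Rightarrow> pfun \<Rightarrow> pfun \<Rightarrow> (nat \<Rightarrow> real) \<Rightarrow> nat \<Rightarrow> pfun" where
  "rhs_x S \<phi> \<Psi> v i p =
     (\<Sum>j<nvars S. matA S i j (jet \<phi> p) * v j) + lin_diff (psi_order S) (inhA S i) \<phi> \<Psi> p"

definition rhs_y :: "guthrie \<Rightarrow> pfun \<Rightarrow> pfun \<Rightarrow> (nat \<Rightarrow> real) \<Rightarrow> nat \<Rightarrow> pfun" where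
  "rhs_y S \<phi> \<Psi> v i p =
     (\<Sum>j<nvars S. matB S i j (jet \<phi> p) * v j) + lin_diff (psi_order S) (inhB S i) \<phi> \<Psi> p"

text \<open>
  The condition \<open>(w\<^sub>x)\<^sub>y = (w\<^sub>y)\<^sub>x\<close>, as an identity in the value \<open>v\<close> of \<open>w\<close> at \<open>p\<close>: with \<open>v\<close> held
  constant, \<open>dy (rhs_x S \<phi> \<Psi> v i)\<close> is \<open>A\<^sub>y v + a\<^sub>y\<close>, and the sum is \<open>A w\<^sub>y\<close> with \<open>w\<^sub>y\<close> replaced
  by its expression in terms of \<open>v\<close>.
\<close>

definition compatible :: "guthrie \<Rightarrow> plane set \<Rightarrow> pfun \<Rightarrow> pfun \<Rightarrow> bool" where
  "compatible S U \<phi> \<Psi> \<longleftrightarrow> (\<forall>p\<in>U. \<forall>v. \<forall>i<nvars S.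
     dy (rhs_x S \<phi> \<Psi> v i) p + (\<Sum>j<nvars S. matA S i j (jet \<phi> p) * rhs_y S \<phi> \<Psi> v j p) =
     dx (rhs_y S \<phi> \<Psi> v i) p + (\<Sum>j<nvars S. matB S i j (jet \<phi> p) * rhs_x S \<phi> \<Psi> v j p))"

definition solves_system ::
  "guthrie \<Rightarrow> plane set \<Rightarrow> pfun \<Rightarrow> pfun \<Rightarrow> (nat \<Rightarrow> pfun) \<Rightarrow> bool" where
  "solves_system S U \<phi> \<Psi> w \<longleftrightarrow> (\<forall>i<nvars S. smooth U (w i) \<and>
     (\<forall>p\<in>U. dx (w i) p = rhs_x S \<phi> \<Psi> (\<lambda>j. w j p) i p \<and>
            dy (w i) p = rhs_y S \<phi> \<Psi> (\<lambda>j. w j p) i p))"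

definition correspondence :: "guthrie \<Rightarrow> plane set \<Rightarrow> pfun \<Rightarrow> mop" where
  "correspondence S U \<phi> \<Psi> = {\<Theta>. \<exists>w. solves_system S U \<phi> \<Psi> w \<and>
     (\<forall>p\<in>U. \<Theta> p = (\<Sum>i<nvars S. outW S i (jet \<phi> p) * w i p)
                   + lin_diff (psi_order S) (outPsi S) \<phi> \<Psi> p)}"

text \<open>
  \<open>T U \<phi>\<close> is the operator \<open>\<Psi> \<mapsto> \<Theta>\<close> over the solution \<open>\<phi>\<close> on \<open>U\<close>. One system serves all
  \<open>U\<close>, \<open>\<phi>\<close> and \<open>\<Psi>\<close>.
\<close>

definition baecklund_auto :: "(plane set \<Rightarrow> pfun \<Rightarrow> mop) \<Rightarrow> bool" where
  "baecklund_auto T \<longleftrightarrow> (\<exists>S :: guthrie. smooth_coeffs S \<and>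
     (\<forall>U \<phi> \<Psi>. background U \<phi> \<and> moutard U \<phi> \<Psi> \<longrightarrow>
        compatible S U \<phi> \<Psi> \<and>
        (\<forall>\<Theta>\<in>correspondence S U \<phi> \<Psi>. moutard U \<phi> \<Theta>) \<and>
        T U \<phi> \<Psi> = correspondence S U \<phi> \<Psi>))"

end

theory Submission
  imports Defs
begin

text \<open>
  If \<open>\<Psi> \<in> \<R>\<Phi>\<close> with potential \<open>Q\<close>, then \<open>\<Psi>\<^sub>y = \<Phi>\<^sub>x cos \<phi> + Q sin \<phi>\<close>, so along a chain
  \<open>\<Phi>\<^sub>0, \<Phi>\<^sub>1 \<in> \<R>\<Phi>\<^sub>0, \<dots>\<close> the functions \<open>\<Phi>\<^sub>k\<close>, \<open>\<partial>\<^sub>x \<Phi>\<^sub>k\<close>, \<open>Q\<^sub>k\<close> satisfy a linear system which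
  is closed at both ends by the relation \<open>\<Sum> \<nu>\<^sub>k \<Phi>\<^sub>k = \<Psi>\<close> if its first and last coefficients do
  not vanish. A factor \<open>\<R>\<^sup>l\<close> of the denominator is inverted separately: \<open>\<R>\<^sup>-\<^sup>1\<close> is \<open>\<R>\<close> with \<open>x\<close>
  and \<open>y\<close> exchanged. Finally \<open>\<R>\<close>, sums and multiples only adjoin potentials to a given system.
  The values of a polynomial of degree \<open>n\<close> in \<open>\<R>\<close> can all be computed from a single chain, since
  the ambiguity of \<open>\<nu>\<^sub>0 \<Phi>\<^sub>0 + \<dots> + \<nu>\<^sub>n \<Phi>\<^sub>n\<close> already exhausts \<open>\<R>\<^sup>n 0\<close>.

  Compatibility and the Moutard equation have to hold identically in the values of the
  unknowns, not only on solutions. They are therefore checked on formal expressions which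
  are linear in the unknowns and in the derivatives of \<open>\<Psi>\<close>, with polynomials in
  \<open>sin \<phi>\<close>, \<open>cos \<phi>\<close> and the derivatives of \<open>\<phi>\<close> as coefficients.
\<close>

section \<open>Calculus in the plane\<close>

text \<open>Numerator and denominator are treated differently, because only the numerator acts on a
  function that is already known. In \<open>P\<close> every power of the operator may use potentials
  of its own, each of them one more quadrature over the system built so far. In \<open>Q\<close> the
  argument \<open>\<Phi>\<close> is itself unknown, and independent potentials would leave many
  chain ends tied by one relation. Along a single chain exactly two quantities lack a formula,
  \<open>\<Phi>_n\<close> and the y-derivative of \<open>\<Phi>_0\<close>; the relation and its
  y-derivative supply them. This is why the single chain matters for \<open>Q\<close>. Reducing to
  it takes only linearity and the fact that 0 is a value of the operator at 0, so that chains
  starting at 0 can be prefixed by zeros. The formal calculus treats the derivatives of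
  \<open>\<phi>\<close> and \<open>\<Psi>\<close> as free symbols, which makes the total derivatives
  commute by inspection; the two equations enter only when expressions are compared by value. The
  only divisions are by the constants \<open>\<nu> 0\<close> and \<open>\<nu> n\<close>, so the
  coefficients remain polynomial.\<close>

lemma has_derivative_partials:
  fixes f :: pfun
  assumes "(f has_derivative f') (at p)"
  shows "((\<lambda>t. f (t, snd p)) has_real_derivative f' (1, 0)) (at (fst p))"
    and "((\<lambda>t. f (fst p, t)) has_real_derivative f' (0, 1)) (at (snd p))"
proof -
  have lin: "linear f'"
    using assms has_derivative_linear by blast
  have "((\<lambda>t. f (t, snd p)) has_derivative (\<lambda>h. f' (h, 0))) (at (fst p))"
    using assms by (intro has_derivative_compose[of "\<lambda>t. (t, snd p)", where g = f])
      (auto intro!: derivative_eq_intros)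
  moreover have "(\<lambda>h. f' (h, 0)) = (\<lambda>h. f' (1, 0) * h)"
  proof
    fix h :: real
    show "f' (h, 0) = f' (1, 0) * h"
      using linear_scale[OF lin, of h "(1, 0)"] by simp
  qed
  ultimately show "((\<lambda>t. f (t, snd p)) has_real_derivative f' (1, 0)) (at (fst p))"
    by (simp add: has_field_derivative_def)
  have "((\<lambda>t. f (fst p, t)) has_derivative (\<lambda>h. f' (0, h))) (at (snd p))"
    using assms by (intro has_derivative_compose[of "\<lambda>t. (fst p, t)", where g = f])
      (auto intro!: derivative_eq_intros)
  moreover have "(\<lambda>h. f' (0, h)) = (\<lambda>h. f' (0, 1) * h)"
  proof
    fix h :: real
    show "f' (0, h) = f' (0, 1) * h"
      using linear_scale[OF lin, of h "(0, 1)"] by simp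
  qed
  ultimately show "((\<lambda>t. f (fst p, t)) has_real_derivative f' (0, 1)) (at (snd p))"
    by (simp add: has_field_derivative_def)
qed

locale plane_domain =
  fixes U :: "plane set"
  assumes open_U: "open U"
begin

text \<open>Derivatives at a point of \<open>U\<close> only see values nearby, so openness of
  \<open>U\<close> makes the values outside irrelevant.\<close>

lemma Ck_cong:
  assumes "Ck k U f" "\<And>p. p \<in> U \<Longrightarrow> f p = g p"
  shows "Ck k U g"
proof (cases k)
  case 0
  then show ?thesis using assms continuous_on_cong[of U U f g] by simp
next
  case (Suc j)
  then obtain f' where f': "\<forall>p\<in>U. (f has_derivative f' p) (at p)" "\<forall>v. Ck j U (\<lambda>p. f' p v)"
    using assms by auto
  have "\<forall>p\<in>U. (g has_derivative f' p) (at p)"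
    using f'(1) assms(2) open_U by (blast intro: has_derivative_transform_within_open)
  with f'(2) Suc show ?thesis by auto
qed

lemma Ck_Suc_imp: "Ck (Suc k) U f \<Longrightarrow> Ck k U f"
proof (induction k arbitrary: f)
  case 0
  then show ?case
    by (auto intro!: continuous_at_imp_continuous_on dest: has_derivative_continuous)
next
  case (Suc k)
  then show ?case by (metis Ck.simps(2))
qed

lemma Ck_const: "Ck k U (\<lambda>_. c)"
proof (induction k arbitrary: c)
  case (Suc k)
  have "\<forall>p\<in>U. ((\<lambda>_. c) has_derivative (\<lambda>_. 0)) (at p)" by simp
  with Suc show ?case unfolding Ck.simps by (intro exI[of _ "\<lambda>_ _. 0"]) simp
qed simp

lemma Ck_add: "Ck k U f \<Longrightarrow> Ck k U g \<Longrightarrow> Ck k U (\<lambda>p. f p + g p)"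
proof (induction k arbitrary: f g)
  case (Suc k)
  from Suc.prems obtain f' g' where
    "\<forall>p\<in>U. (f has_derivative f' p) (at p)" "\<forall>v. Ck k U (\<lambda>p. f' p v)"
    "\<forall>p\<in>U. (g has_derivative g' p) (at p)" "\<forall>v. Ck k U (\<lambda>p. g' p v)"
    by auto
  then show ?case unfolding Ck.simps
    by (intro exI[of _ "\<lambda>p v. f' p v + g' p v"]) (auto intro!: has_derivative_add Suc.IH)
qed (simp add: continuous_on_add)

lemma Ck_mult: "Ck k U f \<Longrightarrow> Ck k U g \<Longrightarrow> Ck k U (\<lambda>p. f p * g p)"
proof (induction k arbitrary: f g)
  case (Suc k)
  from Suc.prems obtain f' g' where
    *: "\<forall>p\<in>U. (f has_derivative f' p) (at p)" "\<forall>v. Ck k U (\<lambda>p. f' p v)"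
    "\<forall>p\<in>U. (g has_derivative g' p) (at p)" "\<forall>v. Ck k U (\<lambda>p. g' p v)"
    by auto
  have "Ck k U f" "Ck k U g" using Suc.prems Ck_Suc_imp by blast+
  with * show ?case unfolding Ck.simps
    by (intro exI[of _ "\<lambda>p v. f p * g' p v + f' p v * g p"])
      (auto intro!: has_derivative_mult Suc.IH Ck_add)
qed (simp add: continuous_on_mult)

text \<open>Both claims share one induction, since the derivative of each function contains the
  other.\<close>

lemma Ck_sin_cos: "Ck k U f \<Longrightarrow> Ck k U (\<lambda>p. sin (f p)) \<and> Ck k U (\<lambda>p. cos (f p))"
proof (induction k arbitrary: f)
  case (Suc k)
  from Suc.prems obtain f' where
    *: "\<forall>p\<in>U. (f has_derivative f' p) (at p)" "\<forall>v. Ck k U (\<lambda>p. f' p v)"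
    by auto
  have sc: "Ck k U (\<lambda>p. sin (f p))" "Ck k U (\<lambda>p. cos (f p))"
    using Suc.IH[of f] Suc.prems Ck_Suc_imp by blast+
  have "Ck (Suc k) U (\<lambda>p. sin (f p))" unfolding Ck.simps
    using * sc by (intro exI[of _ "\<lambda>p v. f' p v * cos (f p)"])
      (auto intro!: has_derivative_sin Ck_mult)
  moreover have "Ck (Suc k) U (\<lambda>p. cos (f p))" unfolding Ck.simps
    using * sc Ck_mult[OF Ck_const[of _ "-1"] sc(1)]
    by (intro exI[of _ "\<lambda>p v. f' p v * (-1 * sin (f p))"] conjI ballI allI Ck_mult Ck_const)
      (auto intro!: derivative_eq_intros)
  ultimately show ?case by blast
qed (simp add: continuous_on_sin continuous_on_cos)

lemma smooth_cong: "smooth U f \<Longrightarrow> (\<And>p. p \<in> U \<Longrightarrow> f p = g p) \<Longrightarrow> smooth U g"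
  unfolding smooth_def using Ck_cong by blast

lemma smooth_const [simp]: "smooth U (\<lambda>_. c)"
  unfolding smooth_def using Ck_const by blast

lemma smooth_add [simp]: "smooth U f \<Longrightarrow> smooth U g \<Longrightarrow> smooth U (\<lambda>p. f p + g p)"
  unfolding smooth_def using Ck_add by blast

lemma smooth_mult [simp]: "smooth U f \<Longrightarrow> smooth U g \<Longrightarrow> smooth U (\<lambda>p. f p * g p)"
  unfolding smooth_def using Ck_mult by blast

lemma smooth_diff [simp]:
  assumes "smooth U f" "smooth U g"
  shows "smooth U (\<lambda>p. f p - g p)"
  using smooth_add[OF assms(1) smooth_mult[OF smooth_const[of "-1"] assms(2)]] by simp

lemma smooth_sin [simp]: "smooth U f \<Longrightarrow> smooth U (\<lambda>p. sin (f p))"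
  and smooth_cos [simp]: "smooth U f \<Longrightarrow> smooth U (\<lambda>p. cos (f p))"
  unfolding smooth_def using Ck_sin_cos by blast+

text \<open>On \<open>U\<close> the two partial derivatives are the Frechet derivative in the
  directions (1,0) and (0,1), and \<open>Ck\<close> controls it in every fixed direction.\<close>

lemma smooth_dx_dy:
  assumes "smooth U f"
  shows smooth_dx: "smooth U (dx f)" and smooth_dy: "smooth U (dy f)"
proof -
  have "Ck k U (dx f) \<and> Ck k U (dy f)" for k
  proof -
    have "Ck (Suc k) U f" using assms smooth_def by blast
    then obtain f' where
      f': "\<forall>p\<in>U. (f has_derivative f' p) (at p)" "\<forall>v. Ck k U (\<lambda>p. f' p v)"
      by auto
    have "f' p (1, 0) = dx f p" "f' p (0, 1) = dy f p" if "p \<in> U" for p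
      using has_derivative_partials[of f "f' p" p] f'(1) that
      by (auto simp: dx_def dy_def DERIV_imp_deriv)
    then show ?thesis
      using f'(2) Ck_cong[of k "\<lambda>p. f' p (1,0)"] Ck_cong[of k "\<lambda>p. f' p (0,1)"] by blast
  qed
  then show "smooth U (dx f)" "smooth U (dy f)" unfolding smooth_def by blast+
qed

declare smooth_dx [simp] smooth_dy [simp]

lemma smooth_continuous: "smooth U f \<Longrightarrow> continuous_on U f"
  by (metis Ck.simps(1) smooth_def)

lemma has_dx_dy:
  assumes "smooth U f" "p \<in> U"
  shows has_dx: "((\<lambda>t. f (t, snd p)) has_real_derivative dx f p) (at (fst p))"
    and has_dy: "((\<lambda>t. f (fst p, t)) has_real_derivative dy f p) (at (snd p))"
proof -
  have "Ck (Suc 0) U f" using assms smooth_def by blast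
  then obtain f' where "(f has_derivative f') (at p)"
    using assms by auto
  then show "((\<lambda>t. f (t, snd p)) has_real_derivative dx f p) (at (fst p))"
    "((\<lambda>t. f (fst p, t)) has_real_derivative dy f p) (at (snd p))"
    using has_derivative_partials DERIV_imp_deriv unfolding dx_def dy_def by metis+
qed

lemma dxI: "((\<lambda>t. f (t, snd p)) has_real_derivative d) (at (fst p)) \<Longrightarrow> dx f p = d"
  and dyI: "((\<lambda>t. f (fst p, t)) has_real_derivative d) (at (snd p)) \<Longrightarrow> dy f p = d"
  unfolding dx_def dy_def by (auto intro: DERIV_imp_deriv)

lemma eventually_in_U:
  assumes "p \<in> U"
  shows "\<forall>\<^sub>F t in nhds (fst p). (t, snd p) \<in> U" "\<forall>\<^sub>F t in nhds (snd p). (fst p, t) \<in> U"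
proof -
  have o: "open ((\<lambda>t. (t, snd p)) -` U)" "open ((\<lambda>t. (fst p, t)) -` U)"
    by (intro open_vimage open_U continuous_intros)+
  show "\<forall>\<^sub>F t in nhds (fst p). (t, snd p) \<in> U"
    using eventually_nhds_in_open[OF o(1), of "fst p"] assms by simp
  show "\<forall>\<^sub>F t in nhds (snd p). (fst p, t) \<in> U"
    using eventually_nhds_in_open[OF o(2), of "snd p"] assms by simp
qed

lemma dx_cong:
  assumes "\<And>p. p \<in> U \<Longrightarrow> f p = g p" "p \<in> U"
  shows "dx f p = dx g p"
  unfolding dx_def
  by (intro deriv_cong_ev eventually_mono[OF eventually_in_U(1)[OF assms(2)]] assms(1)) simp_all

lemma dy_cong:
  assumes "\<And>p. p \<in> U \<Longrightarrow> f p = g p" "p \<in> U"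
  shows "dy f p = dy g p"
  unfolding dy_def
  by (intro deriv_cong_ev eventually_mono[OF eventually_in_U(2)[OF assms(2)]] assms(1)) simp_all

lemma dx_simps [simp]:
  assumes "p \<in> U"
  shows dx_const: "dx (\<lambda>_. c) p = 0"
    and dx_add: "smooth U f \<Longrightarrow> smooth U g \<Longrightarrow> dx (\<lambda>p. f p + g p) p = dx f p + dx g p"
    and dx_diff: "smooth U f \<Longrightarrow> smooth U g \<Longrightarrow> dx (\<lambda>p. f p - g p) p = dx f p - dx g p"
    and dx_mult: "smooth U f \<Longrightarrow> smooth U g \<Longrightarrow> dx (\<lambda>p. f p * g p) p = dx f p * g p + f p * dx g p"
    and dx_sin: "smooth U f \<Longrightarrow> dx (\<lambda>p. sin (f p)) p = cos (f p) * dx f p"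
    and dx_cos: "smooth U f \<Longrightarrow> dx (\<lambda>p. cos (f p)) p = - sin (f p) * dx f p"
  by (rule dxI; auto intro!: derivative_eq_intros has_dx assms)+

lemma dy_simps [simp]:
  assumes "p \<in> U"
  shows dy_const: "dy (\<lambda>_. c) p = 0"
    and dy_add: "smooth U f \<Longrightarrow> smooth U g \<Longrightarrow> dy (\<lambda>p. f p + g p) p = dy f p + dy g p"
    and dy_diff: "smooth U f \<Longrightarrow> smooth U g \<Longrightarrow> dy (\<lambda>p. f p - g p) p = dy f p - dy g p"
    and dy_mult: "smooth U f \<Longrightarrow> smooth U g \<Longrightarrow> dy (\<lambda>p. f p * g p) p = dy f p * g p + f p * dy g p"
    and dy_sin: "smooth U f \<Longrightarrow> dy (\<lambda>p. sin (f p)) p = cos (f p) * dy f p"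
    and dy_cos: "smooth U f \<Longrightarrow> dy (\<lambda>p. cos (f p)) p = - sin (f p) * dy f p"
    and dy_sum: "(\<And>i. i \<in> A \<Longrightarrow> smooth U (h i)) \<Longrightarrow> dy (\<lambda>p. \<Sum>i\<in>A. h i p) p = (\<Sum>i\<in>A. dy (h i) p)"
  by (rule dyI; auto intro!: derivative_eq_intros has_dy assms)+

text \<open>
  Both mixed derivatives are values of the second difference quotient at intermediate points
  of a small square.
\<close>

lemma dx_dy_commute:
  assumes "smooth U f" "p \<in> U"
  shows "dx (dy f) p = dy (dx f) p"
proof (rule ccontr)
  assume ne: "dx (dy f) p \<noteq> dy (dx f) p"
  obtain x y where p: "p = (x, y)" by fastforce
  \<comment> \<open>Half the supposed gap: a common value of both mixed derivatives, taken at two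
    nearby points, cannot be closer than \<open>e\<close> to both limits.\<close>
  define e where "e = \<bar>dx (dy f) p - dy (dx f) p\<bar> / 2"
  have e: "e > 0" using ne by (simp add: e_def)
  have sm: "smooth U (dx (dy f))" "smooth U (dy (dx f))" using assms by simp_all
  have near: "\<exists>d>0. \<forall>q. dist q p < d \<longrightarrow> q \<in> U \<and> \<bar>g q - g p\<bar> < e" if "smooth U g" for g
  proof -
    have "isCont g p"
      using smooth_continuous[OF that] open_U assms(2) continuous_on_eq_continuous_at by blast
    then have "\<forall>\<^sub>F q in nhds p. dist (g q) (g p) < e"
      using e by (metis continuous_at tendsto_at_iff_tendsto_nhds tendsto_iff)
    moreover have "\<forall>\<^sub>F q in nhds p. q \<in> U"
      using assms(2) open_U by (rule eventually_nhds_in_open[rotated])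
    ultimately have "\<forall>\<^sub>F q in nhds p. q \<in> U \<and> dist (g q) (g p) < e"
      by eventually_elim simp
    then show ?thesis
      unfolding eventually_nhds_metric dist_real_def by blast
  qed
  obtain d1 where d1: "d1 > 0" "\<And>q. dist q p < d1 \<Longrightarrow> q \<in> U \<and> \<bar>dx (dy f) q - dx (dy f) p\<bar> < e"
    using near[OF sm(1)] by blast
  obtain d2 where d2: "d2 > 0" "\<And>q. dist q p < d2 \<Longrightarrow> q \<in> U \<and> \<bar>dy (dx f) q - dy (dx f) p\<bar> < e"
    using near[OF sm(2)] by blast
  \<comment> \<open>Points of the square with side \<open>h\<close> are within \<open>2 * h\<close>
    of \<open>p\<close> by the sum bound on the distance, so a third is small enough.\<close>
  define h where "h = min d1 d2 / 3"
  have h: "h > 0" "2 * h < d1" "2 * h < d2" using d1(1) d2(1) by (auto simp: h_def)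
  have dist: "dist (s, t) p \<le> 2 * h" if "x \<le> s" "s \<le> x + h" "y \<le> t" "t \<le> y + h" for s t
  proof -
    have "dist (s, t) p \<le> \<bar>s - x\<bar> + \<bar>t - y\<bar>"
      unfolding p dist_Pair_Pair dist_real_def
      by (rule order_trans[OF sqrt_sum_squares_le_sum_abs]) simp
    with that show ?thesis by simp
  qed
  have box: "(s, t) \<in> U" if "x \<le> s" "s \<le> x + h" "y \<le> t" "t \<le> y + h" for s t
    using dist[OF that] d1(2) h by (meson le_less_trans)
  have Dx: "((\<lambda>s. g (s, t)) has_real_derivative dx g (s, t)) (at s)" if "smooth U g" "(s, t) \<in> U" for g s t
    using has_dx[OF that] by simp
  have Dy: "((\<lambda>t. g (s, t)) has_real_derivative dy g (s, t)) (at t)" if "smooth U g" "(s, t) \<in> U" for g s t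
    using has_dy[OF that] by simp
  let ?\<Delta> = "f (x + h, y + h) - f (x + h, y) - f (x, y + h) + f (x, y)"
  have "\<exists>s>x. s < x + h \<and> (f (x + h, y + h) - f (x + h, y)) - (f (x, y + h) - f (x, y))
      = (x + h - x) * (dx f (s, y + h) - dx f (s, y))"
    using h(1) by (intro MVT2) (auto intro!: derivative_eq_intros Dx assms(1) box)
  then obtain s where s: "x < s" "s < x + h" "?\<Delta> = h * (dx f (s, y + h) - dx f (s, y))"
    by auto
  have "\<exists>t>y. t < y + h \<and> dx f (s, y + h) - dx f (s, y) = (y + h - y) * dy (dx f) (s, t)"
    using h(1) s by (intro MVT2) (auto intro!: derivative_eq_intros Dy smooth_dx assms(1) box)
  then obtain t where t: "y < t" "t < y + h" "?\<Delta> = h * h * dy (dx f) (s, t)"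
    using s by auto
  \<comment> \<open>The same second difference, regrouped so that the mean value theorem is applied
    in \<open>y\<close> first.\<close>
  have "\<exists>t>y. t < y + h \<and> (f (x + h, y + h) - f (x, y + h)) - (f (x + h, y) - f (x, y))
      = (y + h - y) * (dy f (x + h, t) - dy f (x, t))"
    using h(1) by (intro MVT2) (auto intro!: derivative_eq_intros Dy assms(1) box)
  then obtain t' where t': "y < t'" "t' < y + h" "?\<Delta> = h * (dy f (x + h, t') - dy f (x, t'))"
    by auto
  have "\<exists>s>x. s < x + h \<and> dy f (x + h, t') - dy f (x, t') = (x + h - x) * dx (dy f) (s, t')"
    using h(1) t' by (intro MVT2) (auto intro!: derivative_eq_intros Dx smooth_dy assms(1) box)
  then obtain s' where s': "x < s'" "s' < x + h" "?\<Delta> = h * h * dx (dy f) (s', t')"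
    using t' by auto
  have "h * h * dx (dy f) (s', t') = h * h * dy (dx f) (s, t)"
    using s'(3) t(3) by argo
  then have "dx (dy f) (s', t') = dy (dx f) (s, t)"
    using h(1) by simp
  moreover have "\<bar>dx (dy f) (s', t') - dx (dy f) p\<bar> < e"
    using d1(2)[of "(s', t')"] dist[of s' t'] s' t' h(2) by simp
  moreover have "\<bar>dy (dx f) (s, t) - dy (dx f) p\<bar> < e"
    using d2(2)[of "(s, t)"] dist[of s t] s t h(3) by simp
  ultimately show False unfolding e_def by (simp add: abs_if split: if_splits)
qed

lemma smooth_pd [simp]: "smooth U f \<Longrightarrow> smooth U (pd i j f)"
proof -
  assume f: "smooth U f"
  have "smooth U ((dy ^^ j) f)" by (induction j) (simp_all add: f)
  then show ?thesis unfolding pd_def by (induction i) simp_all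
qed

lemma dx_pd: "dx (pd i j f) = pd (Suc i) j f"
  by (simp add: pd_def)

text \<open>\<open>pd\<close> takes the y-derivatives first, so \<open>dy\<close> is moved past the
  x-derivatives one commutation at a time; the induction hypothesis holds only on \<open>U\<close>,
  hence \<open>dx_cong\<close>.\<close>

lemma dy_pd: "smooth U f \<Longrightarrow> p \<in> U \<Longrightarrow> dy (pd i j f) p = pd i (Suc j) f p"
proof (induction i arbitrary: p)
  case 0
  then show ?case by (simp add: pd_def)
next
  case (Suc i)
  have "dy (pd (Suc i) j f) p = dx (dy (pd i j f)) p"
    using Suc.prems dx_dy_commute[of "pd i j f" p] by (simp add: dx_pd[symmetric])
  also have "\<dots> = dx (pd i (Suc j) f) p"
    using Suc by (intro dx_cong) auto
  finally show ?case by (simp add: dx_pd)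
qed

end

section \<open>Linear expressions and systems\<close>

text \<open>Sine and cosine of \<open>\<phi>\<close> are atoms and all jets are independent symbols,
  so the class is closed both under total derivatives, needed for compatibility, and under partial
  derivatives in jet coordinates, needed for smoothness.\<close>

datatype coef = CConst real | CJet nat nat | CSin | CCos | CAdd coef coef | CMul coef coef

primrec cev :: "coef \<Rightarrow> jetfun" where
  "cev (CConst r) u = r"
| "cev (CJet i j) u = u (D i j)"
| "cev CSin u = sin (u (D 0 0))"
| "cev CCos u = cos (u (D 0 0))"
| "cev (CAdd c d) u = cev c u + cev d u"
| "cev (CMul c d) u = cev c u * cev d u"

primrec cdx :: "coef \<Rightarrow> coef" where
  "cdx (CConst r) = CConst 0"
| "cdx (CJet i j) = CJet (Suc i) j"
| "cdx CSin = CMul CCos (CJet 1 0)"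
| "cdx CCos = CMul (CMul (CConst (- 1)) CSin) (CJet 1 0)"
| "cdx (CAdd c d) = CAdd (cdx c) (cdx d)"
| "cdx (CMul c d) = CAdd (CMul (cdx c) d) (CMul c (cdx d))"

primrec cdy :: "coef \<Rightarrow> coef" where
  "cdy (CConst r) = CConst 0"
| "cdy (CJet i j) = CJet i (Suc j)"
| "cdy CSin = CMul CCos (CJet 0 1)"
| "cdy CCos = CMul (CMul (CConst (- 1)) CSin) (CJet 0 1)"
| "cdy (CAdd c d) = CAdd (cdy c) (cdy d)"
| "cdy (CMul c d) = CAdd (CMul (cdy c) d) (CMul c (cdy d))"

primrec cpart :: "coord \<Rightarrow> coef \<Rightarrow> coef" where
  "cpart z (CConst r) = CConst 0"
| "cpart z (CJet i j) = CConst (if z = D i j then 1 else 0)"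
| "cpart z CSin = (if z = D 0 0 then CCos else CConst 0)"
| "cpart z CCos = (if z = D 0 0 then CMul (CConst (- 1)) CSin else CConst 0)"
| "cpart z (CAdd c d) = CAdd (cpart z c) (cpart z d)"
| "cpart z (CMul c d) = CAdd (CMul (cpart z c) d) (CMul c (cpart z d))"

text \<open>The two derivations shift different indices of free jet symbols, so they commute at
  every \<open>u\<close>, before any equation for \<open>\<phi>\<close> is imposed.\<close>

lemma cev_cdx_cdy: "cev (cdx (cdy c)) u = cev (cdy (cdx c)) u"
  by (induction c) (simp_all add: algebra_simps)

lemma continuous_on_cev: "continuous_on A (cev c)"
proof -
  have coord: "continuous_on A (\<lambda>u. u (D i j) :: real)" for i j
    by (rule continuous_on_subset[OF continuous_on_product_coordinates subset_UNIV])
  have "continuous_on A (\<lambda>u. sin (u (D 0 0)) :: real)" "continuous_on A (\<lambda>u. cos (u (D 0 0)) :: real)"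
    by (rule continuous_on_compose2[OF _ coord subset_UNIV], rule continuous_intros, rule continuous_on_id)+
  then have "continuous_on A (\<lambda>u. cev c u)"
    by (induction c) (simp_all add: coord continuous_on_add continuous_on_mult)
  then show ?thesis by simp
qed

lemma cev_has_partial:
  "((\<lambda>t. cev c (u(z := t))) has_real_derivative cev (cpart z c) u) (at (u z))"
proof (induction c)
  case (CMul c d)
  \<comment> \<open>The product rule leaves the factors at \<open>u(z := u z)\<close>, which appears
    here in unfolded form.\<close>
  have "(\<lambda>a. if a = z then u z else u a) = u" by auto
  with CMul show ?case by (auto intro!: derivative_eq_intros)
qed (auto intro!: derivative_eq_intros)

text \<open>Partial derivatives of coefficients are again coefficients, so continuity of all of them
  gives every order.\<close>

lemma jet_Ck_cev: "jet_Ck k (cev c)"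
proof (induction k arbitrary: c)
  case 0
  show ?case by (simp add: continuous_on_cev)
next
  case (Suc k)
  show ?case unfolding jet_Ck.simps
    using cev_has_partial Suc continuous_on_cev by (intro conjI exI[of _ "\<lambda>z. cev (cpart z c)"]) blast+
qed

primrec cord :: "coef \<Rightarrow> nat" where
  "cord (CConst r) = 0"
| "cord (CJet i j) = i + j"
| "cord CSin = 0"
| "cord CCos = 0"
| "cord (CAdd c d) = max (cord c) (cord d)"
| "cord (CMul c d) = max (cord c) (cord d)"

lemma cev_eq_of_jets_eq:
  assumes "\<forall>i j. i + j \<le> cord c \<longrightarrow> u (D i j) = v (D i j)"
  shows "cev c u = cev c v"
  using assms by (induction c) auto

lemma jet_smooth_cev: "jet_smooth (cev c)"
  unfolding jet_smooth_def finite_order_def using jet_Ck_cev cev_eq_of_jets_eq by blast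

section \<open>Expressions linear in the unknowns and in the jets of \<open>\<Psi>\<close>, and
  their total derivatives\<close>

datatype lexp = LZero | LVar nat | LPsi nat nat | LAdd lexp lexp | LMul coef lexp

primrec leval :: "lexp \<Rightarrow> pfun \<Rightarrow> pfun \<Rightarrow> (nat \<Rightarrow> real) \<Rightarrow> pfun" where
  "leval LZero \<phi> \<Psi> v p = 0"
| "leval (LVar i) \<phi> \<Psi> v p = v i"
| "leval (LPsi i j) \<phi> \<Psi> v p = pd i j \<Psi> p"
| "leval (LAdd e f) \<phi> \<Psi> v p = leval e \<phi> \<Psi> v p + leval f \<phi> \<Psi> v p"
| "leval (LMul c e) \<phi> \<Psi> v p = cev c (jet \<phi> p) * leval e \<phi> \<Psi> v p"

primrec vars_below :: "nat \<Rightarrow> lexp \<Rightarrow> bool" where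
  "vars_below m LZero \<longleftrightarrow> True"
| "vars_below m (LVar i) \<longleftrightarrow> i < m"
| "vars_below m (LPsi i j) \<longleftrightarrow> True"
| "vars_below m (LAdd e f) \<longleftrightarrow> vars_below m e \<and> vars_below m f"
| "vars_below m (LMul c e) \<longleftrightarrow> vars_below m e"

text \<open>Total derivatives, where \<open>a\<close> holds the expressions to be substituted for \<open>w\<^sub>x\<close> or \<open>w\<^sub>y\<close>.\<close>

primrec DX :: "(nat \<Rightarrow> lexp) \<Rightarrow> lexp \<Rightarrow> lexp" where
  "DX a LZero = LZero"
| "DX a (LVar i) = a i"
| "DX a (LPsi i j) = LPsi (Suc i) j"
| "DX a (LAdd e f) = LAdd (DX a e) (DX a f)"
| "DX a (LMul c e) = LAdd (LMul (cdx c) e) (LMul c (DX a e))"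

primrec DY :: "(nat \<Rightarrow> lexp) \<Rightarrow> lexp \<Rightarrow> lexp" where
  "DY a LZero = LZero"
| "DY a (LVar i) = a i"
| "DY a (LPsi i j) = LPsi i (Suc j)"
| "DY a (LAdd e f) = LAdd (DY a e) (DY a f)"
| "DY a (LMul c e) = LAdd (LMul (cdy c) e) (LMul c (DY a e))"

lemma vars_below_mono: "vars_below m e \<Longrightarrow> m \<le> n \<Longrightarrow> vars_below n e"
  by (induction e) auto

lemma ex_vars_below: "\<exists>m. vars_below m e"
proof (induction e)
  case (LAdd e f)
  then show ?case
    by (metis vars_below.simps(4) vars_below_mono max.cobounded1 max.cobounded2)
qed auto

lemma vars_below_DX: "vars_below m e \<Longrightarrow> (\<And>i. i < m \<Longrightarrow> vars_below n (a i)) \<Longrightarrow> m \<le> n \<Longrightarrow> vars_below n (DX a e)"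
  and vars_below_DY: "vars_below m e \<Longrightarrow> (\<And>i. i < m \<Longrightarrow> vars_below n (a i)) \<Longrightarrow> m \<le> n \<Longrightarrow> vars_below n (DY a e)"
  by (induction e) (auto intro: vars_below_mono)

lemma DX_cong: "vars_below m e \<Longrightarrow> (\<And>i. i < m \<Longrightarrow> a i = b i) \<Longrightarrow> DX a e = DX b e"
  and DY_cong: "vars_below m e \<Longrightarrow> (\<And>i. i < m \<Longrightarrow> a i = b i) \<Longrightarrow> DY a e = DY b e"
  by (induction e) auto

lemma leval_cong: "vars_below m e \<Longrightarrow> (\<And>i. i < m \<Longrightarrow> v i = w i) \<Longrightarrow> leval e \<phi> \<Psi> v p = leval e \<phi> \<Psi> w p"
  by (induction e) auto

locale sg_solution = plane_domain +
  fixes \<phi> :: pfun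
  assumes sg: "sine_gordon U \<phi>"
begin

lemma smooth_phi [simp]: "smooth U \<phi>"
  using sg by (simp add: sine_gordon_def)

end

locale moutard_pair = sg_solution +
  fixes \<Psi> :: pfun
  assumes mt: "moutard U \<phi> \<Psi>"
begin

lemma smooth_Psi [simp]: "smooth U \<Psi>"
  using mt by (simp add: moutard_def)

lemma cev_has_dx:
  assumes "p \<in> U"
  shows "((\<lambda>t. cev c (jet \<phi> (t, snd p))) has_real_derivative cev (cdx c) (jet \<phi> p)) (at (fst p))"
    and "((\<lambda>t. cev c (jet \<phi> (fst p, t))) has_real_derivative cev (cdy c) (jet \<phi> p)) (at (snd p))"
proof -
  have x: "((\<lambda>t. pd i j \<phi> (t, snd p)) has_real_derivative pd (Suc i) j \<phi> p) (at (fst p))" for i j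
    using has_dx[OF smooth_pd[OF smooth_phi] assms] by (simp add: dx_pd)
  have y: "((\<lambda>t. pd i j \<phi> (fst p, t)) has_real_derivative pd i (Suc j) \<phi> p) (at (snd p))" for i j
    using has_dy[OF smooth_pd[OF smooth_phi] assms] by (simp add: dy_pd assms)
  show "((\<lambda>t. cev c (jet \<phi> (t, snd p))) has_real_derivative cev (cdx c) (jet \<phi> p)) (at (fst p))"
    by (induction c) (auto intro!: derivative_eq_intros x)
  show "((\<lambda>t. cev c (jet \<phi> (fst p, t))) has_real_derivative cev (cdy c) (jet \<phi> p)) (at (snd p))"
    by (induction c) (auto intro!: derivative_eq_intros y)
qed

text \<open>The velocity of \<open>w\<close> is prescribed only at the one point \<open>p\<close>.
  The rule therefore serves solutions of a system, straight lines through an arbitrary value, and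
  constants alike.\<close>

lemma leval_has_dx:
  assumes "p \<in> U" "vars_below m e"
    and "\<And>i. i < m \<Longrightarrow> ((\<lambda>t. w i (t, snd p)) has_real_derivative
      leval (a i) \<phi> \<Psi> (\<lambda>j. w j p) p) (at (fst p))"
  shows "((\<lambda>t. leval e \<phi> \<Psi> (\<lambda>j. w j (t, snd p)) (t, snd p)) has_real_derivative
      leval (DX a e) \<phi> \<Psi> (\<lambda>j. w j p) p) (at (fst p))"
  using assms(2)
proof (induction e)
  case (LPsi i j)
  show ?case
    using has_dx[OF smooth_pd[OF smooth_Psi] assms(1)] by (simp add: dx_pd)
qed (auto intro!: derivative_eq_intros assms(3) cev_has_dx assms(1))

lemma leval_has_dy:
  assumes "p \<in> U" "vars_below m e"
    and "\<And>i. i < m \<Longrightarrow> ((\<lambda>t. w i (fst p, t)) has_real_derivative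
      leval (b i) \<phi> \<Psi> (\<lambda>j. w j p) p) (at (snd p))"
  shows "((\<lambda>t. leval e \<phi> \<Psi> (\<lambda>j. w j (fst p, t)) (fst p, t)) has_real_derivative
      leval (DY b e) \<phi> \<Psi> (\<lambda>j. w j p) p) (at (snd p))"
  using assms(2)
proof (induction e)
  case (LPsi i j)
  show ?case
    using has_dy[OF smooth_pd[OF smooth_Psi] assms(1)] by (simp add: dy_pd assms(1))
qed (auto intro!: derivative_eq_intros assms(3) cev_has_dx assms(1))

lemma smooth_cev: "smooth U (\<lambda>p. cev c (jet \<phi> p))"
  by (induction c) (auto simp: pd_def intro!: smooth_pd[unfolded pd_def])

lemma smooth_leval:
  "vars_below m e \<Longrightarrow> (\<And>i. i < m \<Longrightarrow> smooth U (w i)) \<Longrightarrow> smooth U (\<lambda>p. leval e \<phi> \<Psi> (\<lambda>j. w j p) p)"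
proof (induction e)
  case (LPsi i j)
  show ?case using smooth_pd[OF smooth_Psi, of i j] by simp
qed (auto intro!: smooth_mult smooth_cev)

text \<open>Formal identities use the sine-Gordon equation and the Moutard equation of
  \<open>\<Psi>\<close> through these two values of the otherwise free jets.\<close>

lemma pd_phi_1_1: "p \<in> U \<Longrightarrow> pd (Suc 0) (Suc 0) \<phi> p = sin (\<phi> p)"
  and pd_Psi_1_1: "p \<in> U \<Longrightarrow> pd (Suc 0) (Suc 0) \<Psi> p = cos (\<phi> p) * \<Psi> p"
  using sg mt dx_dy_commute[of \<phi> p] dx_dy_commute[of \<Psi> p]
  by (auto simp: pd_def sine_gordon_def moutard_def)

end

text \<open>Equality is semantic because the syntax does not know the differential equations;
  \<open>v\<close> is arbitrary because compatibility must hold identically in the unknowns.\<close>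

definition lequiv :: "lexp \<Rightarrow> lexp \<Rightarrow> bool" (infix "\<doteq>" 50) where
  "e \<doteq> f \<longleftrightarrow> (\<forall>U \<phi> \<Psi> v. \<forall>p\<in>U. moutard_pair U \<phi> \<Psi> \<longrightarrow> leval e \<phi> \<Psi> v p = leval f \<phi> \<Psi> v p)"

text \<open>
  \<open>DX a e\<close> at \<open>(v, p)\<close> is the derivative of \<open>e\<close> along the line through \<open>(v, p)\<close> on which
  \<open>w\<close> moves with velocity \<open>a\<close>, so it depends on \<open>e\<close> only through its values.
\<close>

lemma DX_lequiv:
  assumes "e \<doteq> f"
  shows "DX a e \<doteq> DX a f"
  unfolding lequiv_def
proof safe
  fix U \<phi> \<Psi> v x y
  assume p: "(x, y) \<in> U" and "moutard_pair U \<phi> \<Psi>"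
  then interpret moutard_pair U \<phi> \<Psi> by simp
  define w where "w = (\<lambda>i (q::plane). v i + (fst q - x) * leval (a i) \<phi> \<Psi> v (x, y))"
  have w: "(\<lambda>j. w j (x, y)) = v" by (simp add: w_def)
  have D: "((\<lambda>t. leval g \<phi> \<Psi> (\<lambda>j. w j (t, y)) (t, y)) has_real_derivative
      leval (DX a g) \<phi> \<Psi> v (x, y)) (at x)" for g
  proof -
    obtain m where "vars_below m g" using ex_vars_below by blast
    moreover have "((\<lambda>t. w i (t, y)) has_real_derivative leval (a i) \<phi> \<Psi> (\<lambda>j. w j (x, y)) (x, y)) (at x)" for i
      unfolding w by (auto simp: w_def intro!: derivative_eq_intros)
    ultimately show ?thesis
      using leval_has_dx[OF p, of m g w a] w by simp
  qed
  have "leval (DX a e) \<phi> \<Psi> v (x, y) = deriv (\<lambda>t. leval e \<phi> \<Psi> (\<lambda>j. w j (t, y)) (t, y)) x"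
    using D DERIV_imp_deriv by metis
  also have "\<dots> = deriv (\<lambda>t. leval f \<phi> \<Psi> (\<lambda>j. w j (t, y)) (t, y)) x"
    using eventually_in_U(1)[OF p] assms moutard_pair_axioms
    by (intro deriv_cong_ev) (auto simp: lequiv_def elim!: eventually_mono)
  also have "\<dots> = leval (DX a f) \<phi> \<Psi> v (x, y)"
    using D DERIV_imp_deriv by metis
  finally show "leval (DX a e) \<phi> \<Psi> v (x, y) = leval (DX a f) \<phi> \<Psi> v (x, y)" .
qed

lemma DY_lequiv:
  assumes "e \<doteq> f"
  shows "DY b e \<doteq> DY b f"
  unfolding lequiv_def
proof safe
  fix U \<phi> \<Psi> v x y
  assume p: "(x, y) \<in> U" and "moutard_pair U \<phi> \<Psi>"
  then interpret moutard_pair U \<phi> \<Psi> by simp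
  define w where "w = (\<lambda>i (q::plane). v i + (snd q - y) * leval (b i) \<phi> \<Psi> v (x, y))"
  have w: "(\<lambda>j. w j (x, y)) = v" by (simp add: w_def)
  have D: "((\<lambda>t. leval g \<phi> \<Psi> (\<lambda>j. w j (x, t)) (x, t)) has_real_derivative
      leval (DY b g) \<phi> \<Psi> v (x, y)) (at y)" for g
  proof -
    obtain m where "vars_below m g" using ex_vars_below by blast
    moreover have "((\<lambda>t. w i (x, t)) has_real_derivative leval (b i) \<phi> \<Psi> (\<lambda>j. w j (x, y)) (x, y)) (at y)" for i
      unfolding w by (auto simp: w_def intro!: derivative_eq_intros)
    ultimately show ?thesis
      using leval_has_dy[OF p, of m g w b] w by simp
  qed
  have "leval (DY b e) \<phi> \<Psi> v (x, y) = deriv (\<lambda>t. leval e \<phi> \<Psi> (\<lambda>j. w j (x, t)) (x, t)) y"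
    using D DERIV_imp_deriv by metis
  also have "\<dots> = deriv (\<lambda>t. leval f \<phi> \<Psi> (\<lambda>j. w j (x, t)) (x, t)) y"
    using eventually_in_U(2)[OF p] assms moutard_pair_axioms
    by (intro deriv_cong_ev) (auto simp: lequiv_def elim!: eventually_mono)
  also have "\<dots> = leval (DY b f) \<phi> \<Psi> v (x, y)"
    using D DERIV_imp_deriv by metis
  finally show "leval (DY b e) \<phi> \<Psi> v (x, y) = leval (DY b f) \<phi> \<Psi> v (x, y)" .
qed

section \<open>Closed linear systems and expressions that formally satisfy the Moutard
  equation\<close>

record lsys =
  arity :: nat
  fx :: "nat \<Rightarrow> lexp"
  fy :: "nat \<Rightarrow> lexp"

definition closed_sys :: "lsys \<Rightarrow> bool" where
  "closed_sys S \<longleftrightarrow> (\<forall>i<arity S. vars_below (arity S) (fx S i) \<and> vars_below (arity S) (fy S i) \<and>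
     DY (fy S) (fx S i) \<doteq> DX (fx S) (fy S i))"

definition moutard_exp :: "lsys \<Rightarrow> lexp \<Rightarrow> bool" where
  "moutard_exp S e \<longleftrightarrow> vars_below (arity S) e \<and> DY (fy S) (DX (fx S) e) \<doteq> LMul CCos e"

text \<open>On an unknown this is the compatibility of the system, on a jet of \<open>\<Psi>\<close>
  both sides shift the same indices, and on coefficients it is \<open>cev_cdx_cdy\<close>; the
  product rule combines them.\<close>

lemma DY_DX_commute:
  assumes "closed_sys S" "vars_below (arity S) e"
  shows "DY (fy S) (DX (fx S) e) \<doteq> DX (fx S) (DY (fy S) e)"
  unfolding lequiv_def
proof safe
  fix U \<phi> \<Psi> v x y
  assume p: "(x, y) \<in> U" and "moutard_pair U \<phi> \<Psi>"
  then show "leval (DY (fy S) (DX (fx S) e)) \<phi> \<Psi> v (x, y) = leval (DX (fx S) (DY (fy S) e)) \<phi> \<Psi> v (x, y)"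
    using assms
    by (induction e) (auto simp: closed_sys_def lequiv_def cev_cdx_cdy algebra_simps)
qed

definition solves :: "lsys \<Rightarrow> plane set \<Rightarrow> pfun \<Rightarrow> pfun \<Rightarrow> (nat \<Rightarrow> pfun) \<Rightarrow> bool" where
  "solves S U \<phi> \<Psi> w \<longleftrightarrow> (\<forall>i<arity S. smooth U (w i) \<and>
     (\<forall>p\<in>U. dx (w i) p = leval (fx S i) \<phi> \<Psi> (\<lambda>j. w j p) p \<and>
            dy (w i) p = leval (fy S i) \<phi> \<Psi> (\<lambda>j. w j p) p))"

context moutard_pair
begin

lemma dx_leval:
  assumes "solves S U \<phi> \<Psi> w" "vars_below (arity S) e" "p \<in> U"
  shows "dx (\<lambda>p. leval e \<phi> \<Psi> (\<lambda>j. w j p) p) p = leval (DX (fx S) e) \<phi> \<Psi> (\<lambda>j. w j p) p"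
    and "dy (\<lambda>p. leval e \<phi> \<Psi> (\<lambda>j. w j p) p) p = leval (DY (fy S) e) \<phi> \<Psi> (\<lambda>j. w j p) p"
  using assms has_dx[OF _ assms(3)] has_dy[OF _ assms(3)]
  by (auto simp: solves_def intro!: dxI dyI leval_has_dx[OF assms(3,2)] leval_has_dy[OF assms(3,2)])
    metis+

lemma moutard_leval:
  assumes "solves S U \<phi> \<Psi> w" "closed_sys S" "moutard_exp S e"
  shows "moutard U \<phi> (\<lambda>p. leval e \<phi> \<Psi> (\<lambda>j. w j p) p)"
proof -
  have e: "vars_below (arity S) e" using assms(3) by (simp add: moutard_exp_def)
  have De: "vars_below (arity S) (DX (fx S) e)"
    using e assms(2) by (auto intro!: vars_below_DX simp: closed_sys_def)
  have "dy (dx (\<lambda>p. leval e \<phi> \<Psi> (\<lambda>j. w j p) p)) p = leval e \<phi> \<Psi> (\<lambda>j. w j p) p * cos (\<phi> p)"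
    if p: "p \<in> U" for p
  proof -
    have "dy (dx (\<lambda>p. leval e \<phi> \<Psi> (\<lambda>j. w j p) p)) p = dy (\<lambda>p. leval (DX (fx S) e) \<phi> \<Psi> (\<lambda>j. w j p) p) p"
      using dx_leval(1)[OF assms(1) e] p by (intro dy_cong) auto
    also have "\<dots> = leval (DY (fy S) (DX (fx S) e)) \<phi> \<Psi> (\<lambda>j. w j p) p"
      using dx_leval(2)[OF assms(1) De p] .
    also have "\<dots> = leval (LMul CCos e) \<phi> \<Psi> (\<lambda>j. w j p) p"
      using assms(3) p moutard_pair_axioms by (auto simp: moutard_exp_def lequiv_def)
    finally show ?thesis by (simp add: pd_def)
  qed
  moreover have "smooth U (\<lambda>p. leval e \<phi> \<Psi> (\<lambda>j. w j p) p)"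
    using assms(1) e by (auto intro: smooth_leval simp: solves_def)
  ultimately show ?thesis by (simp add: moutard_def)
qed

end

section \<open>The recursion operator and its inverse\<close>

definition sg_recursion_y :: "plane set \<Rightarrow> pfun \<Rightarrow> mop" where
  "sg_recursion_y U \<phi> \<Phi> = {\<Psi>. \<exists>q. smooth U q \<and>
     (\<forall>p\<in>U. dy q p = dy \<Phi> p * dy \<phi> p \<and>
            dx q p = \<Phi> p * sin (\<phi> p) \<and>
            \<Psi> p = dy (dy \<Phi>) p + dy \<phi> p * q p)}"

context sg_solution
begin

lemma dy_dx_phi: "p \<in> U \<Longrightarrow> dy (dx \<phi>) p = sin (\<phi> p)"
  and dx_dy_phi: "p \<in> U \<Longrightarrow> dx (dy \<phi>) p = sin (\<phi> p)"
  using sg dx_dy_commute[of \<phi> p] by (auto simp: sine_gordon_def)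

lemma moutardD:
  assumes "moutard U \<phi> \<Theta>"
  shows "smooth U \<Theta>"
    and "\<And>p. p \<in> U \<Longrightarrow> dy (dx \<Theta>) p = \<Theta> p * cos (\<phi> p)"
    and "\<And>p. p \<in> U \<Longrightarrow> dx (dy \<Theta>) p = \<Theta> p * cos (\<phi> p)"
  using assms dx_dy_commute[of \<Theta>] by (auto simp: moutard_def)

text \<open>In \<open>\<Psi>_y\<close> the term \<open>- \<phi>_x \<Theta> sin \<phi>\<close> coming
  from \<open>\<Theta>_xxy\<close> cancels against \<open>\<phi>_x q_y\<close>. Differentiating the
  resulting formula in \<open>x\<close>, the terms \<open>\<phi>_x \<Theta>_x sin \<phi>\<close>
  cancel against \<open>q_x sin \<phi>\<close>, and \<open>\<Psi> cos \<phi>\<close>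
  remains.\<close>

lemma sg_recursion_step:
  assumes \<Theta>: "moutard U \<phi> \<Theta>" and q: "smooth U q"
    and qx: "\<And>p. p \<in> U \<Longrightarrow> dx q p = dx \<Theta> p * dx \<phi> p"
    and qy: "\<And>p. p \<in> U \<Longrightarrow> dy q p = \<Theta> p * sin (\<phi> p)"
    and \<Psi>: "\<And>p. p \<in> U \<Longrightarrow> \<Psi> p = dx (dx \<Theta>) p + dx \<phi> p * q p"
  shows "moutard U \<phi> \<Psi>"
    and "\<And>p. p \<in> U \<Longrightarrow> dy \<Psi> p = cos (\<phi> p) * dx \<Theta> p + sin (\<phi> p) * q p"
proof -
  note [simp] = q moutardD[OF \<Theta>] dy_dx_phi dx_dy_phi qx qy
  have \<Psi>y: "dy \<Psi> p = cos (\<phi> p) * dx \<Theta> p + sin (\<phi> p) * q p" if p [simp]: "p \<in> U" for p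
  proof -
    have "dy (dx (dx \<Theta>)) p = dx (dy (dx \<Theta>)) p"
      by (intro dx_dy_commute[symmetric]) simp_all
    also have "\<dots> = dx (\<lambda>p. \<Theta> p * cos (\<phi> p)) p"
      by (intro dx_cong) simp_all
    also have "\<dots> = dx \<Theta> p * cos (\<phi> p) - \<Theta> p * sin (\<phi> p) * dx \<phi> p"
      by simp
    finally have *: "dy (dx (dx \<Theta>)) p = dx \<Theta> p * cos (\<phi> p) - \<Theta> p * sin (\<phi> p) * dx \<phi> p" .
    have "dy \<Psi> p = dy (\<lambda>p. dx (dx \<Theta>) p + dx \<phi> p * q p) p"
      by (intro dy_cong) (simp_all add: \<Psi>)
    also have "\<dots> = cos (\<phi> p) * dx \<Theta> p + sin (\<phi> p) * q p"
      by (simp add: * algebra_simps)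
    finally show ?thesis .
  qed
  then show "\<And>p. p \<in> U \<Longrightarrow> dy \<Psi> p = cos (\<phi> p) * dx \<Theta> p + sin (\<phi> p) * q p" .
  have sm [simp]: "smooth U \<Psi>"
    by (rule smooth_cong[of "\<lambda>p. dx (dx \<Theta>) p + dx \<phi> p * q p"]) (simp_all add: \<Psi>)
  have "dy (dx \<Psi>) p = \<Psi> p * cos (\<phi> p)" if p [simp]: "p \<in> U" for p
  proof -
    have "dy (dx \<Psi>) p = dx (dy \<Psi>) p"
      by (intro dx_dy_commute[symmetric]) simp_all
    also have "\<dots> = dx (\<lambda>p. cos (\<phi> p) * dx \<Theta> p + sin (\<phi> p) * q p) p"
      by (intro dx_cong) (simp_all add: \<Psi>y)
    also have "\<dots> = \<Psi> p * cos (\<phi> p)"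
      by (simp add: \<Psi> algebra_simps)
    finally show ?thesis .
  qed
  then show "moutard U \<phi> \<Psi>" by (simp add: moutard_def)
qed

lemma sg_recursion_y_step:
  assumes \<Theta>: "moutard U \<phi> \<Theta>" and q: "smooth U q"
    and qy: "\<And>p. p \<in> U \<Longrightarrow> dy q p = dy \<Theta> p * dy \<phi> p"
    and qx: "\<And>p. p \<in> U \<Longrightarrow> dx q p = \<Theta> p * sin (\<phi> p)"
    and \<Psi>: "\<And>p. p \<in> U \<Longrightarrow> \<Psi> p = dy (dy \<Theta>) p + dy \<phi> p * q p"
  shows "moutard U \<phi> \<Psi>"
    and "\<And>p. p \<in> U \<Longrightarrow> dx \<Psi> p = cos (\<phi> p) * dy \<Theta> p + sin (\<phi> p) * q p"
proof -
  note [simp] = q moutardD[OF \<Theta>] dy_dx_phi dx_dy_phi qx qy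
  have \<Psi>x: "dx \<Psi> p = cos (\<phi> p) * dy \<Theta> p + sin (\<phi> p) * q p" if p [simp]: "p \<in> U" for p
  proof -
    have "dx (dy (dy \<Theta>)) p = dy (dx (dy \<Theta>)) p"
      by (intro dx_dy_commute) simp_all
    also have "\<dots> = dy (\<lambda>p. \<Theta> p * cos (\<phi> p)) p"
      by (intro dy_cong) simp_all
    also have "\<dots> = dy \<Theta> p * cos (\<phi> p) - \<Theta> p * sin (\<phi> p) * dy \<phi> p"
      by simp
    finally have *: "dx (dy (dy \<Theta>)) p = dy \<Theta> p * cos (\<phi> p) - \<Theta> p * sin (\<phi> p) * dy \<phi> p" .
    have "dx \<Psi> p = dx (\<lambda>p. dy (dy \<Theta>) p + dy \<phi> p * q p) p"
      by (intro dx_cong) (simp_all add: \<Psi>)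
    also have "\<dots> = cos (\<phi> p) * dy \<Theta> p + sin (\<phi> p) * q p"
      by (simp add: * algebra_simps)
    finally show ?thesis .
  qed
  then show "\<And>p. p \<in> U \<Longrightarrow> dx \<Psi> p = cos (\<phi> p) * dy \<Theta> p + sin (\<phi> p) * q p" .
  have sm [simp]: "smooth U \<Psi>"
    by (rule smooth_cong[of "\<lambda>p. dy (dy \<Theta>) p + dy \<phi> p * q p"]) (simp_all add: \<Psi>)
  have "dy (dx \<Psi>) p = \<Psi> p * cos (\<phi> p)" if p [simp]: "p \<in> U" for p
  proof -
    have "dy (dx \<Psi>) p = dy (\<lambda>p. cos (\<phi> p) * dy \<Theta> p + sin (\<phi> p) * q p) p"
      by (intro dy_cong) (simp_all add: \<Psi>x)
    also have "\<dots> = \<Psi> p * cos (\<phi> p)"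
      by (simp add: \<Psi> algebra_simps)
    finally show ?thesis .
  qed
  then show "moutard U \<phi> \<Psi>" by (simp add: moutard_def)
qed

lemma sin_mult_sin: "sin (\<phi> p) * sin (\<phi> p) = 1 - cos (\<phi> p) * cos (\<phi> p)"
  using sin_squared_eq[of "\<phi> p"] by (simp add: power2_eq_square)

text \<open>
  If \<open>Q\<close> is the potential of \<open>\<Psi> \<in> \<R>\<Theta>\<close>, then \<open>\<Theta>\<^sub>x sin \<phi> - Q cos \<phi>\<close> is the potential of
  \<open>\<Theta>\<close> with respect to the operator with \<open>x\<close> and \<open>y\<close> exchanged, and vice versa.
\<close>

lemma mop_inv_sg_recursion:
  assumes \<Psi>: "moutard U \<phi> \<Psi>"
  shows "mop_inv U \<phi> (sg_recursion U \<phi>) \<Psi> = sg_recursion_y U \<phi> \<Psi>"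
proof safe
  fix \<Theta> assume "\<Theta> \<in> mop_inv U \<phi> (sg_recursion U \<phi>) \<Psi>"
  then obtain q where \<Theta>: "moutard U \<phi> \<Theta>" and q [simp]: "smooth U q"
    and qx: "\<And>p. p \<in> U \<Longrightarrow> dx q p = dx \<Theta> p * dx \<phi> p"
    and qy: "\<And>p. p \<in> U \<Longrightarrow> dy q p = \<Theta> p * sin (\<phi> p)"
    and \<Psi>q: "\<And>p. p \<in> U \<Longrightarrow> \<Psi> p = dx (dx \<Theta>) p + dx \<phi> p * q p"
    unfolding mop_inv_def sg_recursion_def by auto
  note [simp] = moutardD[OF \<Theta>] dy_dx_phi dx_dy_phi qx qy
  have \<Psi>y: "\<And>p. p \<in> U \<Longrightarrow> dy \<Psi> p = cos (\<phi> p) * dx \<Theta> p + sin (\<phi> p) * q p"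
    using sg_recursion_step(2)[OF \<Theta> q qx qy \<Psi>q] by simp
  define r where "r = (\<lambda>p. sin (\<phi> p) * dx \<Theta> p - cos (\<phi> p) * q p)"
  have "dy r p = dy \<Psi> p * dy \<phi> p \<and> dx r p = \<Psi> p * sin (\<phi> p) \<and>
      \<Theta> p = dy (dy \<Psi>) p + dy \<phi> p * r p" if p [simp]: "p \<in> U" for p
  proof (intro conjI)
    show "dy r p = dy \<Psi> p * dy \<phi> p" "dx r p = \<Psi> p * sin (\<phi> p)"
      by (simp_all add: r_def \<Psi>y \<Psi>q algebra_simps)
    \<comment> \<open>The mixed derivative \<open>\<Theta>_xy\<close> and \<open>q_y\<close>
      contribute \<open>\<Theta> cos^2 \<phi>\<close> and \<open>\<Theta> sin^2 \<phi>\<close>,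
      together \<open>\<Theta>\<close>; the remaining terms are \<open>- \<phi>_y r\<close>.\<close>
    have "dy (dy \<Psi>) p = dy (\<lambda>p. cos (\<phi> p) * dx \<Theta> p + sin (\<phi> p) * q p) p"
      by (intro dy_cong) (simp_all add: \<Psi>y)
    then show "\<Theta> p = dy (dy \<Psi>) p + dy \<phi> p * r p"
      by (simp add: r_def algebra_simps sin_mult_sin)
  qed
  moreover have "smooth U r" by (simp add: r_def)
  ultimately show "\<Theta> \<in> sg_recursion_y U \<phi> \<Psi>"
    unfolding sg_recursion_y_def by blast
next
  fix \<Theta> assume "\<Theta> \<in> sg_recursion_y U \<phi> \<Psi>"
  then obtain q where q [simp]: "smooth U q"
    and qy: "\<And>p. p \<in> U \<Longrightarrow> dy q p = dy \<Psi> p * dy \<phi> p"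
    and qx: "\<And>p. p \<in> U \<Longrightarrow> dx q p = \<Psi> p * sin (\<phi> p)"
    and \<Theta>q: "\<And>p. p \<in> U \<Longrightarrow> \<Theta> p = dy (dy \<Psi>) p + dy \<phi> p * q p"
    unfolding sg_recursion_y_def by auto
  note [simp] = moutardD[OF \<Psi>] dy_dx_phi dx_dy_phi qx qy
  note \<Theta> = sg_recursion_y_step[OF \<Psi> q qy qx \<Theta>q]
  define r where "r = (\<lambda>p. sin (\<phi> p) * dy \<Psi> p - cos (\<phi> p) * q p)"
  have "dx r p = dx \<Theta> p * dx \<phi> p \<and> dy r p = \<Theta> p * sin (\<phi> p) \<and>
      \<Psi> p = dx (dx \<Theta>) p + dx \<phi> p * r p" if p [simp]: "p \<in> U" for p
  proof (intro conjI)
    show "dx r p = dx \<Theta> p * dx \<phi> p" "dy r p = \<Theta> p * sin (\<phi> p)"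
      by (simp_all add: r_def \<Theta>(2) \<Theta>q algebra_simps)
    have "dx (dx \<Theta>) p = dx (\<lambda>p. cos (\<phi> p) * dy \<Psi> p + sin (\<phi> p) * q p) p"
      by (intro dx_cong) (simp_all add: \<Theta>(2))
    then show "\<Psi> p = dx (dx \<Theta>) p + dx \<phi> p * r p"
      by (simp add: r_def algebra_simps sin_mult_sin)
  qed
  moreover have "smooth U r" by (simp add: r_def)
  ultimately show "\<Theta> \<in> mop_inv U \<phi> (sg_recursion U \<phi>) \<Psi>"
    unfolding mop_inv_def sg_recursion_def using \<Theta>(1) by blast
qed

end

section \<open>Independence of the values outside the domain\<close>

context plane_domain
begin

lemma dx_dx_cong: "(\<And>p. p \<in> U \<Longrightarrow> f p = g p) \<Longrightarrow> p \<in> U \<Longrightarrow> dx (dx f) p = dx (dx g) p"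
  and dy_dy_cong: "(\<And>p. p \<in> U \<Longrightarrow> f p = g p) \<Longrightarrow> p \<in> U \<Longrightarrow> dy (dy f) p = dy (dy g) p"
  and dy_dx_cong: "(\<And>p. p \<in> U \<Longrightarrow> f p = g p) \<Longrightarrow> p \<in> U \<Longrightarrow> dy (dx f) p = dy (dx g) p"
  by (intro dx_cong dy_cong; simp)+

lemma moutard_cong:
  assumes "moutard U \<phi> f" "\<And>p. p \<in> U \<Longrightarrow> f p = g p"
  shows "moutard U \<phi> g"
  using assms smooth_cong[of f g] dy_dx_cong[of f g] by (simp add: moutard_def)

end

text \<open>Intermediate values of a composition are total functions known only on \<open>U\<close>;
  an outer operator has to ignore the rest.\<close>

definition cong_op :: "(plane set \<Rightarrow> pfun \<Rightarrow> mop) \<Rightarrow> bool" where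
  "cong_op T \<longleftrightarrow> (\<forall>U \<phi> f g. open U \<and> (\<forall>p\<in>U. f p = g p) \<longrightarrow> T U \<phi> f = T U \<phi> g)"

lemma cong_op_sg_recursion: "cong_op sg_recursion"
  unfolding cong_op_def
proof (intro allI impI)
  fix U \<phi> and f g :: pfun
  assume *: "open U \<and> (\<forall>p\<in>U. f p = g p)"
  then interpret plane_domain U by unfold_locales simp
  have "\<forall>p\<in>U. f p = g p \<and> dx f p = dx g p \<and> dx (dx f) p = dx (dx g) p"
    using * dx_cong[of f g] dx_dx_cong[of f g] by simp
  then show "sg_recursion U \<phi> f = sg_recursion U \<phi> g"
    unfolding sg_recursion_def by (simp cong: ball_cong)
qed

lemma cong_op_sg_recursion_y: "cong_op sg_recursion_y"
  unfolding cong_op_def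
proof (intro allI impI)
  fix U \<phi> and f g :: pfun
  assume *: "open U \<and> (\<forall>p\<in>U. f p = g p)"
  then interpret plane_domain U by unfold_locales simp
  have "\<forall>p\<in>U. f p = g p \<and> dy f p = dy g p \<and> dy (dy f) p = dy (dy g) p"
    using * dy_cong[of f g] dy_dy_cong[of f g] by simp
  then show "sg_recursion_y U \<phi> f = sg_recursion_y U \<phi> g"
    unfolding sg_recursion_y_def by (simp cong: ball_cong)
qed

section \<open>Operators that extend systems\<close>

definition extends :: "lsys \<Rightarrow> lsys \<Rightarrow> bool" where
  "extends S T \<longleftrightarrow> arity S \<le> arity T \<and> (\<forall>i<arity S. fx T i = fx S i \<and> fy T i = fy S i)"

lemma extends_trans: "extends S T \<Longrightarrow> extends T V \<Longrightarrow> extends S V"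
  by (auto simp: extends_def)

lemma DX_extends: "extends S T \<Longrightarrow> vars_below (arity S) e \<Longrightarrow> DX (fx T) e = DX (fx S) e"
  and DY_extends: "extends S T \<Longrightarrow> vars_below (arity S) e \<Longrightarrow> DY (fy T) e = DY (fy S) e"
  by (auto simp: extends_def intro: DX_cong DY_cong)

lemma closed_sysD:
  assumes "closed_sys S" "vars_below (arity S) e"
  shows "vars_below (arity S) (DX (fx S) e)" "vars_below (arity S) (DY (fy S) e)"
  using assms by (auto intro!: vars_below_DX vars_below_DY simp: closed_sys_def)

lemma moutard_exp_extends:
  assumes "extends S T" "closed_sys S" "moutard_exp S e"
  shows "moutard_exp T e"
  using assms closed_sysD(1)[of S e]
  by (auto simp: moutard_exp_def DX_extends DY_extends extends_def intro: vars_below_mono)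

lemma leval_extends:
  assumes "extends S T" "vars_below (arity S) e" "\<forall>i<arity S. w' i = w i"
  shows "leval e \<phi> \<Psi> (\<lambda>j. w' j p) p = leval e \<phi> \<Psi> (\<lambda>j. w j p) p"
  using assms leval_cong[of "arity S" e "\<lambda>j. w' j p" "\<lambda>j. w j p"] by simp

lemma solves_extends:
  assumes "extends S T" "closed_sys S" "solves T U \<phi> \<Psi> w'" "\<forall>i<arity S. w' i = w i"
  shows "solves S U \<phi> \<Psi> w"
  unfolding solves_def
proof (intro allI impI)
  fix i assume i: "i < arity S"
  then have "vars_below (arity S) (fx S i)" "vars_below (arity S) (fy S i)"
    using assms(2) by (auto simp: closed_sys_def)
  then have "leval (fx S i) \<phi> \<Psi> (\<lambda>j. w j p) p = leval (fx T i) \<phi> \<Psi> (\<lambda>j. w' j p) p"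
    "leval (fy S i) \<phi> \<Psi> (\<lambda>j. w j p) p = leval (fy T i) \<phi> \<Psi> (\<lambda>j. w' j p) p" for p
    using assms(1,4) i by (auto simp: extends_def intro!: leval_extends[OF assms(1), symmetric])
  then show "smooth U (w i) \<and> (\<forall>p\<in>U. dx (w i) p = leval (fx S i) \<phi> \<Psi> (\<lambda>j. w j p) p \<and>
      dy (w i) p = leval (fy S i) \<phi> \<Psi> (\<lambda>j. w j p) p)"
    using assms(1,3) assms(4)[rule_format, OF i] i by (auto simp: extends_def solves_def dest: order_less_le_trans)
qed

text \<open>The given solution \<open>w\<close> is kept and all multivaluedness sits in the new
  unknowns. Keeping \<open>w\<close> is what allows two operators to be applied to the same
  function, as in a sum.\<close>

definition extends_by :: "(plane set \<Rightarrow> pfun \<Rightarrow> mop) \<Rightarrow> lsys \<Rightarrow> lexp \<Rightarrow> lsys \<Rightarrow> lexp \<Rightarrow> bool" where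
  "extends_by T S e S' e' \<longleftrightarrow> extends S S' \<and> closed_sys S' \<and> moutard_exp S' e' \<and>
     (\<forall>U \<phi> \<Psi> w. moutard_pair U \<phi> \<Psi> \<and> solves S U \<phi> \<Psi> w \<longrightarrow>
        T U \<phi> (\<lambda>p. leval e \<phi> \<Psi> (\<lambda>j. w j p) p) =
        {\<Theta>. \<exists>w'. (\<forall>i<arity S. w' i = w i) \<and> solves S' U \<phi> \<Psi> w' \<and>
               (\<forall>p\<in>U. \<Theta> p = leval e' \<phi> \<Psi> (\<lambda>j. w' j p) p)})"

text \<open>
  A multivalued operator applied to the output of any system can be resolved by adjoining
  further unknowns to that system.
\<close>

definition ext_op :: "(plane set \<Rightarrow> pfun \<Rightarrow> mop) \<Rightarrow> bool" where
  "ext_op T \<longleftrightarrow> (\<forall>S e. closed_sys S \<and> moutard_exp S e \<longrightarrow> (\<exists>S' e'. extends_by T S e S' e'))"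

lemma extends_byD:
  assumes "extends_by T S e S' e'"
  shows "extends S S'" "closed_sys S'" "moutard_exp S' e'"
  using assms by (simp_all add: extends_by_def)

lemma extends_byI:
  assumes "extends S S'" "closed_sys S'" "moutard_exp S' e'"
    and "\<And>U \<phi> \<Psi> w \<Theta>. moutard_pair U \<phi> \<Psi> \<Longrightarrow> solves S U \<phi> \<Psi> w \<Longrightarrow>
      \<Theta> \<in> T U \<phi> (\<lambda>p. leval e \<phi> \<Psi> (\<lambda>j. w j p) p) \<longleftrightarrow>
      (\<exists>w'. (\<forall>i<arity S. w' i = w i) \<and> solves S' U \<phi> \<Psi> w' \<and>
        (\<forall>p\<in>U. \<Theta> p = leval e' \<phi> \<Psi> (\<lambda>j. w' j p) p))"
  shows "extends_by T S e S' e'"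
  unfolding extends_by_def using assms by (intro conjI allI impI set_eqI) simp_all

lemma extends_by_intro:
  assumes "extends_by T S e S' e'" "moutard_pair U \<phi> \<Psi>" "solves S U \<phi> \<Psi> w"
    "\<forall>i<arity S. w' i = w i" "solves S' U \<phi> \<Psi> w'" "\<forall>p\<in>U. \<Theta> p = leval e' \<phi> \<Psi> (\<lambda>j. w' j p) p"
  shows "\<Theta> \<in> T U \<phi> (\<lambda>p. leval e \<phi> \<Psi> (\<lambda>j. w j p) p)"
proof -
  have "T U \<phi> (\<lambda>p. leval e \<phi> \<Psi> (\<lambda>j. w j p) p) =
        {\<Theta>. \<exists>w'. (\<forall>i<arity S. w' i = w i) \<and> solves S' U \<phi> \<Psi> w' \<and>
               (\<forall>p\<in>U. \<Theta> p = leval e' \<phi> \<Psi> (\<lambda>j. w' j p) p)}"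
    using assms(1-3) by (simp add: extends_by_def)
  with assms(4-6) show ?thesis by (simp only: mem_Collect_eq) (intro exI conjI)
qed

lemma extends_by_elim:
  assumes "extends_by T S e S' e'" "moutard_pair U \<phi> \<Psi>" "solves S U \<phi> \<Psi> w"
    "\<Theta> \<in> T U \<phi> (\<lambda>p. leval e \<phi> \<Psi> (\<lambda>j. w j p) p)"
  obtains w' where "\<forall>i<arity S. w' i = w i" "solves S' U \<phi> \<Psi> w'"
    "\<forall>p\<in>U. \<Theta> p = leval e' \<phi> \<Psi> (\<lambda>j. w' j p) p"
proof -
  have "T U \<phi> (\<lambda>p. leval e \<phi> \<Psi> (\<lambda>j. w j p) p) =
        {\<Theta>. \<exists>w'. (\<forall>i<arity S. w' i = w i) \<and> solves S' U \<phi> \<Psi> w' \<and>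
               (\<forall>p\<in>U. \<Theta> p = leval e' \<phi> \<Psi> (\<lambda>j. w' j p) p)}"
    using assms(1-3) by (simp add: extends_by_def)
  with assms(4) that show thesis by (simp only: mem_Collect_eq) (elim exE conjE)
qed

lemma cong_opD:
  assumes "cong_op T" "open U" "\<forall>p\<in>U. f p = g p"
  shows "T U \<phi> f = T U \<phi> g"
  using assms unfolding cong_op_def by simp

lemma moutard_pair_open: "moutard_pair U \<phi> \<Psi> \<Longrightarrow> open U"
  by (simp add: moutard_pair_def sg_solution_def plane_domain_def)

text \<open>The unknowns for \<open>A\<close> are adjoined to those for \<open>B\<close>.
  Conversely, a solution of the final system restricts to one of the intermediate system, whose
  output is the intermediate value.\<close>

lemma ext_op_comp:
  assumes A: "ext_op A" "cong_op A" and B: "ext_op B"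
  shows "ext_op (\<lambda>U \<phi>. mop_comp (A U \<phi>) (B U \<phi>))"
  unfolding ext_op_def
proof (intro allI impI)
  fix S e assume *: "closed_sys S \<and> moutard_exp S e"
  obtain T f where T: "extends_by B S e T f" using B * unfolding ext_op_def by blast
  obtain V g where V: "extends_by A T f V g" using A(1) extends_byD[OF T] unfolding ext_op_def by blast
  have arity: "arity S \<le> arity T" using extends_byD[OF T] by (simp add: extends_def)
  have "\<Theta> \<in> mop_comp (A U \<phi>) (B U \<phi>) (\<lambda>p. leval e \<phi> \<Psi> (\<lambda>j. w j p) p) \<longleftrightarrow>
      (\<exists>w'. (\<forall>i<arity S. w' i = w i) \<and> solves V U \<phi> \<Psi> w' \<and> (\<forall>p\<in>U. \<Theta> p = leval g \<phi> \<Psi> (\<lambda>j. w' j p) p))"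
    (is "?l \<longleftrightarrow> ?r")
    if P: "moutard_pair U \<phi> \<Psi>" and w: "solves S U \<phi> \<Psi> w" for U \<phi> \<Psi> w \<Theta>
  proof
    assume ?l
    then obtain \<eta> where \<eta>: "\<eta> \<in> B U \<phi> (\<lambda>p. leval e \<phi> \<Psi> (\<lambda>j. w j p) p)" and \<Theta>: "\<Theta> \<in> A U \<phi> \<eta>"
      unfolding mop_comp_def by blast
    obtain w' where w': "\<forall>i<arity S. w' i = w i" "solves T U \<phi> \<Psi> w'"
      "\<forall>p\<in>U. \<eta> p = leval f \<phi> \<Psi> (\<lambda>j. w' j p) p"
      by (rule extends_by_elim[OF T P w \<eta>])
    have "\<Theta> \<in> A U \<phi> (\<lambda>p. leval f \<phi> \<Psi> (\<lambda>j. w' j p) p)"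
      using \<Theta> cong_opD[OF A(2) moutard_pair_open[OF P] w'(3)] by simp
    then obtain w'' where "\<forall>i<arity T. w'' i = w' i" "solves V U \<phi> \<Psi> w''"
      "\<forall>p\<in>U. \<Theta> p = leval g \<phi> \<Psi> (\<lambda>j. w'' j p) p"
      by (rule extends_by_elim[OF V P w'(2)])
    with w'(1) arity show ?r by (intro exI[of _ w'']) simp
  next
    assume ?r
    then obtain w' where w': "\<forall>i<arity S. w' i = w i" "solves V U \<phi> \<Psi> w'"
      "\<forall>p\<in>U. \<Theta> p = leval g \<phi> \<Psi> (\<lambda>j. w' j p) p" by blast
    have w'T: "solves T U \<phi> \<Psi> w'"
      by (rule solves_extends[OF extends_byD(1)[OF V] extends_byD(2)[OF T] w'(2)]) simp
    have "\<Theta> \<in> A U \<phi> (\<lambda>p. leval f \<phi> \<Psi> (\<lambda>j. w' j p) p)"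
      by (rule extends_by_intro[OF V P w'T _ w'(2,3)]) simp
    moreover have "(\<lambda>p. leval f \<phi> \<Psi> (\<lambda>j. w' j p) p) \<in> B U \<phi> (\<lambda>p. leval e \<phi> \<Psi> (\<lambda>j. w j p) p)"
      by (rule extends_by_intro[OF T P w w'(1) w'T]) simp
    ultimately show ?l unfolding mop_comp_def by (rule UN_I[rotated])
  qed
  then have "extends_by (\<lambda>U \<phi>. mop_comp (A U \<phi>) (B U \<phi>)) S e V g"
    by (intro extends_byI extends_byD[OF V] extends_trans[OF extends_byD(1)[OF T] extends_byD(1)[OF V]])
  then show "\<exists>V g. extends_by (\<lambda>U \<phi>. mop_comp (A U \<phi>) (B U \<phi>)) S e V g" by blast
qed

lemma moutard_exp_add: "moutard_exp S e \<Longrightarrow> moutard_exp S f \<Longrightarrow> moutard_exp S (LAdd e f)"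
  by (simp add: moutard_exp_def lequiv_def distrib_left)

lemma moutard_exp_scale: "moutard_exp S e \<Longrightarrow> moutard_exp S (LMul (CConst r) e)"
  by (simp add: moutard_exp_def lequiv_def mult_ac)

text \<open>\<open>B\<close> is resolved over the system already extended for \<open>A\<close>, but
  still at the old expression \<open>e\<close>, which keeps its value there. The choices for the two
  summands thus remain independent.\<close>

lemma ext_op_add:
  assumes A: "ext_op A" and B: "ext_op B"
  shows "ext_op (\<lambda>U \<phi>. mop_add U (A U \<phi>) (B U \<phi>))"
  unfolding ext_op_def
proof (intro allI impI)
  fix S e assume *: "closed_sys S \<and> moutard_exp S e"
  obtain T f where T: "extends_by A S e T f" using A * unfolding ext_op_def by blast
  have eT: "moutard_exp T e" using moutard_exp_extends extends_byD[OF T] * by blast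
  obtain V g where V: "extends_by B T e V g"
    using B extends_byD[OF T] eT unfolding ext_op_def by blast
  have fV: "moutard_exp V f" using moutard_exp_extends extends_byD[OF T] extends_byD[OF V] by blast
  have arity: "arity S \<le> arity T" using extends_byD[OF T] by (simp add: extends_def)
  have vb: "vars_below (arity S) e" "vars_below (arity T) f"
    using * extends_byD[OF T] by (simp_all add: moutard_exp_def)
  have "\<Theta> \<in> mop_add U (A U \<phi>) (B U \<phi>) (\<lambda>p. leval e \<phi> \<Psi> (\<lambda>j. w j p) p) \<longleftrightarrow>
      (\<exists>w'. (\<forall>i<arity S. w' i = w i) \<and> solves V U \<phi> \<Psi> w' \<and>
        (\<forall>p\<in>U. \<Theta> p = leval (LAdd f g) \<phi> \<Psi> (\<lambda>j. w' j p) p))"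
    (is "?l \<longleftrightarrow> ?r")
    if P: "moutard_pair U \<phi> \<Psi>" and w: "solves S U \<phi> \<Psi> w" for U \<phi> \<Psi> w \<Theta>
  proof
    assume ?l
    then obtain F G where F: "F \<in> A U \<phi> (\<lambda>p. leval e \<phi> \<Psi> (\<lambda>j. w j p) p)"
      and G: "G \<in> B U \<phi> (\<lambda>p. leval e \<phi> \<Psi> (\<lambda>j. w j p) p)"
      and FG: "\<forall>p\<in>U. \<Theta> p = F p + G p"
      unfolding mop_add_def by blast
    obtain w' where w': "\<forall>i<arity S. w' i = w i" "solves T U \<phi> \<Psi> w'"
      "\<forall>p\<in>U. F p = leval f \<phi> \<Psi> (\<lambda>j. w' j p) p"
      by (rule extends_by_elim[OF T P w F])
    have "(\<lambda>p. leval e \<phi> \<Psi> (\<lambda>j. w j p) p) = (\<lambda>p. leval e \<phi> \<Psi> (\<lambda>j. w' j p) p)"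
      using leval_extends[OF extends_byD(1)[OF T] vb(1) w'(1)] by simp
    with G have "G \<in> B U \<phi> (\<lambda>p. leval e \<phi> \<Psi> (\<lambda>j. w' j p) p)" by simp
    then obtain w'' where w'': "\<forall>i<arity T. w'' i = w' i" "solves V U \<phi> \<Psi> w''"
      "\<forall>p\<in>U. G p = leval g \<phi> \<Psi> (\<lambda>j. w'' j p) p"
      by (rule extends_by_elim[OF V P w'(2)])
    have "\<forall>p\<in>U. \<Theta> p = leval (LAdd f g) \<phi> \<Psi> (\<lambda>j. w'' j p) p"
      using leval_extends[OF extends_byD(1)[OF V] vb(2) w''(1)] FG w'(3) w''(3) by simp
    moreover have "\<forall>i<arity S. w'' i = w i"
      using w'(1) w''(1) arity by simp
    ultimately show ?r using w''(2) by blast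
  next
    assume ?r
    then obtain w' where w': "\<forall>i<arity S. w' i = w i" "solves V U \<phi> \<Psi> w'"
      "\<forall>p\<in>U. \<Theta> p = leval (LAdd f g) \<phi> \<Psi> (\<lambda>j. w' j p) p" by blast
    have w'T: "solves T U \<phi> \<Psi> w'"
      by (rule solves_extends[OF extends_byD(1)[OF V] extends_byD(2)[OF T] w'(2)]) simp
    have e: "(\<lambda>p. leval e \<phi> \<Psi> (\<lambda>j. w j p) p) = (\<lambda>p. leval e \<phi> \<Psi> (\<lambda>j. w' j p) p)"
      using leval_extends[OF extends_byD(1)[OF T] vb(1) w'(1)] by simp
    have F: "(\<lambda>p. leval f \<phi> \<Psi> (\<lambda>j. w' j p) p) \<in> A U \<phi> (\<lambda>p. leval e \<phi> \<Psi> (\<lambda>j. w j p) p)"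
      by (rule extends_by_intro[OF T P w w'(1) w'T]) simp
    have G: "(\<lambda>p. leval g \<phi> \<Psi> (\<lambda>j. w' j p) p) \<in> B U \<phi> (\<lambda>p. leval e \<phi> \<Psi> (\<lambda>j. w j p) p)"
      unfolding e by (rule extends_by_intro[OF V P w'T _ w'(2)]) simp_all
    show ?l unfolding mop_add_def mem_Collect_eq
      by (rule bexI[OF bexI[OF _ G] F]) (simp add: w'(3))
  qed
  then have "extends_by (\<lambda>U \<phi>. mop_add U (A U \<phi>) (B U \<phi>)) S e V (LAdd f g)"
    by (intro extends_byI extends_byD[OF V] extends_trans[OF extends_byD(1)[OF T] extends_byD(1)[OF V]]
      moutard_exp_add fV)
  then show "\<exists>V g. extends_by (\<lambda>U \<phi>. mop_add U (A U \<phi>) (B U \<phi>)) S e V g" by blast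
qed

lemma ext_op_scale:
  assumes A: "ext_op A"
  shows "ext_op (\<lambda>U \<phi>. mop_scale U r (A U \<phi>))"
  unfolding ext_op_def
proof (intro allI impI)
  fix S e assume *: "closed_sys S \<and> moutard_exp S e"
  obtain T f where T: "extends_by A S e T f" using A * unfolding ext_op_def by blast
  have "\<Theta> \<in> mop_scale U r (A U \<phi>) (\<lambda>p. leval e \<phi> \<Psi> (\<lambda>j. w j p) p) \<longleftrightarrow>
      (\<exists>w'. (\<forall>i<arity S. w' i = w i) \<and> solves T U \<phi> \<Psi> w' \<and>
        (\<forall>p\<in>U. \<Theta> p = leval (LMul (CConst r) f) \<phi> \<Psi> (\<lambda>j. w' j p) p))"
    (is "?l \<longleftrightarrow> ?r")
    if P: "moutard_pair U \<phi> \<Psi>" and w: "solves S U \<phi> \<Psi> w" for U \<phi> \<Psi> w \<Theta>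
  proof
    assume ?l
    then obtain F where F: "F \<in> A U \<phi> (\<lambda>p. leval e \<phi> \<Psi> (\<lambda>j. w j p) p)"
      and \<Theta>: "\<forall>p\<in>U. \<Theta> p = r * F p"
      unfolding mop_scale_def by blast
    obtain w' where w': "\<forall>i<arity S. w' i = w i" "solves T U \<phi> \<Psi> w'"
      "\<forall>p\<in>U. F p = leval f \<phi> \<Psi> (\<lambda>j. w' j p) p"
      by (rule extends_by_elim[OF T P w F])
    then show ?r using \<Theta> by (intro exI[of _ w']) simp
  next
    assume ?r
    then obtain w' where w': "\<forall>i<arity S. w' i = w i" "solves T U \<phi> \<Psi> w'"
      "\<forall>p\<in>U. \<Theta> p = leval (LMul (CConst r) f) \<phi> \<Psi> (\<lambda>j. w' j p) p" by blast
    have "(\<lambda>p. leval f \<phi> \<Psi> (\<lambda>j. w' j p) p) \<in> A U \<phi> (\<lambda>p. leval e \<phi> \<Psi> (\<lambda>j. w j p) p)"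
      by (rule extends_by_intro[OF T P w w'(1,2)]) simp
    then show ?l unfolding mop_scale_def mem_Collect_eq
      by (rule bexI[rotated]) (simp add: w'(3))
  qed
  then have "extends_by (\<lambda>U \<phi>. mop_scale U r (A U \<phi>)) S e T (LMul (CConst r) f)"
    by (intro extends_byI extends_byD[OF T] moutard_exp_scale)
  then show "\<exists>V g. extends_by (\<lambda>U \<phi>. mop_scale U r (A U \<phi>)) S e V g" by blast
qed

lemma ext_op_id: "ext_op (\<lambda>U \<phi>. mop_id U)"
  unfolding ext_op_def
proof (intro allI impI)
  fix S e assume *: "closed_sys S \<and> moutard_exp S e"
  then have vb: "vars_below (arity S) e" by (simp add: moutard_exp_def)
  have S: "extends S S" by (simp add: extends_def)
  have "\<Theta> \<in> mop_id U (\<lambda>p. leval e \<phi> \<Psi> (\<lambda>j. w j p) p) \<longleftrightarrow>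
      (\<exists>w'. (\<forall>i<arity S. w' i = w i) \<and> solves S U \<phi> \<Psi> w' \<and>
        (\<forall>p\<in>U. \<Theta> p = leval e \<phi> \<Psi> (\<lambda>j. w' j p) p))"
    if "solves S U \<phi> \<Psi> w" for U \<phi> \<Psi> w \<Theta>
    unfolding mop_id_def mem_Collect_eq
  proof safe
    assume "\<forall>p\<in>U. \<Theta> p = leval e \<phi> \<Psi> (\<lambda>j. w j p) p"
    with that show "\<exists>w'. (\<forall>i<arity S. w' i = w i) \<and> solves S U \<phi> \<Psi> w' \<and>
        (\<forall>p\<in>U. \<Theta> p = leval e \<phi> \<Psi> (\<lambda>j. w' j p) p)"
      by (intro exI[of _ w]) simp
  next
    fix w' x y
    assume "\<forall>i<arity S. w' i = w i" "(x, y) \<in> U" "\<forall>p\<in>U. \<Theta> p = leval e \<phi> \<Psi> (\<lambda>j. w' j p) p"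
    then show "\<Theta> (x, y) = leval e \<phi> \<Psi> (\<lambda>j. w j (x, y)) (x, y)"
      using leval_extends[OF S vb, of w' w] by simp
  qed
  with * S have "extends_by (\<lambda>U \<phi>. mop_id U) S e S e"
    by (intro extends_byI) simp_all
  then show "\<exists>V g. extends_by (\<lambda>U \<phi>. mop_id U) S e V g" by blast
qed

section \<open>Adjoining a potential to a system\<close>

definition adjoin :: "lsys \<Rightarrow> lexp \<Rightarrow> lexp \<Rightarrow> lsys" where
  "adjoin S e f = \<lparr>arity = Suc (arity S), fx = (fx S)(arity S := e), fy = (fy S)(arity S := f)\<rparr>"

lemma adjoin_simps [simp]:
  "arity (adjoin S e f) = Suc (arity S)"
  "fx (adjoin S e f) (arity S) = e"
  "fy (adjoin S e f) (arity S) = f"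
  by (simp_all add: adjoin_def)

lemma extends_adjoin: "extends S (adjoin S e f)"
  by (simp add: extends_def adjoin_def)

text \<open>Both right-hand sides involve old unknowns only, so the one new compatibility condition
  is that of a quadrature.\<close>

lemma closed_sys_adjoin:
  assumes S: "closed_sys S" and vb: "vars_below (arity S) e" "vars_below (arity S) f"
    and eq: "DY (fy S) e \<doteq> DX (fx S) f"
  shows "closed_sys (adjoin S e f)"
  unfolding closed_sys_def
proof (intro allI impI)
  fix i assume "i < arity (adjoin S e f)"
  then consider "i < arity S" | "i = arity S" by force
  then show "vars_below (arity (adjoin S e f)) (fx (adjoin S e f) i) \<and>
      vars_below (arity (adjoin S e f)) (fy (adjoin S e f) i) \<and>
      DY (fy (adjoin S e f)) (fx (adjoin S e f) i) \<doteq> DX (fx (adjoin S e f)) (fy (adjoin S e f) i)"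
  proof cases
    case 1
    moreover have "fx (adjoin S e f) i = fx S i" "fy (adjoin S e f) i = fy S i"
      using extends_adjoin 1 by (simp_all add: extends_def)
    moreover have "vars_below (arity S) (fx S i)" "vars_below (arity S) (fy S i)"
      "DY (fy S) (fx S i) \<doteq> DX (fx S) (fy S i)"
      using S 1 by (simp_all add: closed_sys_def)
    ultimately show ?thesis
      by (auto simp: DX_extends[OF extends_adjoin] DY_extends[OF extends_adjoin] intro: vars_below_mono)
  next
    case 2
    with vb eq show ?thesis
      by (auto simp: DX_extends[OF extends_adjoin] DY_extends[OF extends_adjoin] intro: vars_below_mono)
  qed
qed

lemma solves_adjoin:
  assumes S: "closed_sys S" and vb: "vars_below (arity S) e" "vars_below (arity S) f"
    and w': "\<forall>i<arity S. w' i = w i"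
  shows "solves (adjoin S e f) U \<phi> \<Psi> w' \<longleftrightarrow> solves S U \<phi> \<Psi> w \<and> smooth U (w' (arity S)) \<and>
    (\<forall>p\<in>U. dx (w' (arity S)) p = leval e \<phi> \<Psi> (\<lambda>j. w j p) p \<and>
            dy (w' (arity S)) p = leval f \<phi> \<Psi> (\<lambda>j. w j p) p)"
    (is "?l \<longleftrightarrow> ?r")
proof -
  let ?T = "adjoin S e f"
  have ev: "leval g \<phi> \<Psi> (\<lambda>j. w' j p) p = leval g \<phi> \<Psi> (\<lambda>j. w j p) p" if "vars_below (arity S) g" for g p
    using leval_extends[OF extends_adjoin that w'] .
  show ?thesis
  proof
    assume ?l
    moreover from this have "solves S U \<phi> \<Psi> w"
      using solves_extends[OF extends_adjoin S _ w'] by blast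
    ultimately show ?r
      by (auto simp: solves_def ev vb)
  next
    assume r: ?r
    show ?l unfolding solves_def
    proof (intro allI impI)
      fix i assume "i < arity ?T"
      then consider "i < arity S" | "i = arity S" by force
      then show "smooth U (w' i) \<and> (\<forall>p\<in>U. dx (w' i) p = leval (fx ?T i) \<phi> \<Psi> (\<lambda>j. w' j p) p \<and>
          dy (w' i) p = leval (fy ?T i) \<phi> \<Psi> (\<lambda>j. w' j p) p)"
      proof cases
        case 1
        then have "fx ?T i = fx S i" "fy ?T i = fy S i" "vars_below (arity S) (fx S i)"
          "vars_below (arity S) (fy S i)" "w' i = w i"
          using extends_adjoin S w' by (simp_all add: extends_def closed_sys_def)
        with r 1 show ?thesis by (simp add: solves_def ev)
      next
        case 2
        with r show ?thesis by (simp add: ev vb)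
      qed
    qed
  qed
qed

lemma lequivD: "e \<doteq> f \<Longrightarrow> moutard_pair U \<phi> \<Psi> \<Longrightarrow> p \<in> U \<Longrightarrow> leval e \<phi> \<Psi> v p = leval f \<phi> \<Psi> v p"
  by (simp add: lequiv_def)

lemma lequiv_trans: "e \<doteq> f \<Longrightarrow> f \<doteq> g \<Longrightarrow> e \<doteq> g"
  by (simp add: lequiv_def)

lemma lequiv_sym: "e \<doteq> f \<Longrightarrow> f \<doteq> e"
  by (simp add: lequiv_def)

lemma lequivI:
  assumes "\<And>U \<phi> \<Psi> v p. moutard_pair U \<phi> \<Psi> \<Longrightarrow> p \<in> U \<Longrightarrow> leval e \<phi> \<Psi> v p = leval f \<phi> \<Psi> v p"
  shows "e \<doteq> f"
  using assms by (simp add: lequiv_def)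

lemma pd_0_0 [simp]: "pd 0 0 f = f"
  by (simp add: pd_def)

text \<open>Lets the Moutard condition be checked in whichever order of differentiation starts with
  the simpler derivative.\<close>

lemma moutard_exp_commuted:
  assumes "closed_sys S" "vars_below (arity S) e"
  shows "moutard_exp S e \<longleftrightarrow> DX (fx S) (DY (fy S) e) \<doteq> LMul CCos e"
  using DY_DX_commute[OF assms] assms(2) lequiv_trans lequiv_sym unfolding moutard_exp_def by blast

text \<open>The common shape of the recursion operator and its mirror image: one potential
  \<open>q\<close> and a value \<open>g + c q\<close>.\<close>

lemma extends_by_adjoin:
  assumes S: "closed_sys S" and vb: "vars_below (arity S) e1" "vars_below (arity S) e2" "vars_below (arity S) g"
    and eq: "DY (fy S) e1 \<doteq> DX (fx S) e2"
    and mf: "moutard_exp (adjoin S e1 e2) (LAdd g (LMul c (LVar (arity S))))"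
    and T: "\<And>U \<phi> \<Psi> w. moutard_pair U \<phi> \<Psi> \<Longrightarrow> solves S U \<phi> \<Psi> w \<Longrightarrow>
      T U \<phi> (\<lambda>p. leval e \<phi> \<Psi> (\<lambda>j. w j p) p) = {\<Theta>. \<exists>q. smooth U q \<and>
        (\<forall>p\<in>U. dx q p = leval e1 \<phi> \<Psi> (\<lambda>j. w j p) p \<and> dy q p = leval e2 \<phi> \<Psi> (\<lambda>j. w j p) p \<and>
          \<Theta> p = leval g \<phi> \<Psi> (\<lambda>j. w j p) p + cev c (jet \<phi> p) * q p)}"
  shows "extends_by T S e (adjoin S e1 e2) (LAdd g (LMul c (LVar (arity S))))"
proof (intro extends_byI extends_adjoin closed_sys_adjoin S vb eq mf)
  fix U \<phi> \<Psi> w \<Theta>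
  assume P: "moutard_pair U \<phi> \<Psi>" and w: "solves S U \<phi> \<Psi> w"
  let ?T = "adjoin S e1 e2" and ?f = "LAdd g (LMul c (LVar (arity S)))"
  have *: "solves ?T U \<phi> \<Psi> w' \<and> (\<forall>p\<in>U. \<Theta> p = leval ?f \<phi> \<Psi> (\<lambda>j. w' j p) p) \<longleftrightarrow>
    smooth U (w' (arity S)) \<and> (\<forall>p\<in>U. dx (w' (arity S)) p = leval e1 \<phi> \<Psi> (\<lambda>j. w j p) p \<and>
      dy (w' (arity S)) p = leval e2 \<phi> \<Psi> (\<lambda>j. w j p) p \<and>
      \<Theta> p = leval g \<phi> \<Psi> (\<lambda>j. w j p) p + cev c (jet \<phi> p) * w' (arity S) p)"
    if w': "\<forall>i<arity S. w' i = w i" for w'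
    unfolding solves_adjoin[OF S vb(1,2) w'] leval.simps leval_extends[OF extends_adjoin vb(3) w']
    using w by blast
  show "\<Theta> \<in> T U \<phi> (\<lambda>p. leval e \<phi> \<Psi> (\<lambda>j. w j p) p) \<longleftrightarrow>
    (\<exists>w'. (\<forall>i<arity S. w' i = w i) \<and> solves ?T U \<phi> \<Psi> w' \<and> (\<forall>p\<in>U. \<Theta> p = leval ?f \<phi> \<Psi> (\<lambda>j. w' j p) p))"
    (is "?l \<longleftrightarrow> ?r")
  proof
    assume ?l
    then obtain q where q: "smooth U q" "\<forall>p\<in>U. dx q p = leval e1 \<phi> \<Psi> (\<lambda>j. w j p) p \<and>
      dy q p = leval e2 \<phi> \<Psi> (\<lambda>j. w j p) p \<and> \<Theta> p = leval g \<phi> \<Psi> (\<lambda>j. w j p) p + cev c (jet \<phi> p) * q p"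
      unfolding T[OF P w] by blast
    define w' where "w' = w(arity S := q)"
    have w': "\<forall>i<arity S. w' i = w i" "w' (arity S) = q" by (simp_all add: w'_def)
    have sol: "solves ?T U \<phi> \<Psi> w' \<and> (\<forall>p\<in>U. \<Theta> p = leval ?f \<phi> \<Psi> (\<lambda>j. w' j p) p)"
      unfolding *[OF w'(1)] w'(2) using q by (rule conjI)
    show ?r by (rule exI[of _ w'], rule conjI[OF w'(1) sol])
  next
    assume ?r
    then obtain w' where w': "\<forall>i<arity S. w' i = w i"
      "solves ?T U \<phi> \<Psi> w'" "\<forall>p\<in>U. \<Theta> p = leval ?f \<phi> \<Psi> (\<lambda>j. w' j p) p"
      by (elim exE conjE)
    show ?l unfolding T[OF P w] mem_Collect_eq
      by (rule exI[of _ "w' (arity S)"], rule *[OF w'(1), THEN iffD1, OF conjI[OF w'(2,3)]])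
  qed
qed

text \<open>The computation of \<open>sg_recursion_step\<close> is repeated on expressions: there it
  concerned actual functions, here it must hold for every value of the unknowns, including the new
  potential.\<close>

lemma ext_op_sg_recursion: "ext_op sg_recursion"
  unfolding ext_op_def
proof (intro allI impI)
  fix S e assume *: "closed_sys S \<and> moutard_exp S e"
  then have S: "closed_sys S" and e: "vars_below (arity S) e" and me: "DY (fy S) (DX (fx S) e) \<doteq> LMul CCos e"
    by (simp_all add: moutard_exp_def)
  define X where "X = DX (fx S)"
  define Y where "Y = DY (fy S)"
  define q where "q = LVar (arity S)"
  note me = me[folded X_def Y_def]
  note De = closed_sysD(1)[OF S e, folded X_def]
  note DDe = closed_sysD(1)[OF S De, folded X_def]
  define T where "T = adjoin S (LMul (CJet 1 0) (X e)) (LMul CSin e)"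
  define f where "f = LAdd (X (X e)) (LMul (CJet 1 0) q)"
  have XY: "X (LMul c g) = LAdd (LMul (cdx c) g) (LMul c (X g))"
    "Y (LMul c g) = LAdd (LMul (cdy c) g) (LMul c (Y g))" for g c
    by (simp_all add: X_def Y_def)
  have eq: "Y (LMul (CJet 1 0) (X e)) \<doteq> X (LMul CSin e)"
    unfolding XY by (rule lequivI) (use lequivD[OF me] in \<open>simp add: moutard_pair.pd_phi_1_1 algebra_simps\<close>)
  then have T: "extends S T" "closed_sys T"
    unfolding T_def using S e De by (simp_all add: extends_adjoin closed_sys_adjoin X_def Y_def)
  note DXT = DX_extends[OF T(1), folded X_def] and DYT = DY_extends[OF T(1), folded Y_def]
  have fT: "vars_below (arity T) f"
    using DDe by (auto simp: f_def q_def T_def intro: vars_below_mono)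
  have "Y (X (X e)) \<doteq> X (LMul CCos e)"
    using lequiv_trans[OF DY_DX_commute[OF S De, folded X_def Y_def] DX_lequiv[OF me, of "fx S", folded X_def]] .
  note YXX = lequivD[OF this[unfolded XY]]
  \<comment> \<open>The y-derivative has lower order than \<open>f\<close> suggests, so the Moutard
    equation is verified by differentiating it in \<open>x\<close>.\<close>
  have "DY (fy T) f \<doteq> LAdd (LMul CCos (X e)) (LMul CSin q)"
    by (rule lequivI, use YXX in \<open>simp add: f_def DYT DDe\<close>)
      (simp add: q_def T_def moutard_pair.pd_phi_1_1 algebra_simps)
  from DX_lequiv[OF this, of "fx T"] have "DX (fx T) (DY (fy T) f) \<doteq> LMul CCos f"
    by (rule lequiv_trans, intro lequivI, simp add: DXT De)
      (simp add: f_def q_def T_def algebra_simps)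
  then have "moutard_exp T f"
    using moutard_exp_commuted[OF T(2) fT] by simp
  moreover have "sg_recursion U \<phi> (\<lambda>p. leval e \<phi> \<Psi> (\<lambda>j. w j p) p) = {\<Theta>. \<exists>q. smooth U q \<and>
      (\<forall>p\<in>U. dx q p = leval (LMul (CJet 1 0) (X e)) \<phi> \<Psi> (\<lambda>j. w j p) p \<and>
        dy q p = leval (LMul CSin e) \<phi> \<Psi> (\<lambda>j. w j p) p \<and>
        \<Theta> p = leval (X (X e)) \<phi> \<Psi> (\<lambda>j. w j p) p + cev (CJet 1 0) (jet \<phi> p) * q p)}"
    if P: "moutard_pair U \<phi> \<Psi>" and w: "solves S U \<phi> \<Psi> w" for U \<phi> \<Psi> w
  proof -
    interpret moutard_pair U \<phi> \<Psi> by (rule P)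
    have d: "dx (\<lambda>p. leval e \<phi> \<Psi> (\<lambda>j. w j p) p) p = leval (X e) \<phi> \<Psi> (\<lambda>j. w j p) p" if "p \<in> U" for p
      using dx_leval(1)[OF w e that] by (simp add: X_def)
    have dd: "dx (dx (\<lambda>p. leval e \<phi> \<Psi> (\<lambda>j. w j p) p)) p = leval (X (X e)) \<phi> \<Psi> (\<lambda>j. w j p) p"
      if "p \<in> U" for p
      using dx_cong[OF d that] dx_leval(1)[OF w De that] by (simp add: X_def)
    show ?thesis unfolding sg_recursion_def by (simp add: d dd pd_def mult_ac cong: ball_cong)
  qed
  ultimately have "extends_by sg_recursion S e T f"
    unfolding T_def f_def q_def using S e De DDe eq
    by (intro extends_by_adjoin) (simp_all add: X_def Y_def)
  then show "\<exists>T f. extends_by sg_recursion S e T f" by blast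
qed

text \<open>Mirror image of the preceding proof. Now the x-derivative of the output is the simple
  one, so the change of order is needed for the input \<open>e\<close> instead of the output
  \<open>f\<close>.\<close>

lemma ext_op_sg_recursion_y: "ext_op sg_recursion_y"
  unfolding ext_op_def
proof (intro allI impI)
  fix S e assume *: "closed_sys S \<and> moutard_exp S e"
  then have S: "closed_sys S" and e: "vars_below (arity S) e"
    by (simp_all add: moutard_exp_def)
  define X where "X = DX (fx S)"
  define Y where "Y = DY (fy S)"
  define q where "q = LVar (arity S)"
  have me: "X (Y e) \<doteq> LMul CCos e"
    using * moutard_exp_commuted[OF S e] by (simp add: X_def Y_def)
  note De = closed_sysD(2)[OF S e, folded Y_def]
  note DDe = closed_sysD(2)[OF S De, folded Y_def]
  define T where "T = adjoin S (LMul CSin e) (LMul (CJet 0 1) (Y e))"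
  define f where "f = LAdd (Y (Y e)) (LMul (CJet 0 1) q)"
  have XY: "X (LMul c g) = LAdd (LMul (cdx c) g) (LMul c (X g))"
    "Y (LMul c g) = LAdd (LMul (cdy c) g) (LMul c (Y g))" for g c
    by (simp_all add: X_def Y_def)
  have eq: "Y (LMul CSin e) \<doteq> X (LMul (CJet 0 1) (Y e))"
    unfolding XY by (rule lequivI) (use lequivD[OF me] in \<open>simp add: moutard_pair.pd_phi_1_1 algebra_simps\<close>)
  then have T: "extends S T" "closed_sys T"
    unfolding T_def using S e De by (simp_all add: extends_adjoin closed_sys_adjoin X_def Y_def)
  note DXT = DX_extends[OF T(1), folded X_def] and DYT = DY_extends[OF T(1), folded Y_def]
  have fT: "vars_below (arity T) f"
    using DDe by (auto simp: f_def q_def T_def intro: vars_below_mono)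
  have "X (Y (Y e)) \<doteq> Y (LMul CCos e)"
    using lequiv_trans[OF lequiv_sym[OF DY_DX_commute[OF S De, folded X_def Y_def]]
      DY_lequiv[OF me, of "fy S", folded Y_def]] .
  note XYY = lequivD[OF this[unfolded XY]]
  have "DX (fx T) f \<doteq> LAdd (LMul CCos (Y e)) (LMul CSin q)"
    by (rule lequivI, use XYY in \<open>simp add: f_def DXT DDe\<close>)
      (simp add: q_def T_def moutard_pair.pd_phi_1_1 algebra_simps)
  from DY_lequiv[OF this, of "fy T"] have "DY (fy T) (DX (fx T) f) \<doteq> LMul CCos f"
    by (rule lequiv_trans, intro lequivI, simp add: DYT De)
      (simp add: f_def q_def T_def algebra_simps)
  then have "moutard_exp T f"
    using fT by (simp add: moutard_exp_def)
  moreover have "sg_recursion_y U \<phi> (\<lambda>p. leval e \<phi> \<Psi> (\<lambda>j. w j p) p) = {\<Theta>. \<exists>q. smooth U q \<and>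
      (\<forall>p\<in>U. dx q p = leval (LMul CSin e) \<phi> \<Psi> (\<lambda>j. w j p) p \<and>
        dy q p = leval (LMul (CJet 0 1) (Y e)) \<phi> \<Psi> (\<lambda>j. w j p) p \<and>
        \<Theta> p = leval (Y (Y e)) \<phi> \<Psi> (\<lambda>j. w j p) p + cev (CJet 0 1) (jet \<phi> p) * q p)}"
    if P: "moutard_pair U \<phi> \<Psi>" and w: "solves S U \<phi> \<Psi> w" for U \<phi> \<Psi> w
  proof -
    interpret moutard_pair U \<phi> \<Psi> by (rule P)
    have d: "dy (\<lambda>p. leval e \<phi> \<Psi> (\<lambda>j. w j p) p) p = leval (Y e) \<phi> \<Psi> (\<lambda>j. w j p) p" if "p \<in> U" for p
      using dx_leval(2)[OF w e that] by (simp add: Y_def)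
    have dd: "dy (dy (\<lambda>p. leval e \<phi> \<Psi> (\<lambda>j. w j p) p)) p = leval (Y (Y e)) \<phi> \<Psi> (\<lambda>j. w j p) p"
      if "p \<in> U" for p
      using dy_cong[OF d that] dx_leval(2)[OF w De that] by (simp add: Y_def)
    show ?thesis unfolding sg_recursion_y_def
      by (simp add: d dd pd_def mult_ac conj_ac cong: ball_cong conj_cong)
  qed
  ultimately have "extends_by sg_recursion_y S e T f"
    unfolding T_def f_def q_def using S e De DDe eq
    by (intro extends_by_adjoin) (simp_all add: X_def Y_def)
  then show "\<exists>T f. extends_by sg_recursion_y S e T f" by blast
qed

lemma ext_op_pow: "ext_op T \<Longrightarrow> cong_op T \<Longrightarrow> ext_op (\<lambda>U \<phi>. mop_pow U (T U \<phi>) n)"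
  by (induction n) (simp_all add: ext_op_id ext_op_comp)

text \<open>\<open>mop_poly\<close> chooses the values of different powers independently, which
  matches adjoining separate potentials for each summand; no common chain is required here.\<close>

lemma ext_op_poly:
  assumes "ext_op T" "cong_op T"
  shows "ext_op (\<lambda>U \<phi>. mop_poly U (T U \<phi>) P)"
proof -
  have "ext_op (\<lambda>U \<phi>. mop_poly_upto U (T U \<phi>) \<nu> n)" for \<nu> n
    by (induction n)
      (simp_all add: ext_op_add ext_op_scale ext_op_id ext_op_comp ext_op_pow assms del: mop_pow.simps)
  then show ?thesis unfolding mop_poly_def .
qed

text \<open>Unlike \<open>extends_by\<close>, there is no prior solution to keep: the inverse of a
  polynomial is applied directly to the data \<open>\<Psi>\<close>, and its system is written in the
  jets of \<open>\<Psi>\<close>.\<close>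

definition realizes :: "lsys \<Rightarrow> lexp \<Rightarrow> (plane set \<Rightarrow> pfun \<Rightarrow> mop) \<Rightarrow> bool" where
  "realizes S e T \<longleftrightarrow> closed_sys S \<and> moutard_exp S e \<and> (\<forall>U \<phi> \<Psi>. moutard_pair U \<phi> \<Psi> \<longrightarrow>
     T U \<phi> \<Psi> = {\<Theta>. \<exists>w. solves S U \<phi> \<Psi> w \<and> (\<forall>p\<in>U. \<Theta> p = leval e \<phi> \<Psi> (\<lambda>j. w j p) p)})"

lemma realizes_comp:
  assumes T: "realizes S e T" and A: "ext_op A" "cong_op A"
  shows "\<exists>S' e'. realizes S' e' (\<lambda>U \<phi>. mop_comp (A U \<phi>) (T U \<phi>))"
proof -
  have S: "closed_sys S" "moutard_exp S e" using T by (simp_all add: realizes_def)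
  then obtain V g where V: "extends_by A S e V g" using A(1) unfolding ext_op_def by blast
  have "\<Theta> \<in> mop_comp (A U \<phi>) (T U \<phi>) \<Psi> \<longleftrightarrow>
      (\<exists>w. solves V U \<phi> \<Psi> w \<and> (\<forall>p\<in>U. \<Theta> p = leval g \<phi> \<Psi> (\<lambda>j. w j p) p))" (is "?l \<longleftrightarrow> ?r")
    if P: "moutard_pair U \<phi> \<Psi>" for U \<phi> \<Psi> \<Theta>
  proof -
    have TP: "T U \<phi> \<Psi> = {\<Theta>. \<exists>w. solves S U \<phi> \<Psi> w \<and> (\<forall>p\<in>U. \<Theta> p = leval e \<phi> \<Psi> (\<lambda>j. w j p) p)}"
      using T P by (simp add: realizes_def)
    show ?thesis
    proof
      assume ?l
      then obtain \<eta> w where w: "solves S U \<phi> \<Psi> w" "\<forall>p\<in>U. \<eta> p = leval e \<phi> \<Psi> (\<lambda>j. w j p) p"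
        and \<Theta>: "\<Theta> \<in> A U \<phi> \<eta>"
        unfolding mop_comp_def TP by blast
      have "\<Theta> \<in> A U \<phi> (\<lambda>p. leval e \<phi> \<Psi> (\<lambda>j. w j p) p)"
        using \<Theta> cong_opD[OF A(2) moutard_pair_open[OF P] w(2)] by simp
      then obtain w' where "solves V U \<phi> \<Psi> w'" "\<forall>p\<in>U. \<Theta> p = leval g \<phi> \<Psi> (\<lambda>j. w' j p) p"
        by (rule extends_by_elim[OF V P w(1)])
      then show ?r by (intro exI conjI)
    next
      assume ?r
      then obtain w where w: "solves V U \<phi> \<Psi> w" "\<forall>p\<in>U. \<Theta> p = leval g \<phi> \<Psi> (\<lambda>j. w j p) p" by blast
      have wS: "solves S U \<phi> \<Psi> w"
        by (rule solves_extends[OF extends_byD(1)[OF V] S(1) w(1)]) simp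
      have "\<Theta> \<in> A U \<phi> (\<lambda>p. leval e \<phi> \<Psi> (\<lambda>j. w j p) p)"
        by (rule extends_by_intro[OF V P wS _ w]) simp
      moreover have "(\<lambda>p. leval e \<phi> \<Psi> (\<lambda>j. w j p) p) \<in> T U \<phi> \<Psi>"
        unfolding TP mem_Collect_eq by (rule exI[of _ w]) (simp add: wS)
      ultimately show ?l unfolding mop_comp_def by (rule UN_I[rotated])
    qed
  qed
  then have "realizes V g (\<lambda>U \<phi>. mop_comp (A U \<phi>) (T U \<phi>))"
    unfolding realizes_def using extends_byD[OF V] by (intro conjI allI impI set_eqI) simp_all
  then show ?thesis by blast
qed

section \<open>Chains of the recursion operator\<close>

primrec lsum :: "(nat \<Rightarrow> lexp) \<Rightarrow> nat \<Rightarrow> lexp" where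
  "lsum g 0 = LZero"
| "lsum g (Suc n) = LAdd (lsum g n) (g n)"

lemma leval_lsum: "leval (lsum g n) \<phi> \<Psi> v p = (\<Sum>k<n. leval (g k) \<phi> \<Psi> v p)"
  by (induction n) simp_all

lemma DX_lsum: "DX a (lsum g n) = lsum (\<lambda>k. DX a (g k)) n"
  and DY_lsum: "DY a (lsum g n) = lsum (\<lambda>k. DY a (g k)) n"
  by (induction n) simp_all

lemma vars_below_lsum: "(\<And>k. k < n \<Longrightarrow> vars_below m (g k)) \<Longrightarrow> vars_below m (lsum g n)"
  by (induction n) simp_all

definition R_chain :: "plane set \<Rightarrow> pfun \<Rightarrow> nat \<Rightarrow> (nat \<Rightarrow> pfun) \<Rightarrow> bool" where
  "R_chain U \<phi> n f \<longleftrightarrow> (\<forall>k<n. f (Suc k) \<in> sg_recursion U \<phi> (f k))"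

text \<open>Inverse of \<open>(\<nu>_0 + ... + \<nu>_n \<R>^n) \<R>^l\<close>, with all powers read
  off from one chain; the first \<open>l\<close> links belong to the factor
  \<open>\<R>^l\<close>.\<close>

definition inv_chain :: "(nat \<Rightarrow> real) \<Rightarrow> nat \<Rightarrow> nat \<Rightarrow> plane set \<Rightarrow> pfun \<Rightarrow> mop" where
  "inv_chain \<nu> l n U \<phi> \<Psi> = {\<Phi>. moutard U \<phi> \<Phi> \<and> (\<exists>f. f 0 = \<Phi> \<and> R_chain U \<phi> (l + n) f \<and>
     (\<forall>p\<in>U. \<Psi> p = (\<Sum>k\<le>n. \<nu> k * f (l + k) p)))}"

text \<open>
  The unknowns are \<open>\<Phi>\<^sub>k\<close>, \<open>\<partial>\<^sub>x \<Phi>\<^sub>k\<close> and \<open>Q\<^sub>k\<close> for \<open>k < n\<close> (in this order), where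
  \<open>\<Phi>\<^sub>k \<in> \<R>\<^sup>k \<Phi>\<^sub>0\<close> and \<open>Q\<^sub>k\<close> is the potential of \<open>\<Phi>\<^sub>k\<^sub>+\<^sub>1 \<in> \<R> \<Phi>\<^sub>k\<close>. The relation \<open>\<Psi> = \<nu>\<^sub>0 \<Phi>\<^sub>0 + \<dots> + \<nu>\<^sub>n \<Phi>\<^sub>n\<close> gives \<open>\<Phi>\<^sub>n\<close> since \<open>\<nu>\<^sub>n \<noteq> 0\<close>,
  and gives \<open>\<partial>\<^sub>y \<Phi>\<^sub>0\<close> since \<open>\<nu>\<^sub>0 \<noteq> 0\<close>. \<open>F k\<close> stands for \<open>\<Phi>\<^sub>k\<close> and \<open>Z k\<close> for \<open>\<partial>\<^sub>y \<Phi>\<^sub>k\<^sub>+\<^sub>1\<close>.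
\<close>

locale inverse_system =
  fixes \<nu> :: "nat \<Rightarrow> real" and n :: nat
  assumes \<nu>0: "\<nu> 0 \<noteq> 0" and \<nu>n: "\<nu> n \<noteq> 0"
begin

definition F :: "nat \<Rightarrow> lexp" where
  "F k = (if k < n then LVar k else
     LMul (CConst (1 / \<nu> n)) (LAdd (LPsi 0 0) (lsum (\<lambda>j. LMul (CConst (- \<nu> j)) (LVar j)) n)))"

definition Z :: "nat \<Rightarrow> lexp" where
  "Z k = LAdd (LMul CCos (LVar (n + k))) (LMul CSin (LVar (2 * n + k)))"

text \<open>In the second branch \<open>i = n + k\<close>, and \<open>n + i\<close> is the index of
  \<open>Q_k\<close>: the formula is the recursion solved for the second x-derivative of
  \<open>\<Phi>_k\<close>. In the third, \<open>i = 2 * n + k\<close> and \<open>i - n\<close> is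
  the index of the x-derivative of \<open>\<Phi>_k\<close>.\<close>

definition a :: "nat \<Rightarrow> lexp" where
  "a i = (if i < n then LVar (n + i)
     else if i < 2 * n then LAdd (F (Suc (i - n))) (LMul (CMul (CConst (- 1)) (CJet 1 0)) (LVar (n + i)))
     else LMul (CJet 1 0) (LVar (i - n)))"

text \<open>The case \<open>i = 0\<close> is the y-derivative of the relation, solved for that of
  \<open>\<Phi>_0\<close>. The third branch is the Moutard equation of \<open>\<Phi>_k\<close>, the
  last the y-equation of its potential.\<close>

definition b :: "nat \<Rightarrow> lexp" where
  "b i = (if i = 0 then LMul (CConst (1 / \<nu> 0))
       (LAdd (LPsi 0 1) (lsum (\<lambda>k. LMul (CConst (- \<nu> (Suc k))) (Z k)) n))
     else if i < n then Z (i - 1)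
     else if i < 2 * n then LMul CCos (LVar (i - n))
     else LMul CSin (LVar (i - 2 * n)))"

definition S :: lsys where
  "S = \<lparr>arity = 3 * n, fx = a, fy = b\<rparr>"

lemma S_simps [simp]: "arity S = 3 * n" "fx S = a" "fy S = b"
  by (simp_all add: S_def)

lemma vars_below_F: "vars_below (3 * n) (F k)"
  by (auto simp: F_def intro!: vars_below_lsum)

lemma vars_below_Z: "k < n \<Longrightarrow> vars_below (3 * n) (Z k)"
  by (simp add: Z_def)

lemma vars_below_ab: "i < 3 * n \<Longrightarrow> vars_below (3 * n) (a i) \<and> vars_below (3 * n) (b i)"
  by (auto simp: a_def b_def vars_below_F intro!: vars_below_lsum vars_below_Z)

text \<open>\<open>F n\<close> is the relation solved for its last term, so the relation is built in
  for every \<open>v\<close>.\<close>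

lemma sum_F: "(\<Sum>k\<le>n. \<nu> k * leval (F k) \<phi> \<Psi> v p) = \<Psi> p"
proof -
  have "leval (F n) \<phi> \<Psi> v p = (\<Psi> p - (\<Sum>k<n. \<nu> k * v k)) / \<nu> n"
    by (simp add: F_def leval_lsum sum_negf)
  then have "\<nu> n * leval (F n) \<phi> \<Psi> v p = \<Psi> p - (\<Sum>k<n. \<nu> k * v k)"
    using \<nu>n by simp
  moreover have "(\<Sum>k<n. \<nu> k * leval (F k) \<phi> \<Psi> v p) = (\<Sum>k<n. \<nu> k * v k)"
    by (intro sum.cong) (simp_all add: F_def)
  ultimately show ?thesis by (simp add: lessThan_Suc_atMost[symmetric])
qed

lemma sum_head: "(\<Sum>k\<le>n. g k) = g 0 + (\<Sum>k<n. g (Suc k))" for g :: "nat \<Rightarrow> real"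
  using sum.lessThan_Suc_shift[of g n] by (simp add: lessThan_Suc_atMost del: sum.lessThan_Suc)

lemma leval_F0: "\<nu> 0 * leval (F 0) \<phi> \<Psi> v p = \<Psi> p - (\<Sum>k<n. \<nu> (Suc k) * leval (F (Suc k)) \<phi> \<Psi> v p)"
  using sum_F[of \<phi> \<Psi> v p] unfolding sum_head by linarith

lemma leval_b0: "\<nu> 0 * leval (b 0) \<phi> \<Psi> v p = pd 0 1 \<Psi> p - (\<Sum>k<n. \<nu> (Suc k) * leval (Z k) \<phi> \<Psi> v p)"
  using \<nu>0 by (simp add: b_def leval_lsum sum_negf)

text \<open>Only \<open>Suc k = n\<close> needs work, as \<open>\<Phi>_n\<close> is not an unknown:
  in the y-derivative of its formula the terms \<open>Z j\<close> with \<open>j < k\<close> cancel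
  by the choice of \<open>b 0\<close>, leaving \<open>Z k\<close>.\<close>

lemma DY_F:
  assumes "k < n"
  shows "DY b (F (Suc k)) \<doteq> Z k"
proof (cases "Suc k < n")
  case True
  then show ?thesis by (simp add: F_def b_def lequiv_def)
next
  case False
  with assms have n: "n = Suc k" by simp
  have bZ: "b (Suc j) = Z j" if "j < k" for j
  proof -
    have "Suc j < n" using that n by simp
    then show ?thesis by (simp add: b_def)
  qed
  have lt: "{..<n} = {..<Suc k}" by (simp add: n)
  show ?thesis unfolding n[symmetric]
  proof (rule lequivI)
    fix U \<phi> \<Psi> v p
    have "(\<Sum>j<n. \<nu> j * leval (b j) \<phi> \<Psi> v p) = \<nu> 0 * leval (b 0) \<phi> \<Psi> v p + (\<Sum>j<k. \<nu> (Suc j) * leval (b (Suc j)) \<phi> \<Psi> v p)"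
      unfolding lt by (rule sum.lessThan_Suc_shift)
    also have "(\<Sum>j<k. \<nu> (Suc j) * leval (b (Suc j)) \<phi> \<Psi> v p) = (\<Sum>j<k. \<nu> (Suc j) * leval (Z j) \<phi> \<Psi> v p)"
      by (intro sum.cong) (simp_all add: bZ)
    also have "\<nu> 0 * leval (b 0) \<phi> \<Psi> v p = pd 0 1 \<Psi> p - (\<Sum>j<k. \<nu> (Suc j) * leval (Z j) \<phi> \<Psi> v p) - \<nu> n * leval (Z k) \<phi> \<Psi> v p"
      unfolding leval_b0 lt sum.lessThan_Suc unfolding n[symmetric] by simp
    finally have *: "(\<Sum>j<n. \<nu> j * leval (b j) \<phi> \<Psi> v p) = pd 0 1 \<Psi> p - \<nu> n * leval (Z k) \<phi> \<Psi> v p"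
      by simp
    have "leval (DY b (F n)) \<phi> \<Psi> v p = 1 / \<nu> n * (pd 0 1 \<Psi> p - (\<Sum>j<n. \<nu> j * leval (b j) \<phi> \<Psi> v p))"
      by (simp add: F_def DY_lsum leval_lsum sum_negf)
    then show "leval (DY b (F n)) \<phi> \<Psi> v p = leval (Z k) \<phi> \<Psi> v p"
      using \<nu>n unfolding * by simp
  qed
qed

lemma DX_Z:
  assumes "k < n"
  shows "DX a (Z k) \<doteq> LMul CCos (F (Suc k))"
proof (rule lequivI)
  fix U \<phi> \<Psi> v p
  have "a (n + k) = LAdd (F (Suc k)) (LMul (CMul (CConst (- 1)) (CJet 1 0)) (LVar (2 * n + k)))"
    "a (2 * n + k) = LMul (CJet 1 0) (LVar (n + k))"
    using assms by (simp_all add: a_def mult_2)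
  then show "leval (DX a (Z k)) \<phi> \<Psi> v p = leval (LMul CCos (F (Suc k))) \<phi> \<Psi> v p"
    by (simp add: Z_def algebra_simps)
qed

text \<open>The Moutard equation of \<open>\<Psi>\<close> and \<open>DX_Z\<close> produce a common
  factor \<open>cos \<phi>\<close>; what it multiplies is the relation solved for
  \<open>\<Phi>_0\<close>.\<close>

lemma DX_b0: "DX a (b 0) \<doteq> LMul CCos (F 0)"
proof (rule lequivI)
  fix U \<phi> \<Psi> v p
  assume P: "moutard_pair U \<phi> \<Psi>" "p \<in> U"
  have "leval (DX a (b 0)) \<phi> \<Psi> v p = 1 / \<nu> 0 * (pd 1 1 \<Psi> p - (\<Sum>k<n. \<nu> (Suc k) * leval (DX a (Z k)) \<phi> \<Psi> v p))"
    by (simp add: b_def DX_lsum leval_lsum sum_negf)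
  also have "(\<Sum>k<n. \<nu> (Suc k) * leval (DX a (Z k)) \<phi> \<Psi> v p) =
      (\<Sum>k<n. \<nu> (Suc k) * (cos (\<phi> p) * leval (F (Suc k)) \<phi> \<Psi> v p))"
    by (intro sum.cong) (simp_all add: lequivD[OF DX_Z P])
  also have "\<dots> = cos (\<phi> p) * (\<Sum>k<n. \<nu> (Suc k) * leval (F (Suc k)) \<phi> \<Psi> v p)"
    by (simp add: sum_distrib_left mult_ac)
  also have "pd 1 1 \<Psi> p = cos (\<phi> p) * \<Psi> p"
    using moutard_pair.pd_Psi_1_1[OF P] by simp
  also have "1 / \<nu> 0 * (cos (\<phi> p) * \<Psi> p - cos (\<phi> p) * (\<Sum>k<n. \<nu> (Suc k) * leval (F (Suc k)) \<phi> \<Psi> v p)) =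
      cos (\<phi> p) * (1 / \<nu> 0 * (\<nu> 0 * leval (F 0) \<phi> \<Psi> v p))"
    unfolding leval_F0 by (simp add: right_diff_distrib diff_divide_distrib)
  finally show "leval (DX a (b 0)) \<phi> \<Psi> v p = leval (LMul CCos (F 0)) \<phi> \<Psi> v p"
    using \<nu>0 by simp
qed

lemma index_cases [consumes 1, case_names 1 2 3 4]:
  assumes "i < 3 * n"
  obtains "i = 0" "0 < n" | k where "i = Suc k" "Suc k < n" | k where "i = n + k" "k < n"
    | k where "i = 2 * n + k" "k < n"
proof -
  consider "i = 0" | "0 < i" "i < n" | "n \<le> i" "i < 2 * n" | "2 * n \<le> i" by linarith
  then show thesis
  proof cases
    case 1
    with assms that(1) show thesis by simp
  next
    case 2
    with that(2)[of "i - 1"] show thesis by simp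
  next
    case 3
    with that(3)[of "i - n"] show thesis by simp
  next
    case 4
    with assms that(4)[of "i - 2 * n"] show thesis by simp
  qed
qed

lemma closed_sys_S: "closed_sys S"
  unfolding closed_sys_def S_simps
proof (intro allI impI conjI)
  fix i assume i: "i < 3 * n"
  then show "vars_below (3 * n) (a i)" "vars_below (3 * n) (b i)"
    using vars_below_ab by blast+
  from i show "DY b (a i) \<doteq> DX a (b i)"
  proof (cases rule: index_cases)
    case 1
    have "DY b (a i) = LMul CCos (F 0)"
      using 1 by (simp add: a_def b_def F_def)
    then show ?thesis using lequiv_sym[OF DX_b0] 1 by simp
  next
    case (2 k)
    have "DY b (a i) = LMul CCos (F (Suc k))" "b i = Z k"
      using 2 by (simp_all add: a_def b_def F_def)
    then show ?thesis using lequiv_sym[OF DX_Z[of k]] 2 by simp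
  next
    case (3 k)
    have ab: "a i = LAdd (F (Suc k)) (LMul (CMul (CConst (- 1)) (CJet 1 0)) (LVar (2 * n + k)))"
      "b i = LMul CCos (LVar k)" "b (2 * n + k) = LMul CSin (LVar k)" "a k = LVar (n + k)"
      using 3 by (simp_all add: a_def b_def mult_2)
    \<comment> \<open>The term \<open>\<phi>_xy Q_k\<close> cancels the \<open>Q_k\<close> part of
      \<open>Z k\<close>; both sides become \<open>cos \<phi>\<close> times the x-derivative of
      \<open>\<Phi>_k\<close> minus \<open>\<phi>_x sin \<phi> \<Phi>_k\<close>.\<close>
    show ?thesis unfolding ab
      by (rule lequivI, simp add: ab lequivD[OF DY_F[OF 3(2)]] moutard_pair.pd_phi_1_1)
        (simp add: Z_def algebra_simps)
  next
    case (4 k)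
    have ab: "a i = LMul (CJet 1 0) (LVar (n + k))" "b i = LMul CSin (LVar k)"
      "b (n + k) = LMul CCos (LVar k)" "a k = LVar (n + k)"
      using 4 by (simp_all add: a_def b_def mult_2)
    show ?thesis unfolding ab
      by (rule lequivI) (simp add: ab moutard_pair.pd_phi_1_1)
  qed
qed

lemma moutard_exp_F0: "moutard_exp S (F 0)"
proof (cases "n = 0")
  \<comment> \<open>For a constant polynomial there are no unknowns and the output is a multiple of
    \<open>\<Psi>\<close>.\<close>
  case True
  then have F0: "F 0 = LMul (CConst (1 / \<nu> n)) (LAdd (LPsi 0 0) LZero)"
    unfolding F_def by simp
  have "DY b (DX a (F 0)) \<doteq> LMul CCos (F 0)"
    unfolding F0 by (rule lequivI) (simp add: moutard_pair.pd_Psi_1_1)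
  then show ?thesis using vars_below_F by (simp add: moutard_exp_def)
next
  case False
  then have "DY b (DX a (F 0)) = LMul CCos (F 0)"
    by (simp add: F_def a_def b_def)
  then show ?thesis using vars_below_F by (simp add: moutard_exp_def lequiv_def)
qed

lemma solution_to_chain:
  assumes P: "moutard_pair U \<phi> \<Psi>" and w: "solves S U \<phi> \<Psi> w"
    and \<Theta>: "\<forall>p\<in>U. \<Theta> p = leval (F 0) \<phi> \<Psi> (\<lambda>j. w j p) p"
  shows "\<Theta> \<in> inv_chain \<nu> 0 n U \<phi> \<Psi>"
proof -
  interpret moutard_pair U \<phi> \<Psi> by (rule P)
  \<comment> \<open>The chain must start at \<open>\<Theta>\<close> as a total function, whereas the
    expression agrees with it only on \<open>U\<close>.\<close>
  define f where "f k = (if k = 0 then \<Theta> else (\<lambda>p. leval (F k) \<phi> \<Psi> (\<lambda>j. w j p) p))" for k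
  have f: "f k p = leval (F k) \<phi> \<Psi> (\<lambda>j. w j p) p" if "p \<in> U" for k p
    using \<Theta> that by (simp add: f_def)
  have "moutard U \<phi> (\<lambda>p. leval (F 0) \<phi> \<Psi> (\<lambda>j. w j p) p)"
    using moutard_leval[OF w closed_sys_S moutard_exp_F0] .
  then have m: "moutard U \<phi> \<Theta>"
    by (rule moutard_cong) (simp add: \<Theta>)
  have "f (Suc k) \<in> sg_recursion U \<phi> (f k)" if k: "k < n" for k
  proof -
    have i: "k < 3 * n" "n + k < 3 * n" "2 * n + k < 3 * n" using k by simp_all
    have W: "dx (w i) p = leval (a i) \<phi> \<Psi> (\<lambda>j. w j p) p" "dy (w i) p = leval (b i) \<phi> \<Psi> (\<lambda>j. w j p) p"
      if "i < 3 * n" "p \<in> U" for i p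
      using w that by (simp_all add: solves_def)
    have fk: "f k p = w k p" if "p \<in> U" for p
      using f[OF that, of k] k by (simp add: F_def)
    have fx: "dx (f k) p = w (n + k) p" if "p \<in> U" for p
      using dx_cong[OF fk that] W(1)[OF i(1) that] k by (simp add: a_def)
    have fxx: "dx (dx (f k)) p = f (Suc k) p - dx \<phi> p * w (2 * n + k) p" if "p \<in> U" for p
      using dx_cong[OF fx that] W(1)[OF i(2) that] f[OF that, of "Suc k"] k
      by (simp add: a_def pd_def mult_2 add.assoc)
    have "smooth U (w (2 * n + k))" using w i by (simp add: solves_def)
    moreover have "dx (w (2 * n + k)) p = dx (f k) p * dx \<phi> p \<and> dy (w (2 * n + k)) p = f k p * sin (\<phi> p) \<and>
        f (Suc k) p = dx (dx (f k)) p + dx \<phi> p * w (2 * n + k) p" if "p \<in> U" for p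
      using W[OF i(3) that] k fx[OF that] fk[OF that] fxx[OF that] by (simp add: a_def b_def pd_def mult_2)
    ultimately show ?thesis unfolding sg_recursion_def by blast
  qed
  moreover have "\<Psi> p = (\<Sum>k\<le>n. \<nu> k * f k p)" if "p \<in> U" for p
    using sum_F[of \<phi> \<Psi> "\<lambda>j. w j p" p] by (simp add: f[OF that])
  moreover have "f 0 = \<Theta>" by (simp add: f_def)
  ultimately have "moutard U \<phi> \<Theta> \<and> (\<exists>f. f 0 = \<Theta> \<and> R_chain U \<phi> (0 + n) f \<and> (\<forall>p\<in>U. \<Psi> p = (\<Sum>k\<le>n. \<nu> k * f (0 + k) p)))"
    using m by (intro conjI exI[of _ f]) (simp_all add: R_chain_def)
  then show ?thesis unfolding inv_chain_def mem_Collect_eq .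
qed

end

lemma (in sg_solution) sg_recursion_moutard:
  assumes "moutard U \<phi> \<Theta>" "\<Psi> \<in> sg_recursion U \<phi> \<Theta>"
  shows "moutard U \<phi> \<Psi>"
  using assms(2) sg_recursion_step(1)[OF assms(1)] unfolding sg_recursion_def by blast

lemma (in sg_solution) R_chain_moutard:
  assumes "moutard U \<phi> (f 0)" "R_chain U \<phi> n f" "k \<le> n"
  shows "moutard U \<phi> (f k)"
  using assms(3)
proof (induction k)
  case (Suc k)
  then show ?case
    using assms(2) sg_recursion_moutard[of "f k" "f (Suc k)"] by (simp add: R_chain_def)
qed (rule assms(1))

context inverse_system
begin

lemma chain_to_solution:
  assumes P: "moutard_pair U \<phi> \<Psi>" and \<Theta>: "\<Theta> \<in> inv_chain \<nu> 0 n U \<phi> \<Psi>"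
  shows "\<exists>w. solves S U \<phi> \<Psi> w \<and> (\<forall>p\<in>U. \<Theta> p = leval (F 0) \<phi> \<Psi> (\<lambda>j. w j p) p)"
proof -
  interpret moutard_pair U \<phi> \<Psi> by (rule P)
  obtain f where m: "moutard U \<phi> (f 0)" and f0: "f 0 = \<Theta>" and ch: "R_chain U \<phi> n f"
    and \<Psi>: "\<And>p. p \<in> U \<Longrightarrow> \<Psi> p = (\<Sum>k\<le>n. \<nu> k * f k p)"
    using \<Theta> unfolding inv_chain_def by auto
  have fm: "moutard U \<phi> (f k)" if "k \<le> n" for k
    using R_chain_moutard[OF m ch that] .
  define pot where "pot k q \<longleftrightarrow> smooth U q \<and>
     (\<forall>p\<in>U. dx q p = dx (f k) p * dx \<phi> p \<and> dy q p = f k p * sin (\<phi> p) \<and>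
            f (Suc k) p = dx (dx (f k)) p + dx \<phi> p * q p)" for k q
  \<comment> \<open>A chain only asserts that potentials exist; one is fixed for each link to serve
    as an unknown.\<close>
  define q where "q k = (SOME q. pot k q)" for k
  have "pot k (q k)" if "k < n" for k
  proof -
    have "f (Suc k) \<in> sg_recursion U \<phi> (f k)"
      using ch that by (simp add: R_chain_def)
    then have "\<exists>q. pot k q" unfolding sg_recursion_def pot_def by (rule CollectD)
    then show ?thesis unfolding q_def by (rule someI_ex)
  qed
  then have q: "\<And>k. k < n \<Longrightarrow> smooth U (q k)"
    "\<And>k p. k < n \<Longrightarrow> p \<in> U \<Longrightarrow> dx (q k) p = dx (f k) p * dx \<phi> p"
    "\<And>k p. k < n \<Longrightarrow> p \<in> U \<Longrightarrow> dy (q k) p = f k p * sin (\<phi> p)"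
    "\<And>k p. k < n \<Longrightarrow> p \<in> U \<Longrightarrow> f (Suc k) p = dx (dx (f k)) p + dx \<phi> p * q k p"
    unfolding pot_def by simp_all
  have fy: "dy (f (Suc k)) p = cos (\<phi> p) * dx (f k) p + sin (\<phi> p) * q k p" if "k < n" "p \<in> U" for k p
    by (rule sg_recursion_step(2)[of "f k" "q k"]) (use that fm q in simp_all)
  define w where "w i = (if i < n then f i else if i < 2 * n then dx (f (i - n)) else q (i - 2 * n))" for i
  have w: "w k = f k" "w (n + k) = dx (f k)" "w (2 * n + k) = q k" if "k < n" for k
    using that by (simp_all add: w_def)
  have Z: "leval (Z k) \<phi> \<Psi> (\<lambda>j. w j p) p = dy (f (Suc k)) p" if "k < n" "p \<in> U" for k p
    using that by (simp add: Z_def fy w)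
  have F: "leval (F k) \<phi> \<Psi> (\<lambda>j. w j p) p = f k p" if "k \<le> n" "p \<in> U" for k p
  proof (cases "k < n")
    case True
    then show ?thesis by (simp add: F_def w)
  next
    case False
    then have k: "k = n" using that by simp
    have "leval (F n) \<phi> \<Psi> (\<lambda>j. w j p) p = 1 / \<nu> n * (\<Psi> p - (\<Sum>j<n. \<nu> j * f j p))"
      by (simp add: F_def leval_lsum sum_negf w)
    also have "\<dots> = f n p"
      using \<nu>n \<Psi>[OF that(2)] by (simp add: lessThan_Suc_atMost[symmetric])
    finally show ?thesis using k by simp
  qed
  \<comment> \<open>The start of the chain has no predecessor to supply its y-derivative; it comes
    from differentiating the relation and dividing by \<open>\<nu> 0\<close>.\<close>
  have b0: "dy (f 0) p = leval (b 0) \<phi> \<Psi> (\<lambda>j. w j p) p" if p: "p \<in> U" for p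
  proof -
    have "dy \<Psi> p = dy (\<lambda>p. \<Sum>k\<le>n. \<nu> k * f k p) p"
      using dy_cong[OF \<Psi> p] .
    also have "\<dots> = (\<Sum>k\<le>n. \<nu> k * dy (f k) p)"
      using dy_sum[OF p, of "{..n}" "\<lambda>k p. \<nu> k * f k p"] p moutardD(1)[OF fm] by simp
    also have "\<dots> = \<nu> 0 * dy (f 0) p + (\<Sum>k<n. \<nu> (Suc k) * leval (Z k) \<phi> \<Psi> (\<lambda>j. w j p) p)"
      unfolding sum_head by (simp add: Z[OF _ p])
    finally have "\<nu> 0 * leval (b 0) \<phi> \<Psi> (\<lambda>j. w j p) p = \<nu> 0 * dy (f 0) p"
      unfolding leval_b0 by (simp add: pd_def)
    then show ?thesis using \<nu>0 by simp
  qed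
  have "smooth U (w i) \<and> (\<forall>p\<in>U. dx (w i) p = leval (a i) \<phi> \<Psi> (\<lambda>j. w j p) p \<and>
      dy (w i) p = leval (b i) \<phi> \<Psi> (\<lambda>j. w j p) p)" if i: "i < 3 * n" for i
  proof -
    from i show ?thesis
    proof (cases rule: index_cases)
      case 1
      then show ?thesis using w(2)[of 0] moutardD(1)[OF fm, of 0] b0
        by (simp add: w a_def)
    next
      case (2 k)
      then show ?thesis using moutardD(1)[OF fm, of "Suc k"] Z[of k] w(2)[of "Suc k"]
        by (simp add: w a_def b_def)
    next
      case (3 k)
      then show ?thesis
        using moutardD[OF fm, of k] F[of "Suc k"] q(4)[of k]
        by (simp add: w a_def b_def mult_2 pd_def add.assoc[symmetric] w(3)[unfolded mult_2])
    next
      case (4 k)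
      then show ?thesis
        using q[of k] by (simp add: w a_def b_def mult_2 pd_def w(3)[unfolded mult_2])
    qed
  qed
  then have "solves S U \<phi> \<Psi> w" by (simp add: solves_def)
  moreover have "\<forall>p\<in>U. \<Theta> p = leval (F 0) \<phi> \<Psi> (\<lambda>j. w j p) p"
    using F[of 0] f0 by simp
  ultimately show ?thesis by blast
qed

lemma realizes_inv_chain: "realizes S (F 0) (inv_chain \<nu> 0 n)"
  unfolding realizes_def
proof (intro conjI allI impI set_eqI closed_sys_S moutard_exp_F0)
  fix U \<phi> \<Psi> \<Theta> assume P: "moutard_pair U \<phi> \<Psi>"
  show "\<Theta> \<in> inv_chain \<nu> 0 n U \<phi> \<Psi> \<longleftrightarrow>
    \<Theta> \<in> {\<Theta>. \<exists>w. solves S U \<phi> \<Psi> w \<and> (\<forall>p\<in>U. \<Theta> p = leval (F 0) \<phi> \<Psi> (\<lambda>j. w j p) p)}"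
    unfolding mem_Collect_eq
  proof
    assume "\<Theta> \<in> inv_chain \<nu> 0 n U \<phi> \<Psi>"
    then show "\<exists>w. solves S U \<phi> \<Psi> w \<and> (\<forall>p\<in>U. \<Theta> p = leval (F 0) \<phi> \<Psi> (\<lambda>j. w j p) p)"
      by (rule chain_to_solution[OF P])
  next
    assume "\<exists>w. solves S U \<phi> \<Psi> w \<and> (\<forall>p\<in>U. \<Theta> p = leval (F 0) \<phi> \<Psi> (\<lambda>j. w j p) p)"
    then show "\<Theta> \<in> inv_chain \<nu> 0 n U \<phi> \<Psi>"
      by (elim exE conjE) (rule solution_to_chain[OF P])
  qed
qed

end

lemma realizes_cong:
  assumes "realizes S e T"
    and "\<And>U \<phi> \<Psi>. moutard_pair U \<phi> \<Psi> \<Longrightarrow> T' U \<phi> \<Psi> = T U \<phi> \<Psi>"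
  shows "realizes S e T'"
  using assms by (simp add: realizes_def)

section \<open>Powers and polynomials of the recursion operator in terms of chains\<close>

context sg_solution
begin

text \<open>The first link is read backwards: \<open>f 1 \<in> \<R> (f 0)\<close> means that
  \<open>f 0\<close> is a value of the mirrored operator at \<open>f 1\<close>, and the rest is a
  chain with one initial link fewer.\<close>

lemma inv_chain_Suc:
  assumes \<Psi>: "moutard U \<phi> \<Psi>"
  shows "inv_chain \<nu> (Suc l) n U \<phi> \<Psi> = mop_comp (sg_recursion_y U \<phi>) (inv_chain \<nu> l n U \<phi>) \<Psi>"
proof (intro set_eqI iffI)
  fix \<Phi> assume "\<Phi> \<in> inv_chain \<nu> (Suc l) n U \<phi> \<Psi>"
  then obtain f where f: "moutard U \<phi> (f 0)" "f 0 = \<Phi>" "R_chain U \<phi> (Suc l + n) f"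
    "\<forall>p\<in>U. \<Psi> p = (\<Sum>k\<le>n. \<nu> k * f (Suc l + k) p)"
    unfolding inv_chain_def by auto
  have f1: "f 1 \<in> sg_recursion U \<phi> (f 0)" "moutard U \<phi> (f 1)"
    using f(3) R_chain_moutard[OF f(1,3), of 1] by (simp_all add: R_chain_def)
  have "R_chain U \<phi> (l + n) (\<lambda>k. f (Suc k))"
    using f(3) by (simp add: R_chain_def)
  then have "f 1 \<in> inv_chain \<nu> l n U \<phi> \<Psi>"
    unfolding inv_chain_def mem_Collect_eq using f(4) f1(2)
    by (intro conjI exI[of _ "\<lambda>k. f (Suc k)"]) simp_all
  moreover have "\<Phi> \<in> sg_recursion_y U \<phi> (f 1)"
    unfolding mop_inv_sg_recursion[OF f1(2), symmetric] mop_inv_def using f(1,2) f1(1) by simp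
  ultimately show "\<Phi> \<in> mop_comp (sg_recursion_y U \<phi>) (inv_chain \<nu> l n U \<phi>) \<Psi>"
    unfolding mop_comp_def by (rule UN_I[where a = "f 1"])
next
  fix \<Phi> assume "\<Phi> \<in> mop_comp (sg_recursion_y U \<phi>) (inv_chain \<nu> l n U \<phi>) \<Psi>"
  then obtain f where f: "moutard U \<phi> (f 0)" "R_chain U \<phi> (l + n) f"
    "\<forall>p\<in>U. \<Psi> p = (\<Sum>k\<le>n. \<nu> k * f (l + k) p)" and "\<Phi> \<in> sg_recursion_y U \<phi> (f 0)"
    unfolding mop_comp_def inv_chain_def by auto
  then have \<Phi>: "moutard U \<phi> \<Phi>" "f 0 \<in> sg_recursion U \<phi> \<Phi>"
    unfolding mop_inv_sg_recursion[OF f(1), symmetric] mop_inv_def by simp_all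
  define g where "g k = (case k of 0 \<Rightarrow> \<Phi> | Suc k \<Rightarrow> f k)" for k
  have "R_chain U \<phi> (Suc l + n) g"
    using f(2) \<Phi>(2) by (auto simp: R_chain_def g_def split: nat.split)
  then show "\<Phi> \<in> inv_chain \<nu> (Suc l) n U \<phi> \<Psi>"
    unfolding inv_chain_def mem_Collect_eq using f(3) \<Phi>(1)
    by (intro conjI exI[of _ g]) (simp_all add: g_def)
qed

lemma sg_recursion_eq:
  assumes "\<And>p. p \<in> U \<Longrightarrow> f p = g p"
  shows "sg_recursion U \<phi> f = sg_recursion U \<phi> g"
  using cong_opD[OF cong_op_sg_recursion open_U] assms by blast

lemma mop_pow_iff:
  "\<Psi> \<in> mop_pow U (sg_recursion U \<phi>) n \<Phi> \<longleftrightarrow> (\<exists>f. f 0 = \<Phi> \<and> R_chain U \<phi> n f \<and> (\<forall>p\<in>U. \<Psi> p = f n p))"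
proof (induction n arbitrary: \<Psi>)
  case 0
  show ?case by (auto simp: mop_id_def R_chain_def)
next
  case (Suc n)
  show ?case
  proof
    assume "\<Psi> \<in> mop_pow U (sg_recursion U \<phi>) (Suc n) \<Phi>"
    then obtain \<eta> where "\<eta> \<in> mop_pow U (sg_recursion U \<phi>) n \<Phi>" and \<Psi>: "\<Psi> \<in> sg_recursion U \<phi> \<eta>"
      by (auto simp: mop_comp_def)
    then obtain f where f: "f 0 = \<Phi>" "R_chain U \<phi> n f" "\<forall>p\<in>U. \<eta> p = f n p"
      using Suc.IH by blast
    have "\<Psi> \<in> sg_recursion U \<phi> (f n)"
      using \<Psi> sg_recursion_eq[of \<eta> "f n"] f(3) by simp
    then have "R_chain U \<phi> (Suc n) (f(Suc n := \<Psi>))"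
      using f(2) by (auto simp: R_chain_def less_Suc_eq)
    then show "\<exists>f. f 0 = \<Phi> \<and> R_chain U \<phi> (Suc n) f \<and> (\<forall>p\<in>U. \<Psi> p = f (Suc n) p)"
      using f(1) by (intro exI[of _ "f(Suc n := \<Psi>)"]) simp
  next
    assume "\<exists>f. f 0 = \<Phi> \<and> R_chain U \<phi> (Suc n) f \<and> (\<forall>p\<in>U. \<Psi> p = f (Suc n) p)"
    then obtain f where f: "f 0 = \<Phi>" "R_chain U \<phi> (Suc n) f" "\<forall>p\<in>U. \<Psi> p = f (Suc n) p"
      by (elim exE conjE)
    have "f n \<in> mop_pow U (sg_recursion U \<phi>) n \<Phi>"
      unfolding Suc.IH using f(1,2) by (intro exI[of _ f]) (simp add: R_chain_def)
    moreover have "f (Suc n) \<in> sg_recursion U \<phi> (f n)"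
      using f(2) by (simp add: R_chain_def)
    then have "\<Psi> \<in> sg_recursion U \<phi> (f n)"
      using f(3) unfolding sg_recursion_def by simp
    ultimately show "\<Psi> \<in> mop_pow U (sg_recursion U \<phi>) (Suc n) \<Phi>"
      by (auto simp: mop_comp_def)
  qed
qed

lemma mop_poly_upto_iff:
  "\<Psi> \<in> mop_poly_upto U T \<nu> n \<Phi> \<longleftrightarrow>
    (\<exists>g. (\<forall>k\<le>n. g k \<in> mop_pow U T k \<Phi>) \<and> (\<forall>p\<in>U. \<Psi> p = (\<Sum>k\<le>n. \<nu> k * g k p)))"
proof (induction n arbitrary: \<Psi>)
  case 0
  show ?case
  proof
    assume "\<Psi> \<in> mop_poly_upto U T \<nu> 0 \<Phi>"
    then obtain f where "f \<in> mop_id U \<Phi>" "\<forall>p\<in>U. \<Psi> p = \<nu> 0 * f p"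
      unfolding mop_poly_upto.simps mop_scale_def by blast
    then show "\<exists>g. (\<forall>k\<le>0. g k \<in> mop_pow U T k \<Phi>) \<and> (\<forall>p\<in>U. \<Psi> p = (\<Sum>k\<le>0. \<nu> k * g k p))"
      by (intro exI[of _ "\<lambda>_. f"]) simp
  next
    assume "\<exists>g. (\<forall>k\<le>0. g k \<in> mop_pow U T k \<Phi>) \<and> (\<forall>p\<in>U. \<Psi> p = (\<Sum>k\<le>0. \<nu> k * g k p))"
    then obtain g where "\<forall>k\<le>0. g k \<in> mop_pow U T k \<Phi>" "\<forall>p\<in>U. \<Psi> p = (\<Sum>k\<le>0. \<nu> k * g k p)"
      by (elim exE conjE)
    then show "\<Psi> \<in> mop_poly_upto U T \<nu> 0 \<Phi>"
      unfolding mop_poly_upto.simps mop_scale_def mem_Collect_eq by (intro bexI[of _ "g 0"]) simp_all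
  qed
next
  case (Suc n)
  show ?case
  proof
    assume "\<Psi> \<in> mop_poly_upto U T \<nu> (Suc n) \<Phi>"
    then obtain f F h where f: "f \<in> mop_pow U T (Suc n) \<Phi>" "\<forall>p\<in>U. F p = \<nu> (Suc n) * f p"
      and h: "h \<in> mop_poly_upto U T \<nu> n \<Phi>" "\<forall>p\<in>U. \<Psi> p = F p + h p"
      by (auto simp: mop_add_def mop_scale_def simp del: mop_pow.simps)
    obtain g where g: "\<forall>k\<le>n. g k \<in> mop_pow U T k \<Phi>" "\<forall>p\<in>U. h p = (\<Sum>k\<le>n. \<nu> k * g k p)"
      using h(1) Suc.IH by blast
    show "\<exists>g. (\<forall>k\<le>Suc n. g k \<in> mop_pow U T k \<Phi>) \<and> (\<forall>p\<in>U. \<Psi> p = (\<Sum>k\<le>Suc n. \<nu> k * g k p))"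
      using f g h(2) by (intro exI[of _ "g(Suc n := f)"]) (auto simp: le_Suc_eq simp del: mop_pow.simps)
  next
    assume "\<exists>g. (\<forall>k\<le>Suc n. g k \<in> mop_pow U T k \<Phi>) \<and> (\<forall>p\<in>U. \<Psi> p = (\<Sum>k\<le>Suc n. \<nu> k * g k p))"
    then obtain g where g: "\<forall>k\<le>Suc n. g k \<in> mop_pow U T k \<Phi>" "\<forall>p\<in>U. \<Psi> p = (\<Sum>k\<le>Suc n. \<nu> k * g k p)"
      by (elim exE conjE)
    have 1: "(\<lambda>p. \<Sum>k\<le>n. \<nu> k * g k p) \<in> mop_poly_upto U T \<nu> n \<Phi>"
      unfolding Suc.IH using g(1) by (intro exI[of _ g]) simp
    have 2: "(\<lambda>p. \<nu> (Suc n) * g (Suc n) p) \<in> mop_scale U (\<nu> (Suc n)) (mop_pow U T (Suc n)) \<Phi>"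
      unfolding mop_scale_def mem_Collect_eq by (rule bexI[of _ "g (Suc n)"]) (use g(1) in \<open>simp_all del: mop_pow.simps\<close>)
    show "\<Psi> \<in> mop_poly_upto U T \<nu> (Suc n) \<Phi>"
      unfolding mop_poly_upto.simps mop_add_def mem_Collect_eq
      by (rule bexI[OF bexI[OF _ 1] 2]) (simp add: g(2))
  qed
qed

section \<open>Linearity, and the ambiguity of values as chains that start at zero\<close>

lemma sg_recursion_linear:
  assumes f: "moutard U \<phi> f" "f' \<in> sg_recursion U \<phi> f" and t: "moutard U \<phi> t" "t' \<in> sg_recursion U \<phi> t"
  shows "(\<lambda>p. f' p + c * t' p) \<in> sg_recursion U \<phi> (\<lambda>p. f p + c * t p)"
proof -
  obtain q where q: "smooth U q" "\<forall>p\<in>U. dx q p = dx f p * dx \<phi> p \<and> dy q p = f p * sin (\<phi> p) \<and>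
      f' p = dx (dx f) p + dx \<phi> p * q p"
    using f(2) unfolding sg_recursion_def by blast
  obtain r where r: "smooth U r" "\<forall>p\<in>U. dx r p = dx t p * dx \<phi> p \<and> dy r p = t p * sin (\<phi> p) \<and>
      t' p = dx (dx t) p + dx \<phi> p * r p"
    using t(2) unfolding sg_recursion_def by blast
  note [simp] = moutardD(1)[OF f(1)] moutardD(1)[OF t(1)] q(1) r(1)
  have d: "dx (\<lambda>p. f p + c * t p) p = dx f p + c * dx t p" if "p \<in> U" for p
    using that by simp
  have dd: "dx (dx (\<lambda>p. f p + c * t p)) p = dx (dx f) p + c * dx (dx t) p" if "p \<in> U" for p
    using dx_cong[OF d that] that by simp
  show ?thesis unfolding sg_recursion_def mem_Collect_eq
    using q(2) r(2) by (intro exI[of _ "\<lambda>p. q p + c * r p"]) (simp add: d dd algebra_simps)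
qed

lemma R_chain_linear:
  assumes "moutard U \<phi> (f 0)" "R_chain U \<phi> n f" "moutard U \<phi> (t 0)" "R_chain U \<phi> n t"
  shows "R_chain U \<phi> n (\<lambda>k p. f k p + c * t k p)"
  unfolding R_chain_def
proof (intro allI impI)
  fix k assume k: "k < n"
  show "(\<lambda>p. f (Suc k) p + c * t (Suc k) p) \<in> sg_recursion U \<phi> (\<lambda>p. f k p + c * t k p)"
    using assms(2,4) k R_chain_moutard[OF assms(1,2), of k] R_chain_moutard[OF assms(3,4), of k]
    by (intro sg_recursion_linear) (simp_all add: R_chain_def)
qed

lemma moutard_zero: "moutard U \<phi> (\<lambda>_. 0)"
proof -
  have "dy (dx (\<lambda>_. 0)) p = 0" if "p \<in> U" for p
    using dy_cong[of "dx (\<lambda>_. 0)" "\<lambda>_. 0" p] that by simp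
  then show ?thesis by (simp add: moutard_def)
qed

lemma zero_in_sg_recursion: "(\<lambda>_. 0) \<in> sg_recursion U \<phi> (\<lambda>_. 0)"
proof -
  have "dx (dx (\<lambda>_. 0)) p = 0" if "p \<in> U" for p
    using dx_cong[of "dx (\<lambda>_. 0)" "\<lambda>_. 0" p] that by simp
  then show ?thesis
    unfolding sg_recursion_def mem_Collect_eq by (intro exI[of _ "\<lambda>_. 0"]) simp
qed

definition null_chain :: "nat \<Rightarrow> (nat \<Rightarrow> pfun) \<Rightarrow> bool" where
  "null_chain n t \<longleftrightarrow> t 0 = (\<lambda>_. 0) \<and> R_chain U \<phi> n t"

text \<open>The ambiguity of the polynomial evaluated along one chain: two chains with the same
  start differ by a chain starting at 0.\<close>

definition null_values :: "(nat \<Rightarrow> real) \<Rightarrow> nat \<Rightarrow> pfun set" where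
  "null_values \<nu> n = {h. \<exists>t. null_chain n t \<and> (\<forall>p\<in>U. h p = (\<Sum>k\<le>n. \<nu> k * t k p))}"

lemma null_values_linear:
  assumes "g \<in> null_values \<nu> n" "h \<in> null_values \<nu> n"
  shows "(\<lambda>p. g p + c * h p) \<in> null_values \<nu> n"
proof -
  obtain s t where s: "null_chain n s" "\<forall>p\<in>U. g p = (\<Sum>k\<le>n. \<nu> k * s k p)"
    and t: "null_chain n t" "\<forall>p\<in>U. h p = (\<Sum>k\<le>n. \<nu> k * t k p)"
    using assms unfolding null_values_def by blast
  have "null_chain n (\<lambda>k p. s k p + c * t k p)"
    using R_chain_linear[of s n t c] s(1) t(1) moutard_zero by (simp add: null_chain_def)
  then show ?thesis unfolding null_values_def mem_Collect_eq
    using s(2) t(2) by (intro exI[of _ "\<lambda>k p. s k p + c * t k p"])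
      (simp add: sum.distrib sum_distrib_left algebra_simps)
qed

lemma null_values_zero: "(\<lambda>_. 0) \<in> null_values \<nu> n"
  unfolding null_values_def mem_Collect_eq null_chain_def R_chain_def
  using zero_in_sg_recursion by (intro exI[of _ "\<lambda>_ _. 0"]) simp

lemma null_values_sum:
  "(\<And>i. i < (m::nat) \<Longrightarrow> h i \<in> null_values \<nu> n) \<Longrightarrow> (\<lambda>p. \<Sum>i<m. c i * h i p) \<in> null_values \<nu> n"
proof (induction m)
  case 0
  show ?case using null_values_zero by simp
next
  case (Suc m)
  then show ?case using null_values_linear[of "\<lambda>p. \<Sum>i<m. c i * h i p" \<nu> n "h m" "c m"] by simp
qed

text \<open>
  Prepending zeros to a chain of length \<open>j\<close> that starts at \<open>0\<close> makes its last element
  the leading term of an element of \<open>null_values \<nu> n\<close>; the lower terms are removed by induction.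
\<close>

lemma null_chain_values:
  assumes \<nu>: "\<nu> n \<noteq> 0"
    and "null_chain j t" "j \<le> n"
  shows "t j \<in> null_values \<nu> n"
  using assms(2,3)
proof (induction j rule: less_induct)
  case (less j)
  \<comment> \<open>The number of zeros to prepend, so that \<open>t j\<close> lands at position
    \<open>n\<close> with the nonvanishing coefficient \<open>\<nu> n\<close>.\<close>
  define d where "d = n - j"
  have n: "n = d + j" using less.prems by (simp add: d_def)
  have t: "t i \<in> null_values \<nu> n" if "i < j" for i
    using less.prems that by (intro less.IH) (simp_all add: null_chain_def R_chain_def)
  define s where "s k = (if k < d then (\<lambda>_. 0) else t (k - d))" for k
  have "s (Suc k) \<in> sg_recursion U \<phi> (s k)" if k: "k < n" for k
  proof -
    \<comment> \<open>Links inside the zeros, the link from the last zero to \<open>t 0\<close>,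
      which is again zero, and the links of \<open>t\<close>.\<close>
    consider "Suc k < d" | "Suc k = d" | i where "k = d + i" "i < j"
    proof -
      consider "Suc k < d" | "Suc k = d" | "d \<le> k" by linarith
      then show thesis
      proof cases
        case 3
        with k n that(3)[of "k - d"] show thesis by simp
      qed (fact that(1,2))+
    qed
    then show ?thesis
    proof cases
      case 3
      then show ?thesis
        using less.prems(1) by (simp add: s_def null_chain_def R_chain_def Suc_diff_le)
    qed (use zero_in_sg_recursion less.prems(1) in \<open>simp_all add: s_def null_chain_def\<close>)
  qed
  moreover have "s 0 = (\<lambda>_. 0)"
    using less.prems(1) by (simp add: s_def null_chain_def)
  ultimately have s: "(\<lambda>p. \<Sum>k\<le>n. \<nu> k * s k p) \<in> null_values \<nu> n"
    unfolding null_values_def mem_Collect_eq by (intro exI[of _ s]) (simp add: null_chain_def R_chain_def)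
  have split: "(\<Sum>k\<le>n. \<nu> k * s k p) = (\<Sum>i<j. \<nu> (d + i) * t i p) + \<nu> n * t j p" for p
  proof -
    have "(\<Sum>k<d + m. \<nu> k * s k p) = (\<Sum>i<m. \<nu> (d + i) * t i p)" for m
      by (induction m) (simp_all add: s_def)
    from this[of "Suc j"] show ?thesis by (simp add: n lessThan_Suc_atMost[symmetric])
  qed
  have "(\<lambda>p. \<Sum>i<j. \<nu> (d + i) * t i p) \<in> null_values \<nu> n"
    by (rule null_values_sum) (rule t)
  then have "(\<lambda>p. (\<Sum>k\<le>n. \<nu> k * s k p) + (- 1) * (\<Sum>i<j. \<nu> (d + i) * t i p)) \<in> null_values \<nu> n"
    by (rule null_values_linear[OF s])
  then have "(\<lambda>p. \<nu> n * t j p) \<in> null_values \<nu> n"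
    unfolding split by simp
  then have "(\<lambda>p. 0 + (1 / \<nu> n) * (\<nu> n * t j p)) \<in> null_values \<nu> n"
    by (rule null_values_linear[OF null_values_zero])
  then show ?case using \<nu> by simp
qed

text \<open>Replacing the separate chains by a single one changes each power by the end of a chain
  starting at 0. Those ends lie in the linear set \<open>null_values\<close>, so one correction of
  the single chain absorbs the total change.\<close>

lemma mop_poly_iff:
  assumes \<Phi>: "moutard U \<phi> \<Phi>" and \<nu>: "\<nu> n \<noteq> 0"
  shows "\<Psi> \<in> mop_poly_upto U (sg_recursion U \<phi>) \<nu> n \<Phi> \<longleftrightarrow>
    (\<exists>f. f 0 = \<Phi> \<and> R_chain U \<phi> n f \<and> (\<forall>p\<in>U. \<Psi> p = (\<Sum>k\<le>n. \<nu> k * f k p)))"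
proof
  assume "\<Psi> \<in> mop_poly_upto U (sg_recursion U \<phi>) \<nu> n \<Phi>"
  then obtain g where g: "\<forall>k\<le>n. g k \<in> mop_pow U (sg_recursion U \<phi>) k \<Phi>"
    and \<Psi>: "\<forall>p\<in>U. \<Psi> p = (\<Sum>k\<le>n. \<nu> k * g k p)"
    unfolding mop_poly_upto_iff by (elim exE conjE)
  define ch where "ch k h \<longleftrightarrow> h 0 = \<Phi> \<and> R_chain U \<phi> k h \<and> (\<forall>p\<in>U. g k p = h k p)" for k h
  define h where "h k = (SOME h. ch k h)" for k
  have h: "h k 0 = \<Phi> \<and> R_chain U \<phi> k (h k) \<and> (\<forall>p\<in>U. g k p = h k k p)" if "k \<le> n" for k
  proof -
    have "\<exists>h. ch k h" using g[rule_format, OF that] unfolding mop_pow_iff ch_def .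
    then have "ch k (h k)" unfolding h_def by (rule someI_ex)
    then show ?thesis unfolding ch_def .
  qed
  \<comment> \<open>The chain of the top power is long enough to stand in for all lower
    powers.\<close>
  define f where "f = h n"
  have f: "f 0 = \<Phi>" "R_chain U \<phi> n f" using h[of n] by (simp_all add: f_def)
  have diff: "(\<lambda>p. h k k p + (- 1) * f k p) \<in> null_values \<nu> n" if k: "k \<le> n" for k
  proof -
    have fk: "R_chain U \<phi> k f" using f(2) k by (simp add: R_chain_def)
    have "null_chain k (\<lambda>i p. h k i p + (- 1) * f i p)"
      using R_chain_linear[of "h k" k f "- 1"] h[OF k] f fk \<Phi> by (simp add: null_chain_def)
    from null_chain_values[where \<nu> = \<nu> and n = n and j = k and t = "\<lambda>i p. h k i p + (- 1) * f i p", OF \<nu> this k] show ?thesis by simp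
  qed
  have "(\<lambda>p. \<Sum>k<Suc n. \<nu> k * (h k k p + (- 1) * f k p)) \<in> null_values \<nu> n"
    by (rule null_values_sum) (rule diff, simp)
  then obtain t where t: "null_chain n t"
    "\<forall>p\<in>U. (\<Sum>k<Suc n. \<nu> k * (h k k p + (- 1) * f k p)) = (\<Sum>k\<le>n. \<nu> k * t k p)"
    unfolding null_values_def mem_Collect_eq by (elim exE conjE)
  \<comment> \<open>\<open>t\<close> realizes the total discrepancy along one chain from 0, so
    adding it corrects the value without moving the start \<open>\<Phi>\<close>.\<close>
  have "R_chain U \<phi> n (\<lambda>k p. f k p + 1 * t k p)"
    using f t(1) \<Phi> moutard_zero by (intro R_chain_linear) (simp_all add: null_chain_def)
  moreover have "\<Psi> p = (\<Sum>k\<le>n. \<nu> k * (f k p + 1 * t k p))" if p: "p \<in> U" for p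
  proof -
    have "\<Psi> p = (\<Sum>k\<le>n. \<nu> k * h k k p)"
      using \<Psi> h p by simp
    also have "\<dots> = (\<Sum>k\<le>n. \<nu> k * f k p) + (\<Sum>k<Suc n. \<nu> k * (h k k p + (- 1) * f k p))"
      by (simp add: lessThan_Suc_atMost right_diff_distrib sum_subtractf del: sum.lessThan_Suc)
    also have "\<dots> = (\<Sum>k\<le>n. \<nu> k * f k p) + (\<Sum>k\<le>n. \<nu> k * t k p)"
      using t(2) p by (simp del: sum.lessThan_Suc)
    finally show ?thesis by (simp add: distrib_left sum.distrib)
  qed
  moreover have "(\<lambda>p. f 0 p + 1 * t 0 p) = \<Phi>"
    using f(1) t(1) by (simp add: null_chain_def)
  ultimately show "\<exists>f. f 0 = \<Phi> \<and> R_chain U \<phi> n f \<and> (\<forall>p\<in>U. \<Psi> p = (\<Sum>k\<le>n. \<nu> k * f k p))"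
    by (intro exI[of _ "\<lambda>k p. f k p + 1 * t k p"] conjI ballI)
next
  assume "\<exists>f. f 0 = \<Phi> \<and> R_chain U \<phi> n f \<and> (\<forall>p\<in>U. \<Psi> p = (\<Sum>k\<le>n. \<nu> k * f k p))"
  then obtain f where f: "f 0 = \<Phi>" "R_chain U \<phi> n f" "\<forall>p\<in>U. \<Psi> p = (\<Sum>k\<le>n. \<nu> k * f k p)"
    by (elim exE conjE)
  have "f k \<in> mop_pow U (sg_recursion U \<phi>) k \<Phi>" if "k \<le> n" for k
    unfolding mop_pow_iff using f(1,2) that by (intro exI[of _ f]) (simp add: R_chain_def)
  then show "\<Psi> \<in> mop_poly_upto U (sg_recursion U \<phi>) \<nu> n \<Phi>"
    unfolding mop_poly_upto_iff using f(3) by (intro exI[of _ f]) simp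
qed

end

lemma realizes_inv_poly:
  assumes Q: "Q \<noteq> (0 :: real poly)"
  shows "\<exists>S e. realizes S e (\<lambda>U \<phi>. mop_inv U \<phi> (mop_poly U (sg_recursion U \<phi>) Q))"
proof -
  \<comment> \<open>The multiplicity of the root 0: splitting off this power leaves coefficients
    \<open>\<nu>\<close> with nonzero first and last entries.\<close>
  define l where "l = (LEAST k. coeff Q k \<noteq> 0)"
  have lead: "coeff Q (degree Q) \<noteq> 0" using Q by simp
  have l: "coeff Q l \<noteq> 0" "l \<le> degree Q" "\<And>k. k < l \<Longrightarrow> coeff Q k = 0"
    unfolding l_def using LeastI[of "\<lambda>k. coeff Q k \<noteq> 0", OF lead] Least_le[of "\<lambda>k. coeff Q k \<noteq> 0", OF lead]
      not_less_Least by blast+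
  define n where "n = degree Q - l"
  define \<nu> where "\<nu> k = coeff Q (l + k)" for k
  have deg: "degree Q = l + n" using l(2) by (simp add: n_def)
  interpret inverse_system \<nu> n
    using l(1) lead by unfold_locales (simp_all add: \<nu>_def deg)
  have "\<exists>S e. realizes S e (inv_chain \<nu> m n)" for m
  proof (induction m)
    case 0
    then show ?case using realizes_inv_chain by blast
  next
    case (Suc m)
    then obtain S e where "realizes S e (inv_chain \<nu> m n)" by blast
    then obtain S' e' where "realizes S' e' (\<lambda>U \<phi>. mop_comp (sg_recursion_y U \<phi>) (inv_chain \<nu> m n U \<phi>))"
      using realizes_comp[OF _ ext_op_sg_recursion_y cong_op_sg_recursion_y] by blast
    then have "realizes S' e' (inv_chain \<nu> (Suc m) n)"
      by (rule realizes_cong) (simp add: moutard_pair_def moutard_pair_axioms_def sg_solution.inv_chain_Suc)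
    then show ?case by blast
  qed
  then obtain S e where R: "realizes S e (inv_chain \<nu> l n)" by blast
  have low: "(\<Sum>k\<le>l + n. coeff Q k * g k) = (\<Sum>k\<le>n. \<nu> k * g (l + k))" for g :: "nat \<Rightarrow> real"
  proof -
    have "(\<Sum>k<l + m. coeff Q k * g k) = (\<Sum>k<m. \<nu> k * g (l + k))" for m
      by (induction m) (simp_all add: \<nu>_def l(3))
    from this[of "Suc n"] show ?thesis by (simp add: lessThan_Suc_atMost[symmetric])
  qed
  have "realizes S e (\<lambda>U \<phi>. mop_inv U \<phi> (mop_poly U (sg_recursion U \<phi>) Q))"
  proof (rule realizes_cong[OF R])
    fix U \<phi> \<Psi> assume "moutard_pair U \<phi> \<Psi>"
    then interpret moutard_pair U \<phi> \<Psi> .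
    show "mop_inv U \<phi> (mop_poly U (sg_recursion U \<phi>) Q) \<Psi> = inv_chain \<nu> l n U \<phi> \<Psi>"
      unfolding mop_inv_def inv_chain_def mop_poly_def deg
      using mop_poly_iff[of _ "coeff Q" "l + n"] lead low[of "\<lambda>k. f k p" for f :: "nat \<Rightarrow> pfun" and p]
      by (intro Collect_cong conj_cong refl) (simp add: deg)
  qed
  then show ?thesis by blast
qed

section \<open>From expressions to jet functions\<close>

primrec coefW :: "lexp \<Rightarrow> nat \<Rightarrow> coef" where
  "coefW LZero j = CConst 0"
| "coefW (LVar i) j = CConst (if i = j then 1 else 0)"
| "coefW (LPsi k l) j = CConst 0"
| "coefW (LAdd e f) j = CAdd (coefW e j) (coefW f j)"
| "coefW (LMul c e) j = CMul c (coefW e j)"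

primrec coefP :: "lexp \<Rightarrow> nat \<Rightarrow> nat \<Rightarrow> coef" where
  "coefP LZero i j = CConst 0"
| "coefP (LVar k) i j = CConst 0"
| "coefP (LPsi k l) i j = CConst (if i = k \<and> j = l then 1 else 0)"
| "coefP (LAdd e f) i j = CAdd (coefP e i j) (coefP f i j)"
| "coefP (LMul c e) i j = CMul c (coefP e i j)"

primrec psi_ord :: "lexp \<Rightarrow> nat" where
  "psi_ord LZero = 0"
| "psi_ord (LVar i) = 0"
| "psi_ord (LPsi k l) = max k l"
| "psi_ord (LAdd e f) = max (psi_ord e) (psi_ord f)"
| "psi_ord (LMul c e) = psi_ord e"

lemma leval_normal_form:
  assumes "vars_below m e" "psi_ord e \<le> N"
  shows "leval e \<phi> \<Psi> v p = (\<Sum>j<m. cev (coefW e j) (jet \<phi> p) * v j) +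
    lin_diff N (\<lambda>i j. cev (coefP e i j)) \<phi> \<Psi> p"
  using assms
proof (induction e)
  case LZero
  show ?case by (simp add: lin_diff_def)
next
  case (LVar i)
  then show ?case by (simp add: lin_diff_def if_distrib[where f = "\<lambda>x. x * _"] cong: if_cong)
next
  case (LPsi k l)
  have "lin_diff N (\<lambda>i j. cev (coefP (LPsi k l) i j)) \<phi> \<Psi> p =
      (\<Sum>i\<le>N. \<Sum>j\<le>N. if j = l then (if i = k then pd i j \<Psi> p else 0) else 0)"
    unfolding lin_diff_def by (intro sum.cong refl) auto
  also have "\<dots> = pd k l \<Psi> p"
    using LPsi by (simp add: sum.delta)
  finally have *: "lin_diff N (\<lambda>i j. cev (coefP (LPsi k l) i j)) \<phi> \<Psi> p = pd k l \<Psi> p" .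
  show ?case unfolding * by simp
next
  case (LAdd e f)
  then show ?case by (simp add: lin_diff_def sum.distrib algebra_simps)
next
  case (LMul c e)
  then show ?case by (simp add: lin_diff_def sum_distrib_left algebra_simps)
qed

text \<open>Separates the derivative with frozen unknowns from the part caused by their motion, the
  form in which \<open>compatible\<close> is stated.\<close>

lemma leval_DX_split:
  assumes "vars_below m e"
  shows "leval (DX a e) \<phi> \<Psi> v p = leval (DX (\<lambda>_. LZero) e) \<phi> \<Psi> v p +
      (\<Sum>j<m. cev (coefW e j) (jet \<phi> p) * leval (a j) \<phi> \<Psi> v p)"
    and "leval (DY a e) \<phi> \<Psi> v p = leval (DY (\<lambda>_. LZero) e) \<phi> \<Psi> v p +
      (\<Sum>j<m. cev (coefW e j) (jet \<phi> p) * leval (a j) \<phi> \<Psi> v p)"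
  using assms
  by (induction e) (simp_all add: if_distrib[where f = "\<lambda>x. x * _"] sum.distrib sum_distrib_left algebra_simps cong: if_cong)

lemma (in moutard_pair) dx_leval_fixed:
  assumes "p \<in> U"
  shows "dx (leval e \<phi> \<Psi> v) p = leval (DX (\<lambda>_. LZero) e) \<phi> \<Psi> v p"
    and "dy (leval e \<phi> \<Psi> v) p = leval (DY (\<lambda>_. LZero) e) \<phi> \<Psi> v p"
proof -
  obtain m where m: "vars_below m e" using ex_vars_below by blast
  show "dx (leval e \<phi> \<Psi> v) p = leval (DX (\<lambda>_. LZero) e) \<phi> \<Psi> v p"
    using leval_has_dx[OF assms m, of "\<lambda>i _. v i" "\<lambda>_. LZero"] by (intro dxI) simp
  show "dy (leval e \<phi> \<Psi> v) p = leval (DY (\<lambda>_. LZero) e) \<phi> \<Psi> v p"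
    using leval_has_dy[OF assms m, of "\<lambda>i _. v i" "\<lambda>_. LZero"] by (intro dyI) simp
qed

lemma background_moutard_pair: "background U \<phi> \<Longrightarrow> moutard U \<phi> \<Psi> \<Longrightarrow> moutard_pair U \<phi> \<Psi>"
  by unfold_locales (simp_all add: background_def)

text \<open>Only translation remains: collecting coefficients turns the expressions into matrices,
  and \<open>compatible\<close> becomes the identity of \<open>closed_sys\<close> evaluated at an
  arbitrary \<open>v\<close>.\<close>

lemma baecklund_auto_if_realizes:
  assumes R: "realizes S e T"
  shows "baecklund_auto T"
proof -
  have S: "closed_sys S" and e: "moutard_exp S e" and eS: "vars_below (arity S) e"
    using R by (simp_all add: realizes_def moutard_exp_def)
  \<comment> \<open>A crude common bound, since the record has a single order for all inhomogeneous
    terms and the output; the sum avoids a maximum over a possibly empty set.\<close>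
  define N where "N = psi_ord e + (\<Sum>i<arity S. psi_ord (fx S i) + psi_ord (fy S i))"
  have le: "psi_ord (fx S i) + psi_ord (fy S i) \<le> N" if "i < arity S" for i
    using member_le_sum[of i "{..<arity S}" "\<lambda>i. psi_ord (fx S i) + psi_ord (fy S i)"] that
    by (simp add: N_def)
  have N: "psi_ord e \<le> N" by (simp add: N_def)
  have Nx: "psi_ord (fx S i) \<le> N" "psi_ord (fy S i) \<le> N" if "i < arity S" for i
    using le[OF that] by simp_all
  have vb: "vars_below (arity S) (fx S i)" "vars_below (arity S) (fy S i)"
    "DY (fy S) (fx S i) \<doteq> DX (fx S) (fy S i)" if "i < arity S" for i
    using S that by (simp_all add: closed_sys_def)
  define G where "G = \<lparr>nvars = arity S, psi_order = N,
    matA = (\<lambda>i j. cev (coefW (fx S i) j)), matB = (\<lambda>i j. cev (coefW (fy S i) j)),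
    inhA = (\<lambda>i k l. cev (coefP (fx S i) k l)), inhB = (\<lambda>i k l. cev (coefP (fy S i) k l)),
    outW = (\<lambda>j. cev (coefW e j)), outPsi = (\<lambda>k l. cev (coefP e k l))\<rparr>"
  have rhs: "rhs_x G \<phi> \<Psi> v i = leval (fx S i) \<phi> \<Psi> v" "rhs_y G \<phi> \<Psi> v i = leval (fy S i) \<phi> \<Psi> v"
    if "i < arity S" for \<phi> \<Psi> v i
    by (rule ext, use that in \<open>simp add: rhs_x_def rhs_y_def G_def leval_normal_form[OF vb(1) Nx(1)]
      leval_normal_form[OF vb(2) Nx(2)]\<close>)+
  have out: "(\<Sum>i<nvars G. outW G i (jet \<phi> p) * v i) + lin_diff (psi_order G) (outPsi G) \<phi> \<Psi> p =
      leval e \<phi> \<Psi> v p" for \<phi> \<Psi> v p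
    by (simp add: G_def leval_normal_form[OF eS N])
  have "smooth_coeffs G"
    by (simp add: smooth_coeffs_def G_def jet_smooth_cev)
  moreover have "\<forall>U \<phi> \<Psi>. background U \<phi> \<and> moutard U \<phi> \<Psi> \<longrightarrow> compatible G U \<phi> \<Psi> \<and>
      (\<forall>\<Theta>\<in>correspondence G U \<phi> \<Psi>. moutard U \<phi> \<Theta>) \<and> T U \<phi> \<Psi> = correspondence G U \<phi> \<Psi>"
  proof (intro allI impI, elim conjE)
    fix U \<phi> \<Psi> assume that: "background U \<phi>" "moutard U \<phi> \<Psi>"
    interpret moutard_pair U \<phi> \<Psi> using background_moutard_pair that .
    have "compatible G U \<phi> \<Psi>" unfolding compatible_def
    proof (intro ballI allI impI)
      fix p v i assume p: "p \<in> U" and "i < nvars G"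
      then have i: "i < arity S" by (simp add: G_def)
      have "dy (leval (fx S i) \<phi> \<Psi> v) p + (\<Sum>j<arity S. cev (coefW (fx S i) j) (jet \<phi> p) * leval (fy S j) \<phi> \<Psi> v p) =
          leval (DY (fy S) (fx S i)) \<phi> \<Psi> v p"
        unfolding leval_DX_split(2)[where a = "fy S", OF vb(1)[OF i]] dx_leval_fixed(2)[OF p] ..
      also have "\<dots> = leval (DX (fx S) (fy S i)) \<phi> \<Psi> v p"
        using lequivD[OF vb(3)[OF i] moutard_pair_axioms p] .
      also have "\<dots> = dx (leval (fy S i) \<phi> \<Psi> v) p +
          (\<Sum>j<arity S. cev (coefW (fy S i) j) (jet \<phi> p) * leval (fx S j) \<phi> \<Psi> v p)"
        unfolding leval_DX_split(1)[where a = "fx S", OF vb(2)[OF i]] dx_leval_fixed(1)[OF p] ..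
      finally show "dy (rhs_x G \<phi> \<Psi> v i) p + (\<Sum>j<nvars G. matA G i j (jet \<phi> p) * rhs_y G \<phi> \<Psi> v j p) =
          dx (rhs_y G \<phi> \<Psi> v i) p + (\<Sum>j<nvars G. matB G i j (jet \<phi> p) * rhs_x G \<phi> \<Psi> v j p)"
        unfolding rhs[OF i] using rhs by (simp add: G_def)
    qed
    moreover have sol: "solves_system G U \<phi> \<Psi> w \<longleftrightarrow> solves S U \<phi> \<Psi> w" for w
    proof -
      have "nvars G = arity S" by (simp add: G_def)
      then show ?thesis unfolding solves_system_def solves_def by (simp add: rhs cong: conj_cong)
    qed
    have corr: "correspondence G U \<phi> \<Psi> =
        {\<Theta>. \<exists>w. solves S U \<phi> \<Psi> w \<and> (\<forall>p\<in>U. \<Theta> p = leval e \<phi> \<Psi> (\<lambda>j. w j p) p)}"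
      unfolding correspondence_def sol out ..
    moreover have "T U \<phi> \<Psi> = correspondence G U \<phi> \<Psi>"
      unfolding corr using R moutard_pair_axioms by (simp add: realizes_def)
    moreover have "moutard U \<phi> \<Theta>" if \<Theta>: "\<Theta> \<in> correspondence G U \<phi> \<Psi>" for \<Theta>
    proof -
      obtain w where w: "solves S U \<phi> \<Psi> w" "\<forall>p\<in>U. \<Theta> p = leval e \<phi> \<Psi> (\<lambda>j. w j p) p"
        using \<Theta> unfolding corr mem_Collect_eq by (elim exE conjE)
      show ?thesis
        by (rule moutard_cong[OF moutard_leval[OF w(1) S e]]) (simp add: w(2))
    qed
    ultimately show "compatible G U \<phi> \<Psi> \<and> (\<forall>\<Theta>\<in>correspondence G U \<phi> \<Psi>. moutard U \<phi> \<Theta>) \<and>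
      T U \<phi> \<Psi> = correspondence G U \<phi> \<Psi>"
      by (intro conjI ballI)
  qed
  ultimately show ?thesis
    unfolding baecklund_auto_def by (intro exI[of _ G] conjI)
qed

section \<open>Polynomials depend only on values in the domain, and the conclusion\<close>

lemma cong_op_pow:
  assumes "cong_op T"
  shows "cong_op (\<lambda>U \<phi>. mop_pow U (T U \<phi>) n)"
proof (induction n)
  case 0
  show ?case by (auto simp: cong_op_def mop_id_def)
next
  case (Suc n)
  show ?case unfolding cong_op_def
  proof (intro allI impI, elim conjE)
    fix U \<phi> and f g :: pfun assume "open U" "\<forall>p\<in>U. f p = g p"
    then have "mop_pow U (T U \<phi>) n f = mop_pow U (T U \<phi>) n g"
      by (rule cong_opD[OF Suc.IH])
    then show "mop_pow U (T U \<phi>) (Suc n) f = mop_pow U (T U \<phi>) (Suc n) g"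
      by (simp add: mop_comp_def)
  qed
qed

lemma cong_op_poly:
  assumes "cong_op T"
  shows "cong_op (\<lambda>U \<phi>. mop_poly U (T U \<phi>) P)"
proof -
  have "mop_poly_upto U (T U \<phi>) \<nu> n f = mop_poly_upto U (T U \<phi>) \<nu> n g"
    if fg: "open U" "\<forall>p\<in>U. f p = g p" for U \<phi> \<nu> n f g
  proof -
    have "mop_pow U (T U \<phi>) k f = mop_pow U (T U \<phi>) k g" for k
      by (rule cong_opD[OF cong_op_pow[OF assms] fg])
    from this[of 0] this show ?thesis
      by (induction n) (simp_all add: mop_add_def mop_scale_def del: mop_pow.simps(2))
  qed
  then show ?thesis unfolding cong_op_def mop_poly_def by blast
qed

theorem proposition9p5:
  fixes P Q :: "real poly"
  assumes "Q \<noteq> 0"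
  shows "baecklund_auto (\<lambda>U \<phi>.
    mop_comp (mop_poly U (sg_recursion U \<phi>) P) (mop_inv U \<phi> (mop_poly U (sg_recursion U \<phi>) Q)))"
proof -
  obtain S e where "realizes S e (\<lambda>U \<phi>. mop_inv U \<phi> (mop_poly U (sg_recursion U \<phi>) Q))"
    using realizes_inv_poly[OF assms] by blast
  from realizes_comp[OF this ext_op_poly[OF ext_op_sg_recursion cong_op_sg_recursion]
      cong_op_poly[OF cong_op_sg_recursion]]
  show ?thesis using baecklund_auto_if_realizes by blast
qed

end
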